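(* Let $E$ be a Banach lattice with dual $E'$. A bounded subset $A$ of $E$ is super weakly precompact if and only if it is $|\sigma|(E,E')$-totally bounded. (That is, $T(A)$ is relatively compact in $c_0$ for every almost Dunford-Pettis operator $T:E\to c_0$ if and only if $A$ is $|\sigma|(E,E')$-totally bounded.)
   Context: Operators are bounded linear operators. An operator $T:E\to X$ from a Banach lattice $E$ to a Banach space $X$ is almost Dunford-Pettis if $\|Tx_n\|\to 0$ for each disjoint weakly null sequence $(x_n)$ in $E$. A bounded subset $A$ of a Banach lattice $E$ is called super weakly precompact if $T(A)$ is relatively compact in $c_0$ for every almost Dunford-Pettis operator $T:E\to c_0$. The absolute weak topology $|\sigma|(E,E')$ on $E$ is the locally convex-solid topology generated by the lattice seminorms $p_f(x)=|f|(|x|)$, $f\in E'$. A set $A\subset E$ is $|\sigma|(E,E')$-totally bounded if for every $\varepsilon>0$ and every finite collection $\{f_1,\dots,f_n\}\subset E'$ there is a finite subset $\Phi\subset A$ with $A\subset \Phi+\bigcap_{i=1}^n\{x\in E:|f_i|(|x|)<\varepsilon\}$. *)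

theory Defs
  imports
    "HOL-Analysis.Analysis"
    "HOL-Library.Lattice_Algebras"
    "HOL-Library.Set_Algebras"
begin

section \<open>Banach lattices\<close>

class banach_lattice = banach + ordered_real_vector + lattice_ab_group_add_abs +
  assumes norm_mono_abs: "\<bar>x\<bar> \<le> \<bar>y\<bar> \<Longrightarrow> norm x \<le> norm y"

instance real :: banach_lattice
  by standard auto

lemma lattice_abs_le_iff:
  fixes x :: "'a::lattice_ab_group_add_abs"
  shows "\<bar>x\<bar> \<le> y \<longleftrightarrow> x \<le> y \<and> - x \<le> y"
  by (simp add: abs_lattice)

definition disjoint_seq :: "(nat \<Rightarrow> 'a::banach_lattice) \<Rightarrow> bool" where
  "disjoint_seq x \<longleftrightarrow> (\<forall>m n. m \<noteq> n \<longrightarrow> inf \<bar>x m\<bar> \<bar>x n\<bar> = 0)"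

definition weakly_null :: "(nat \<Rightarrow> 'a::real_normed_vector) \<Rightarrow> bool" where
  "weakly_null x \<longleftrightarrow> (\<forall>f :: 'a \<Rightarrow>\<^sub>L real. (\<lambda>n. f (x n)) \<longlonglongrightarrow> 0)"

definition almost_dunford_pettis :: "('a::banach_lattice \<Rightarrow>\<^sub>L 'b::banach) \<Rightarrow> bool" where
  "almost_dunford_pettis T \<longleftrightarrow>
     (\<forall>x. disjoint_seq x \<longrightarrow> weakly_null x \<longrightarrow> (\<lambda>n. norm (T (x n))) \<longlonglongrightarrow> 0)"


section \<open>The Banach space of real null sequences\<close>

typedef c0 = "{x :: nat \<Rightarrow> real. x \<longlonglongrightarrow> 0}"
  morphisms c0_nth Abs_c0
  by (rule exI[of _ "\<lambda>_. 0"]) simp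

setup_lifting type_definition_c0

lemma c0_nth_tendsto: "c0_nth x \<longlonglongrightarrow> 0"
  using c0_nth by simp

lemma c0_eqI: "(\<And>n. c0_nth x n = c0_nth y n) \<Longrightarrow> x = y"
  by (metis c0_nth_inject ext)

instantiation c0 :: real_vector
begin

lift_definition zero_c0 :: c0 is "\<lambda>_. 0" by simp
lift_definition plus_c0 :: "c0 \<Rightarrow> c0 \<Rightarrow> c0" is "\<lambda>x y n. x n + y n"
  by (rule tendsto_add_zero)
lift_definition uminus_c0 :: "c0 \<Rightarrow> c0" is "\<lambda>x n. - x n"
  using tendsto_minus by fastforce
lift_definition minus_c0 :: "c0 \<Rightarrow> c0 \<Rightarrow> c0" is "\<lambda>x y n. x n - y n"
  using tendsto_diff by fastforce
lift_definition scaleR_c0 :: "real \<Rightarrow> c0 \<Rightarrow> c0" is "\<lambda>r x n. r * x n"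
  by (rule tendsto_mult_right_zero)

instance
  by standard (transfer; simp add: algebra_simps)+

end

lemmas c0_nth_simps [simp] =
  zero_c0.rep_eq plus_c0.rep_eq uminus_c0.rep_eq minus_c0.rep_eq scaleR_c0.rep_eq

lemma c0_bdd_above: "bdd_above (range (\<lambda>n. \<bar>c0_nth x n\<bar>))"
proof -
  have "Bseq (c0_nth x)"
    using c0_nth_tendsto convergentI convergent_imp_Bseq by blast
  then obtain K where "\<And>n. \<bar>c0_nth x n\<bar> \<le> K"
    by (auto simp: Bseq_def)
  then show ?thesis by (auto intro!: bdd_aboveI)
qed

instantiation c0 :: real_normed_vector
begin

definition norm_c0 :: "c0 \<Rightarrow> real" where "norm_c0 x = (SUP n. \<bar>c0_nth x n\<bar>)"
definition dist_c0 :: "c0 \<Rightarrow> c0 \<Rightarrow> real" where "dist_c0 x y = norm (x - y)"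
definition sgn_c0 :: "c0 \<Rightarrow> c0" where "sgn_c0 x = x /\<^sub>R norm x"
definition uniformity_c0 :: "(c0 \<times> c0) filter"
  where "uniformity_c0 = (INF e\<in>{0 <..}. principal {(x, y). dist x y < e})"
definition open_c0 :: "c0 set \<Rightarrow> bool"
  where "open_c0 S = (\<forall>x\<in>S. \<forall>\<^sub>F (x', y) in uniformity. x' = x \<longrightarrow> y \<in> S)"

lemma c0_nth_le_norm: "\<bar>c0_nth x n\<bar> \<le> norm x"
  unfolding norm_c0_def by (rule cSUP_upper[OF _ c0_bdd_above]) simp

lemma c0_norm_le: "(\<And>n. \<bar>c0_nth x n\<bar> \<le> b) \<Longrightarrow> norm x \<le> b"
  unfolding norm_c0_def by (rule cSUP_least) auto

instance
proof
  fix x y :: c0 and r :: real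
  show "norm x = 0 \<longleftrightarrow> x = 0"
  proof
    assume "norm x = 0"
    then have "c0_nth x n = 0" for n using c0_nth_le_norm[of x n] by simp
    then show "x = 0" by (intro c0_eqI) simp
  qed (simp add: norm_c0_def)
  show "norm (x + y) \<le> norm x + norm y"
    using c0_nth_le_norm[of x] c0_nth_le_norm[of y]
    by (intro c0_norm_le) (smt (verit) c0_nth_simps(2))
  have le: "norm (s *\<^sub>R z) \<le> \<bar>s\<bar> * norm z" for s and z :: c0
    using c0_nth_le_norm[of z] by (intro c0_norm_le) (simp add: abs_mult mult_left_mono)
  show "norm (r *\<^sub>R x) = \<bar>r\<bar> * norm x"
  proof (cases "r = 0")
    case True then show ?thesis by (simp add: norm_c0_def)
  next
    case False
    then have "norm x \<le> \<bar>inverse r\<bar> * norm (r *\<^sub>R x)" using le[of "inverse r" "r *\<^sub>R x"] by simp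
    then have "\<bar>r\<bar> * norm x \<le> norm (r *\<^sub>R x)" using False by (simp add: field_simps)
    then show ?thesis using le[of r x] by simp
  qed
qed (rule dist_c0_def sgn_c0_def uniformity_c0_def open_c0_def)+

end

instance c0 :: banach
proof
  fix X :: "nat \<Rightarrow> c0" assume C: "Cauchy X"
  have near: "\<bar>c0_nth x n - c0_nth y n\<bar> \<le> dist x y" for x y n
    using c0_nth_le_norm[of "x - y" n] by (simp add: dist_norm)
  have "Cauchy (\<lambda>i. c0_nth (X i) n)" for n
    unfolding Cauchy_def dist_real_def using C near unfolding Cauchy_def by (meson le_less_trans)
  then have "\<exists>l. (\<lambda>i. c0_nth (X i) n) \<longlonglongrightarrow> l" for n
    using Cauchy_convergent_iff convergent_def by blast
  then obtain L where L: "\<And>n. (\<lambda>i. c0_nth (X i) n) \<longlonglongrightarrow> L n" by metis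
  have unif: "\<exists>N. \<forall>i\<ge>N. \<forall>n. \<bar>c0_nth (X i) n - L n\<bar> \<le> e" if "e > 0" for e
  proof -
    obtain N where N: "\<And>i j. i \<ge> N \<Longrightarrow> j \<ge> N \<Longrightarrow> dist (X i) (X j) < e"
      using C \<open>e > 0\<close> unfolding Cauchy_def by blast
    have "\<bar>c0_nth (X i) n - L n\<bar> \<le> e" if "i \<ge> N" for i n
    proof (rule tendsto_upperbound)
      show "(\<lambda>j. \<bar>c0_nth (X i) n - c0_nth (X j) n\<bar>) \<longlonglongrightarrow> \<bar>c0_nth (X i) n - L n\<bar>"
        by (intro tendsto_intros L)
      show "\<forall>\<^sub>F j in sequentially. \<bar>c0_nth (X i) n - c0_nth (X j) n\<bar> \<le> e"
        using N[OF that] near unfolding eventually_sequentially by (meson le_less_trans less_imp_le)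
    qed simp
    then show ?thesis by blast
  qed
  have "L \<longlonglongrightarrow> 0"
  proof (rule LIMSEQ_I)
    fix e :: real assume "e > 0"
    obtain i where i: "\<And>n. \<bar>c0_nth (X i) n - L n\<bar> \<le> e / 2" using unif[of "e/2"] \<open>e > 0\<close> by auto
    obtain M where M: "\<And>n. n \<ge> M \<Longrightarrow> \<bar>c0_nth (X i) n\<bar> < e / 2"
      using LIMSEQ_D[OF c0_nth_tendsto[of "X i"], of "e/2"] \<open>e > 0\<close> by auto
    have "norm (L n - 0) < e" if "n \<ge> M" for n
      using i[of n] M[OF that] unfolding real_norm_def by linarith
    then show "\<exists>M. \<forall>n\<ge>M. norm (L n - 0) < e" by blast
  qed
  then have nth: "c0_nth (Abs_c0 L) = L" by (simp add: Abs_c0_inverse)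
  have "X \<longlonglongrightarrow> Abs_c0 L"
  proof (rule metric_LIMSEQ_I)
    fix e :: real assume "e > 0"
    then obtain N where "\<forall>i\<ge>N. \<forall>n. \<bar>c0_nth (X i) n - L n\<bar> \<le> e / 2" using unif[of "e/2"] by auto
    then have "dist (X i) (Abs_c0 L) \<le> e / 2" if "i \<ge> N" for i
      unfolding dist_c0_def using that by (intro c0_norm_le) (simp add: nth)
    then show "\<exists>N. \<forall>i\<ge>N. dist (X i) (Abs_c0 L) < e" using \<open>e > 0\<close> by (smt (verit) field_sum_of_halves)
  qed
  then show "convergent X" by (rule convergentI)
qed


section \<open>Super weakly precompact sets\<close>

definition super_weakly_precompact :: "'a::banach_lattice set \<Rightarrow> bool" where
  "super_weakly_precompact A \<longleftrightarrow> bounded A \<and>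
     (\<forall>T :: 'a \<Rightarrow>\<^sub>L c0. almost_dunford_pettis T \<longrightarrow> compact (closure (T ` A)))"


section \<open>The modulus of a functional and the absolute weak topology\<close>

definition dual_le :: "('a::banach_lattice \<Rightarrow>\<^sub>L real) \<Rightarrow> ('a \<Rightarrow>\<^sub>L real) \<Rightarrow> bool" where
  "dual_le f g \<longleftrightarrow> (\<forall>x\<ge>0. f x \<le> g x)"

text \<open>The modulus of \<open>f\<close> in the dual lattice is the least upper bound of \<open>f\<close> and \<open>- f\<close>
  with respect to the dual order. It exists and is unique; see \<open>dual_modulus_lub\<close> below.\<close>

definition is_dual_modulus :: "('a::banach_lattice \<Rightarrow>\<^sub>L real) \<Rightarrow> ('a \<Rightarrow>\<^sub>L real) \<Rightarrow> bool" where
  "is_dual_modulus f g \<longleftrightarrow> dual_le f g \<and> dual_le (- f) g \<and>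
     (\<forall>h. dual_le f h \<longrightarrow> dual_le (- f) h \<longrightarrow> dual_le g h)"

definition dual_modulus :: "('a::banach_lattice \<Rightarrow>\<^sub>L real) \<Rightarrow> ('a \<Rightarrow>\<^sub>L real)" where
  "dual_modulus f = (THE g. is_dual_modulus f g)"

lemma pprt_nprt_decomp:
  fixes x :: "'a::lattice_ab_group_add_abs"
  shows "x = pprt x - (- nprt x)" "0 \<le> pprt x" "0 \<le> - nprt x"
  using prts[of x] by auto

lemma dual_le_antisym:
  assumes "dual_le f g" "dual_le g f"
  shows "f = g"
proof (rule blinfun_eqI)
  fix x
  have eq: "f y = g y" if "y \<ge> 0" for y
    using assms that by (auto simp: dual_le_def intro: antisym)
  show "f x = g x"
    using eq[OF pprt_nprt_decomp(2)[of x]] eq[OF pprt_nprt_decomp(3)[of x]] pprt_nprt_decomp(1)[of x]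
    by (metis blinfun.diff_right)
qed

text \<open>Existence of the modulus, by the Riesz--Kantorovich formula.\<close>

lemma ex_dual_modulus:
  fixes f :: "'a::banach_lattice \<Rightarrow>\<^sub>L real"
  obtains g where "is_dual_modulus f g"
    and "\<And>x. x \<ge> 0 \<Longrightarrow> g x = (SUP y\<in>{y. \<bar>y\<bar> \<le> x}. f y)"
proof -
  define p where "p x = (SUP y\<in>{y. \<bar>y\<bar> \<le> x}. f y)" for x
  have norm_le: "norm y \<le> norm x" if "\<bar>y\<bar> \<le> x" for x y :: 'a
  proof (rule norm_mono_abs)
    have "0 \<le> x" using that abs_ge_zero[of y] by (rule order_trans[rotated])
    then show "\<bar>y\<bar> \<le> \<bar>x\<bar>" using that by simp
  qed
  have f_bd: "f y \<le> norm f * norm x" if "\<bar>y\<bar> \<le> x" for x y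
  proof -
    have "f y \<le> norm (f y)" by simp
    also have "\<dots> \<le> norm f * norm y" by (rule norm_blinfun)
    also have "\<dots> \<le> norm f * norm x" using norm_le[OF that] by (simp add: mult_left_mono)
    finally show ?thesis .
  qed
  have upper: "f y \<le> p x" if "\<bar>y\<bar> \<le> x" for x y
    unfolding p_def using that f_bd by (intro cSUP_upper bdd_aboveI2) auto
  have least: "p x \<le> b" if "x \<ge> 0" "\<And>y. \<bar>y\<bar> \<le> x \<Longrightarrow> f y \<le> b" for x b
    unfolding p_def using that by (intro cSUP_least) (auto intro: exI[of _ 0])
  have p_nonneg: "0 \<le> p x" if "x \<ge> 0" for x
    using upper[of 0 x] that by (simp add: blinfun.zero_right)
  have p_le: "p x \<le> norm f * norm x" if "x \<ge> 0" for x
    using that f_bd by (intro least) auto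
  have p_add: "p (a + b) = p a + p b" if a: "a \<ge> 0" and b: "b \<ge> 0" for a b
  proof (rule antisym)
    show "p (a + b) \<le> p a + p b"
    proof (rule least)
      fix y assume "\<bar>y\<bar> \<le> a + b"
      then have y: "y \<le> a + b" "- y \<le> a + b" by (auto simp: lattice_abs_le_iff)
      define y1 where "y1 = sup (- a) (inf y a)"
      have "- a \<le> a" using a by (meson neg_le_0_iff_le order_trans)
      then have "y1 \<le> a" "- a \<le> y1" by (simp_all add: y1_def)
      then have 1: "\<bar>y1\<bar> \<le> a"
        using minus_le_iff[of a y1] by (simp only: lattice_abs_le_iff)
      have eq: "y - y1 = inf (a + y) (sup 0 (y - a))"
      proof -
        have "y - y1 = y + inf a (sup (- y) (- a))"
          by (simp add: y1_def diff_conv_add_uminus neg_sup_eq_inf neg_inf_eq_sup del: add_uminus_conv_diff)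
        also have "\<dots> = inf (a + y) (sup 0 (y - a))"
          by (simp add: add_inf_distrib_left add_sup_distrib_left add.commute)
        finally show ?thesis .
      qed
      have "y - a \<le> b" using y(1) by (simp add: algebra_simps)
      then have "y - y1 \<le> b" unfolding eq using b by (meson le_infI2 le_supI)
      have "0 \<le> y + (a + b)" using add_left_mono[OF y(2), of y] by simp
      from add_left_mono[OF this, of "- b"] have "- b \<le> a + y" by (simp add: algebra_simps)
      then have "- b \<le> y - y1" unfolding eq using b
        by (meson le_infI le_supI1 neg_le_0_iff_le)
      with \<open>y - y1 \<le> b\<close> have 2: "\<bar>y - y1\<bar> \<le> b"
        using minus_le_iff[of b "y - y1"] by (simp only: lattice_abs_le_iff)
      have "f y = f y1 + f (y - y1)" by (simp flip: blinfun.add_right)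
      then show "f y \<le> p a + p b" using upper[OF 1] upper[OF 2] by linarith
    qed (use a b in simp)
    have "p a \<le> p (a + b) - p b"
    proof (rule least[OF a])
      fix y assume y: "\<bar>y\<bar> \<le> a"
      have "p b \<le> p (a + b) - f y"
      proof (rule least[OF b])
        fix z assume z: "\<bar>z\<bar> \<le> b"
        have "\<bar>y + z\<bar> \<le> a + b" using y z by (meson abs_triangle_ineq add_mono order_trans)
        from upper[OF this] show "f z \<le> p (a + b) - f y" by (simp add: blinfun.add_right)
      qed
      then show "f y \<le> p (a + b) - p b" by simp
    qed
    then show "p a + p b \<le> p (a + b)" by simp
  qed
  have p_scale_le: "p (r *\<^sub>R x) \<le> r * p x" if r: "r > 0" and x: "x \<ge> 0" for r x
  proof (rule least)
    show "0 \<le> r *\<^sub>R x" using r x by (simp add: scaleR_nonneg_nonneg)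
    fix y assume y: "\<bar>y\<bar> \<le> r *\<^sub>R x"
    have "\<bar>inverse r *\<^sub>R y\<bar> \<le> x"
      using y scaleR_left_mono[of y "r *\<^sub>R x" "inverse r"] scaleR_left_mono[of "- y" "r *\<^sub>R x" "inverse r"] r
      by (simp add: lattice_abs_le_iff)
    from upper[OF this] show "f y \<le> r * p x" using r by (simp add: blinfun.scaleR_right field_simps)
  qed
  have p0: "p 0 = 0" using p_add[of 0 0] by simp
  have p_scale: "p (r *\<^sub>R x) = r * p x" if r: "r \<ge> 0" and x: "x \<ge> 0" for r x
  proof (cases "r = 0")
    case True then show ?thesis by (simp add: p0)
  next
    case False
    then have "p x \<le> inverse r * p (r *\<^sub>R x)"
      using p_scale_le[of "inverse r" "r *\<^sub>R x"] r x by (simp add: scaleR_nonneg_nonneg)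
    then have "r * p x \<le> p (r *\<^sub>R x)" using False r by (simp add: field_simps)
    then show ?thesis using p_scale_le[of r x] False r x by simp
  qed
  define G where "G x = p (pprt x) - p (- nprt x)" for x
  have G: "G (a - b) = p a - p b" if "a \<ge> 0" "b \<ge> 0" for a b
  proof -
    have "a + (- nprt (a - b)) = pprt (a - b) + b"
      using prts[of "a - b"] by (simp add: algebra_simps)
    then have "p a + p (- nprt (a - b)) = p (pprt (a - b)) + p b"
      using p_add that pprt_nprt_decomp(2,3)[of "a - b"] by metis
    then show ?thesis by (simp add: G_def)
  qed
  have G_p: "G x = p x" if "x \<ge> 0" for x
    using G[OF that, of 0] by (simp add: p0)
  have lin: "bounded_linear G"
  proof (rule bounded_linear_intro[where K = "2 * norm f"])
    fix x y :: 'a and r :: real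
    note dx = pprt_nprt_decomp[of x] and dy = pprt_nprt_decomp[of y]
    have "x + y = (pprt x + pprt y) - (- nprt x + - nprt y)"
      using arg_cong2[OF dx(1) dy(1), of "(+)"] by (simp only: diff_conv_add_uminus minus_add_distrib ac_simps)
    then have "G (x + y) = p (pprt x + pprt y) - p (- nprt x + - nprt y)"
      using G[of "pprt x + pprt y" "- nprt x + - nprt y"] dx(2,3) dy(2,3)
      by (metis add_nonneg_nonneg)
    then show "G (x + y) = G x + G y"
      using p_add[OF dx(2) dy(2)] p_add[OF dx(3) dy(3)] by (simp add: G_def)
    show "G (r *\<^sub>R x) = r *\<^sub>R G x"
    proof (cases "r \<ge> 0")
      case True
      have "r *\<^sub>R x = r *\<^sub>R pprt x - r *\<^sub>R (- nprt x)" using dx(1) by (metis scaleR_right_diff_distrib)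
      then have "G (r *\<^sub>R x) = p (r *\<^sub>R pprt x) - p (r *\<^sub>R (- nprt x))"
        using G True dx(2,3) by (metis scaleR_nonneg_nonneg)
      then show ?thesis using p_scale[OF True dx(2)] p_scale[OF True dx(3)]
        by (simp add: G_def right_diff_distrib)
    next
      case False
      then have s: "- r \<ge> 0" by simp
      have "r *\<^sub>R x = (- r) *\<^sub>R (- nprt x) - (- r) *\<^sub>R pprt x"
        using arg_cong[OF dx(1), of "scaleR r"] by (simp add: scaleR_right_diff_distrib scaleR_right_distrib)
      then have "G (r *\<^sub>R x) = p ((- r) *\<^sub>R (- nprt x)) - p ((- r) *\<^sub>R pprt x)"
        using G s dx(2,3) by (metis scaleR_nonneg_nonneg)
      then show ?thesis unfolding p_scale[OF s dx(2)] p_scale[OF s dx(3)]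
        by (simp add: G_def right_diff_distrib)
    qed
    have abs: "\<bar>x\<bar> = pprt x + - nprt x" using abs_prts[of x] by simp
    have "G x \<le> p \<bar>x\<bar>" "- G x \<le> p \<bar>x\<bar>"
      unfolding abs p_add[OF dx(2,3)] G_def using p_nonneg[OF dx(2)] p_nonneg[OF dx(3)] by auto
    moreover have "p \<bar>x\<bar> \<le> norm f * norm x"
    proof -
      have "norm \<bar>x\<bar> \<le> norm x" by (rule norm_mono_abs) simp
      then show ?thesis using p_le[OF abs_ge_zero, of x]
        by (meson mult_left_mono norm_ge_zero order_trans)
    qed
    moreover have "0 \<le> norm f * norm x" by simp
    ultimately show "norm (G x) \<le> norm x * (2 * norm f)"
      unfolding real_norm_def by (auto simp: abs_le_iff algebra_simps)
  qed
  define g where "g = Blinfun G"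
  have gG: "g x = G x" for x by (simp add: g_def bounded_linear_Blinfun_apply[OF lin])
  show thesis
  proof
    show "g x = (SUP y\<in>{y. \<bar>y\<bar> \<le> x}. f y)" if "x \<ge> 0" for x
      using G_p[OF that] by (simp add: gG p_def)
    show "is_dual_modulus f g"
      unfolding is_dual_modulus_def
    proof (intro conjI allI impI)
      show "dual_le f g" unfolding dual_le_def
      proof (intro allI impI)
        fix x :: 'a assume "0 \<le> x"
        then show "f x \<le> g x" using upper[of x x] by (simp add: gG G_p)
      qed
      show "dual_le (- f) g" unfolding dual_le_def
      proof (intro allI impI)
        fix x :: 'a assume "0 \<le> x"
        then show "(- f) x \<le> g x" using upper[of "- x" x]
          by (simp add: gG G_p blinfun.minus_left blinfun.minus_right)
      qed
      fix h assume h: "dual_le f h" "dual_le (- f) h"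
      show "dual_le g h" unfolding dual_le_def
      proof (intro allI impI)
        fix x :: 'a assume x: "0 \<le> x"
        have "p x \<le> h x"
        proof (rule least[OF x])
          fix y assume y: "\<bar>y\<bar> \<le> x"
          note d = pprt_nprt_decomp[of y]
          have fh: "f z \<le> h z" "- f z \<le> h z" if "z \<ge> 0" for z
            using h that by (auto simp: dual_le_def blinfun.minus_left)
          have "f y = f (pprt y) - f (- nprt y)" using d(1) by (metis blinfun.diff_right)
          also have "\<dots> \<le> h (pprt y) + h (- nprt y)" using fh(1)[OF d(2)] fh(2)[OF d(3)] by simp
          also have "\<dots> = h \<bar>y\<bar>" using abs_prts[of y] by (simp add: blinfun.diff_right blinfun.minus_right)
          also have "\<dots> \<le> h x"
            using fh[of "x - \<bar>y\<bar>"] y by (simp add: blinfun.diff_right)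
          finally show "f y \<le> h x" .
        qed
        then show "g x \<le> h x" using x by (simp add: gG G_p)
      qed
    qed
  qed
qed

lemma is_dual_modulus_unique: "is_dual_modulus f g \<Longrightarrow> is_dual_modulus f h \<Longrightarrow> g = h"
  unfolding is_dual_modulus_def by (blast intro: dual_le_antisym)

lemma dual_modulus_lub: "is_dual_modulus f (dual_modulus f)"
proof -
  obtain g where "is_dual_modulus f g" using ex_dual_modulus by blast
  then show ?thesis unfolding dual_modulus_def by (rule theI) (use is_dual_modulus_unique \<open>is_dual_modulus f g\<close> in blast)
qed

lemma dual_modulus_Riesz_Kantorovich:
  assumes "x \<ge> 0"
  shows "dual_modulus f x = (SUP y\<in>{y. \<bar>y\<bar> \<le> x}. f y)"
  using ex_dual_modulus[of f] is_dual_modulus_unique dual_modulus_lub assms by metis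

definition abs_weak_seminorm :: "('a::banach_lattice \<Rightarrow>\<^sub>L real) \<Rightarrow> 'a \<Rightarrow> real" where
  "abs_weak_seminorm f x = dual_modulus f \<bar>x\<bar>"

definition abs_weak_totally_bounded :: "'a::banach_lattice set \<Rightarrow> bool" where
  "abs_weak_totally_bounded A \<longleftrightarrow>
     (\<forall>\<epsilon>>0. \<forall>F :: ('a \<Rightarrow>\<^sub>L real) set. finite F \<longrightarrow>
        (\<exists>\<Phi>. finite \<Phi> \<and> \<Phi> \<subseteq> A \<and> A \<subseteq> \<Phi> + (\<Inter>f\<in>F. {x. abs_weak_seminorm f x < \<epsilon>})))"

end

theory Submission
  imports Defs "HOL-Complex_Analysis.Great_Picard"
begin

text \<open>
  For \<open>T\<close> into \<open>c0\<close> with coordinate functionals \<open>f i\<close> put \<open>q x = sup |f i| |x|\<close>. If \<open>T\<close> is almost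
  Dunford--Pettis and \<open>A\<close> is totally bounded, then disjoint sequences in the solid hull of \<open>A\<close> are
  weakly null, so \<open>q\<close> tends to \<open>0\<close> along them. Disjointification yields \<open>u\<close> with
  \<open>q ((|x| - u)\<^sup>+)\<close> small on \<open>A\<close>, and on the order interval below \<open>2 u\<close> the seminorm \<open>q\<close> is dominated,
  up to a small constant, by a single positive functional; so a net for that functional is a net
  for \<open>T\<close>.

  Conversely, let \<open>f\<close> be positive and \<open>x n\<close> a sequence in \<open>A\<close> that is separated for \<open>f |x|\<close>. One
  needs functionals \<open>g n\<close>, dominated by \<open>f\<close> and pointwise null, with \<open>g n\<close> not uniformly small on
  \<open>A\<close>. If \<open>A\<close> is not \<open>f\<close>-equi-integrable, disjoint components of \<open>f\<close> do this. Otherwise the clipped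
  sequence is still separated, and in the Hilbert space of the quadratic form \<open>f (x\<^sup>2 / w)\<close>
  on the ideal of a suitable \<open>w\<close> a subsequence of it converges weakly; its consecutive differences
  represent the \<open>g n\<close>.
\<close>

section \<open>Vector lattice arithmetic\<close>

text \<open>Read \<open>f\<close> as an integral and the ideal of \<open>w\<close> as bounded
  functions times \<open>w\<close>. For the differences \<open>p n\<close> of clipped terms,
  \<open>g n y\<close> is the integral of \<open>p n\<close> times \<open>y / w\<close>: clipping
  bounds \<open>p n\<close> by \<open>2 w\<close>, which gives domination by \<open>f\<close>, and
  Cauchy-Schwarz turns separation in the L1 seminorm \<open>f \<bar>x\<bar>\<close> into a lower
  bound for \<open>g n (p n)\<close>. Domination matters because it makes the operator with
  coordinates \<open>g n\<close> almost Dunford-Pettis: the moduli of a disjoint weakly null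
  sequence are null for every positive functional. The obstacle is that the lattice need be neither
  order complete nor a function space, so products, infinite suprema and band projections are not at
  hand. Hence finite suprema of tangents replace the square, components of \<open>f\<close> are
  limits of values of \<open>f\<close>, and tails of sequences are replaced by finite suprema with
  geometric errors. In the other direction \<open>q\<close> is a supremum of functionals and only
  subadditive. Being null on order bounded disjoint sequences makes it null on the increments of
  order bounded monotone sequences, by counting level crossings; this excludes an endless supply of
  functionals each charging something new.\<close>

lemma inf_eq_diff_pprt: "inf a b = a - pprt (a - b)" for a b :: "'a::lattice_ab_group_add"
proof -
  have "a - pprt (a - b) = a + inf (b - a) 0" by (simp add: pprt_def)
  then show ?thesis by (simp add: add_inf_distrib_left inf_commute)
qed

lemma pprt_leI: "a \<le> b \<Longrightarrow> 0 \<le> b \<Longrightarrow> pprt a \<le> b" for a b :: "'a::lattice_ab_group_add"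
  by (simp add: pprt_def)

lemma le_pprt: "a \<le> pprt a" for a :: "'a::lattice_ab_group_add"
  by (simp add: pprt_def)

lemma pprt_add_le: "pprt (a + b) \<le> pprt a + pprt b" for a b :: "'a::lattice_ab_group_add"
  by (intro pprt_leI add_mono le_pprt add_nonneg_nonneg zero_le_pprt)

lemma pprt_le_abs: "pprt x \<le> \<bar>x\<bar>" for x :: "'a::lattice_ab_group_add_abs"
  by (rule pprt_leI[OF abs_ge_self abs_ge_zero])

lemma pprt_uminus_le_abs: "pprt (- x) \<le> \<bar>x\<bar>" for x :: "'a::lattice_ab_group_add_abs"
  using pprt_le_abs[of "- x"] by simp

lemma eq_pprt_diff: "x = pprt x - pprt (- x)" for x :: "'a::lattice_ab_group_add"
  using prts[of x] by (simp add: pprt_neg)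

lemma abs_eq_pprt_add: "\<bar>x\<bar> = pprt x + pprt (- x)" for x :: "'a::lattice_ab_group_add_abs"
  using abs_prts[of x] by (simp add: pprt_neg)

lemma inf_pprt_pprt_uminus: "inf (pprt x) (pprt (- x)) = 0" for x :: "'a::lattice_ab_group_add"
proof -
  have "inf (pprt x) (pprt (- x)) = pprt x - pprt (pprt x - pprt (- x))"
    by (rule inf_eq_diff_pprt)
  then show ?thesis by (simp flip: eq_pprt_diff)
qed

lemma inf_add_le:
  fixes a b c :: "'a::lattice_ab_group_add"
  assumes "0 \<le> a" "0 \<le> b" "0 \<le> c"
  shows "inf (a + b) c \<le> inf a c + inf b c"
proof -
  have "inf (a + b) c \<le> a + inf b c"
    by (simp add: add_inf_distrib_left assms le_infI2)
  moreover have "inf (a + b) c \<le> c + inf b c"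
    by (intro le_infI2) (simp add: assms)
  ultimately show ?thesis
    by (simp add: add_inf_distrib_right)
qed

text \<open>Distributivity comes from the group structure: every \<open>x\<close> equals
  \<open>inf a x + pprt (x - a)\<close>, so with \<open>e\<close> the right-hand side both
  \<open>b\<close> and \<open>c\<close> lie below \<open>e + pprt (sup b c - a)\<close>, and hence
  so does \<open>sup b c\<close>.\<close>

lemma inf_sup_le:
  fixes a b c :: "'a::lattice_ab_group_add"
  shows "inf a (sup b c) \<le> sup (inf a b) (inf a c)"
proof -
  define e where "e = sup (inf a b) (inf a c)"
  have *: "x \<le> e + pprt (sup b c - a)" if "inf a x \<le> e" "x \<le> sup b c" for x
  proof -
    have "x = inf a x + pprt (x - a)"
      using inf_eq_diff_pprt[of x a] by (simp add: inf_commute)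
    also have "\<dots> \<le> e + pprt (sup b c - a)"
      by (intro add_mono that pprt_mono diff_right_mono)
    finally show ?thesis .
  qed
  have "sup b c \<le> e + pprt (sup b c - a)"
    by (intro sup_least *) (auto simp: e_def)
  then have "sup b c - pprt (sup b c - a) \<le> e"
    by (simp add: diff_le_eq)
  then show ?thesis
    using inf_eq_diff_pprt[of "sup b c" a] by (simp add: inf_commute e_def)
qed

lemma inf_le_sup_inf:
  fixes x :: "'a::lattice_ab_group_add"
  assumes "x \<le> a" "x \<le> sup b c"
  shows "x \<le> sup (inf a b) (inf a c)"
  using assms inf_sup_le[of a b c] by (meson le_inf_iff order_trans)

lemma pprt_diff_mono:
  fixes a b c :: "'a::lattice_ab_group_add"
  shows "\<lbrakk>a \<le> a'; b' \<le> b\<rbrakk> \<Longrightarrow> pprt (a - b) \<le> pprt (a' - b')"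
  by (intro pprt_mono diff_mono)

lemma inf_zero_mono:
  fixes a b :: "'a::lattice_ab_group_add"
  assumes "inf a b = 0" "0 \<le> a'" "a' \<le> a" "0 \<le> b'" "b' \<le> b"
  shows "inf a' b' = 0"
  using assms inf_mono[OF assms(3,5)] by (intro antisym) auto

lemma add_le_of_disjoint:
  fixes a b :: "'a::lattice_ab_group_add"
  assumes "inf a b = 0" "a \<le> x" "b \<le> x"
  shows "a + b \<le> x"
  using assms add_eq_inf_sup[of a b] by simp

lemma inf_add_zero:
  fixes a b c :: "'a::lattice_ab_group_add"
  assumes "0 \<le> a" "0 \<le> b" "0 \<le> c" "inf a c = 0" "inf b c = 0"
  shows "inf (a + b) c = 0"
  using inf_add_le[OF assms(1-3)] assms by (intro antisym) auto

lemma inf_sum_zero: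
  fixes a :: "'i \<Rightarrow> 'a::lattice_ab_group_add"
  assumes "\<And>i. i \<in> I \<Longrightarrow> 0 \<le> a i" "0 \<le> c" "\<And>i. i \<in> I \<Longrightarrow> inf (a i) c = 0"
  shows "inf (sum a I) c = 0"
  using assms
proof (induction I rule: infinite_finite_induct)
  case (insert i I)
  then show ?case by (simp add: inf_add_zero sum_nonneg)
qed (auto simp: inf_absorb1)

lemma sum_le_of_disjoint:
  fixes a :: "nat \<Rightarrow> 'a::lattice_ab_group_add"
  assumes "\<And>i. i < n \<Longrightarrow> 0 \<le> a i" "\<And>i. i < n \<Longrightarrow> a i \<le> x" "0 \<le> x"
    and "\<And>i j. i < j \<Longrightarrow> j < n \<Longrightarrow> inf (a i) (a j) = 0"
  shows "(\<Sum>i<n. a i) \<le> x"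
  using assms
proof (induction n)
  case (Suc n)
  have "inf (\<Sum>i<n. a i) (a n) = 0"
    by (intro inf_sum_zero) (use Suc.prems in auto)
  moreover have "(\<Sum>i<n. a i) \<le> x"
    by (intro Suc.IH) (use Suc.prems in auto)
  ultimately show ?case
    using Suc.prems(2)[of n] add_le_of_disjoint by fastforce
qed simp

lemma abs_inf_diff_le: "\<bar>inf a b - inf a c\<bar> \<le> \<bar>b - c\<bar>" for a :: "'a::lattice_ab_group_add_abs"
proof -
  have *: "inf a b - inf a c \<le> \<bar>b - c\<bar>" for b c
  proof -
    have "inf a b \<le> inf (a + \<bar>b - c\<bar>) (c + \<bar>b - c\<bar>)"
      using abs_ge_self[of "b - c"] by (intro inf_mono) (simp_all add: algebra_simps)
    then show ?thesis by (simp only: diff_le_eq add_inf_distrib_right[symmetric] add.commute)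
  qed
  show ?thesis
    using *[of b c] *[of c b] unfolding lattice_abs_le_iff
    by (simp only: abs_minus_commute[of c b] minus_diff_eq)
qed

context
  fixes r :: real
  assumes r: "0 \<le> r"
begin

lemma scaleR_inf: "r *\<^sub>R inf a b = inf (r *\<^sub>R a) (r *\<^sub>R b)" for a b :: "'a::banach_lattice"
proof (cases "r = 0")
  case False
  with r have pos: "0 < r" by simp
  show ?thesis
  proof (intro antisym)
    show "r *\<^sub>R inf a b \<le> inf (r *\<^sub>R a) (r *\<^sub>R b)"
      by (intro le_infI scaleR_left_mono) (use r in auto)
    have "inf (r *\<^sub>R a) (r *\<^sub>R b) /\<^sub>R r \<le> inf a b"
      using pos by (intro le_infI) (simp_all add: pos_divideR_le_eq)
    then show "inf (r *\<^sub>R a) (r *\<^sub>R b) \<le> r *\<^sub>R inf a b"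
      using pos by (simp only: pos_divideR_le_eq)
  qed
qed simp

lemma scaleR_sup: "r *\<^sub>R sup a b = sup (r *\<^sub>R a) (r *\<^sub>R b)" for a b :: "'a::banach_lattice"
  by (simp only: sup_eq_neg_inf scaleR_minus_right scaleR_inf)

lemma scaleR_pprt: "r *\<^sub>R pprt a = pprt (r *\<^sub>R a)" for a :: "'a::banach_lattice"
  by (simp add: pprt_def scaleR_sup)

end

lemma abs_scaleR: "\<bar>r *\<^sub>R a\<bar> = \<bar>r\<bar> *\<^sub>R \<bar>a\<bar>" for a :: "'a::banach_lattice"
proof -
  have "\<bar>\<bar>r\<bar> *\<^sub>R a\<bar> = \<bar>r\<bar> *\<^sub>R \<bar>a\<bar>"
    by (simp only: abs_lattice[of a] abs_lattice[of "\<bar>r\<bar> *\<^sub>R a"] scaleR_sup[OF abs_ge_zero] scaleR_minus_right)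
  then show ?thesis
    by (cases "r \<ge> 0") auto
qed

section \<open>Norm limits and series of positive elements\<close>

lemma norm_abs: "norm \<bar>x\<bar> = norm x" for x :: "'a::banach_lattice"
  by (intro antisym norm_mono_abs) auto

lemma tendsto_inf_left:
  fixes X :: "nat \<Rightarrow> 'a::banach_lattice"
  assumes "X \<longlonglongrightarrow> x"
  shows "(\<lambda>n. inf a (X n)) \<longlonglongrightarrow> inf a x"
proof (rule Lim_null[THEN iffD2], rule Lim_null_comparison)
  show "(\<lambda>n. norm (X n - x)) \<longlonglongrightarrow> 0"
    using assms by (simp add: LIM_zero_iff tendsto_norm_zero_iff)
  show "\<forall>\<^sub>F n in sequentially. norm (inf a (X n) - inf a x) \<le> norm (X n - x)"
    by (intro always_eventually allI norm_mono_abs abs_inf_diff_le)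
qed

lemma limit_nonneg:
  fixes X :: "nat \<Rightarrow> 'a::banach_lattice"
  assumes "X \<longlonglongrightarrow> x" "\<And>n. 0 \<le> X n"
  shows "0 \<le> x"
proof -
  have "(\<lambda>n. inf 0 (X n)) \<longlonglongrightarrow> inf 0 x" by (rule tendsto_inf_left[OF assms(1)])
  moreover have "inf 0 (X n) = 0" for n using assms(2) by (simp add: inf_absorb1)
  ultimately have "inf 0 x = 0" by (simp add: LIMSEQ_const_iff)
  then show ?thesis by (simp add: le_iff_inf)
qed

lemma suminf_nonneg_lattice:
  fixes a :: "nat \<Rightarrow> 'a::banach_lattice"
  assumes "summable a" "\<And>n. 0 \<le> a n"
  shows "0 \<le> suminf a"
  using limit_nonneg[OF summable_LIMSEQ[OF assms(1)]] assms(2) by (simp add: sum_nonneg)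

lemma term_le_suminf:
  fixes a :: "nat \<Rightarrow> 'a::banach_lattice"
  assumes "summable a" "\<And>n. 0 \<le> a n"
  shows "a k \<le> suminf a"
proof -
  have "(\<Sum>i<Suc k. a i) + (\<Sum>n. a (n + Suc k)) = suminf a"
    using suminf_split_initial_segment[OF assms(1), of "Suc k"] by simp
  moreover have "0 \<le> (\<Sum>n. a (n + Suc k))"
    using assms by (intro suminf_nonneg_lattice summable_ignore_initial_segment)
  moreover have "a k \<le> (\<Sum>i<Suc k. a i)"
    using assms(2) by (simp add: sum_nonneg)
  ultimately show ?thesis by (metis add_increasing2)
qed

lemma inf_suminf_zero:
  fixes a :: "nat \<Rightarrow> 'a::banach_lattice"
  assumes "summable a" "\<And>n. 0 \<le> a n" "0 \<le> c" "\<And>n. inf c (a n) = 0"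
  shows "inf c (suminf a) = 0"
proof -
  have "inf (\<Sum>i<n. a i) c = 0" for n
    using assms by (intro inf_sum_zero) (auto simp: inf_commute)
  then have "inf c (\<Sum>i<n. a i) = 0" for n by (simp add: inf_commute)
  then show ?thesis
    using tendsto_inf_left[OF summable_LIMSEQ[OF assms(1)], of c] by (simp add: LIMSEQ_const_iff)
qed

text \<open>The weights allow a bounded sequence of positive elements to be summed to one element
  that dominates a positive multiple of each term; principal ideals containing a whole sequence
  arise in this way.\<close>

lemma summable_scaled_bounded:
  fixes a :: "nat \<Rightarrow> 'a::banach"
  assumes "\<And>n. norm (a n) \<le> K"
  shows "summable (\<lambda>n. (1/2)^n *\<^sub>R a n)"
proof (rule summable_comparison_test')
  show "summable (\<lambda>n. K * (1/2)^n)" by (intro summable_mult) (simp add: summable_geometric)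
  show "norm ((1/2)^n *\<^sub>R a n) \<le> K * (1/2)^n" for n
    using assms[of n] by (simp add: mult_right_mono divide_right_mono)
qed

lemma inf_scaleR_zero:
  fixes u v :: "'a::banach_lattice"
  assumes "inf u v = 0" "0 \<le> u" "0 \<le> v" "0 \<le> r"
  shows "inf u (r *\<^sub>R v) = 0"
proof -
  define R where "R = max 1 r"
  have R: "1 \<le> R" "r \<le> R" by (auto simp: R_def)
  have "inf (R *\<^sub>R u) (R *\<^sub>R v) = 0"
    using scaleR_inf[of R u v] R assms by simp
  moreover have "u \<le> R *\<^sub>R u"
    using scaleR_right_mono[OF R(1) assms(2)] by simp
  moreover have "0 \<le> r *\<^sub>R v" using assms(3,4) by (simp add: scaleR_nonneg_nonneg)
  ultimately show ?thesis
    by (rule inf_zero_mono[OF _ assms(2) _ _ scaleR_right_mono[OF R(2) assms(3)]])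
qed

text \<open>Pointwise, the first factor lives where \<open>a\<close> exceeds \<open>s b\<close>, the
  second where \<open>b\<close> exceeds \<open>t a\<close>, and \<open>t a\<close> is at least
  \<open>a / s\<close>; the two regions cannot meet.\<close>

lemma disjoint_pprt_scaled:
  fixes a b :: "'a::banach_lattice"
  assumes "0 \<le> a" "0 < s" "1 \<le> s * t"
  shows "inf (pprt (a - s *\<^sub>R b)) (pprt (b - t *\<^sub>R a)) = 0"
proof -
  have "inf (pprt (a - s *\<^sub>R b)) (pprt (s *\<^sub>R b - a)) = 0"
    using inf_pprt_pprt_uminus[of "a - s *\<^sub>R b"] by (simp only: minus_diff_eq)
  then have "inf (pprt (a - s *\<^sub>R b)) (inverse s *\<^sub>R pprt (s *\<^sub>R b - a)) = 0"
    by (rule inf_scaleR_zero) (use assms in auto)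
  moreover have "inverse s *\<^sub>R pprt (s *\<^sub>R b - a) = pprt (b - inverse s *\<^sub>R a)"
    using assms by (simp add: scaleR_pprt scaleR_diff_right)
  ultimately have disj: "inf (pprt (a - s *\<^sub>R b)) (pprt (b - inverse s *\<^sub>R a)) = 0" by simp
  have "pprt (b - t *\<^sub>R a) \<le> pprt (b - inverse s *\<^sub>R a)"
  proof (intro pprt_diff_mono scaleR_right_mono)
    show "inverse s \<le> t" using assms by (simp add: field_simps)
  qed (use assms in auto)
  then show ?thesis
    by (intro inf_zero_mono[OF disj] zero_le_pprt order_refl)
qed

text \<open>A jump of size more than \<open>h\<close> from \<open>a\<close> to \<open>b\<close> crosses one of the levels \<open>j h\<close>, and
  crosses a nearest one to its midpoint with margin about half of the jump on both sides.\<close>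

lemma diff_le_level_crossings:
  fixes a b h :: "'a::banach_lattice"
  assumes "0 \<le> a" "0 \<le> b" "0 \<le> h" "b \<le> real k *\<^sub>R h"
  shows "b - a \<le> h + 2 *\<^sub>R (\<Sum>j<k. inf (pprt (b - real j *\<^sub>R h)) (pprt (real j *\<^sub>R h - a)))"
proof -
  define P where "P j = b - real j *\<^sub>R h" for j
  define Q where "Q j = real j *\<^sub>R h - a" for j
  define c where "c j = inf (pprt (P j)) (pprt (Q j))" for j
  define D where "D = (1/2) *\<^sub>R (b - a - h)"
  have halfI: "D \<le> x" if "b - a - h \<le> x + x" for x
  proof -
    have "(1/2) *\<^sub>R (b - a - h) \<le> (1/2) *\<^sub>R (x + x)"
      by (intro scaleR_left_mono that) auto
    also have "\<dots> = x" by (simp add: scaleR_add_right flip: scaleR_add_left)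
    finally show ?thesis by (simp add: D_def)
  qed
  have c_nonneg: "0 \<le> c j" for j by (simp add: c_def)
  \<comment> \<open>Invariant over the levels: unless a level below \<open>i\<close> was crossed
    with margin \<open>D\<close>, \<open>b\<close> still exceeds level \<open>i\<close> by
    \<open>D\<close>. The latter is impossible at level \<open>k\<close>, where
    \<open>P k \<le> 0\<close>.\<close>
  have "D \<le> sup (\<Sum>j<i. c j) (P i)" for i
  proof (induction i)
    case 0
    have "b - a - h \<le> b + b"
      using assms by (metis add.commute add_increasing diff_le_eq le_add_same_cancel1)
    then have "D \<le> P 0" by (intro halfI) (simp add: P_def)
    then show ?case by (rule le_supI2)
  next
    case (Suc i)
    define S where "S = (\<Sum>j<i. c j)"
    define A where "A = sup (P (Suc i)) (Q i)"
    \<comment> \<open>\<open>D\<close> is half of this sum, so pointwise \<open>P (Suc i)\<close> or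
      \<open>Q i\<close> is at least \<open>D\<close>; in the second case \<open>P i\<close> and
      \<open>Q i\<close> are both large, and so is \<open>c i\<close>.\<close>
    have "b - a - h = P (Suc i) + Q i"
      by (simp add: P_def Q_def algebra_simps)
    also have "\<dots> \<le> A + A" by (intro add_mono) (auto simp: A_def)
    finally have "D \<le> A" by (rule halfI)
    then have "D \<le> sup (inf A S) (inf A (P i))"
      using Suc by (intro inf_le_sup_inf) (auto simp: S_def)
    moreover have "inf A (P i) \<le> sup (inf (P i) (P (Suc i))) (inf (P i) (Q i))"
      unfolding A_def by (subst inf_commute) (rule inf_sup_le)
    moreover have "inf (P i) (Q i) \<le> c i"
      unfolding c_def by (intro inf_mono le_pprt)
    moreover have "inf A S \<le> S + c i"
      using c_nonneg[of i] by (intro le_infI2) simp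
    moreover have "c i \<le> S + c i" by (simp add: S_def sum_nonneg c_nonneg)
    ultimately have "D \<le> sup (S + c i) (P (Suc i))"
      by (meson inf_le2 le_supI le_supI1 le_supI2 order_trans)
    then show ?case by (simp add: S_def)
  qed
  from this[of k] have "D \<le> sup (\<Sum>j<k. c j) (P k)" .
  moreover have "P k \<le> (\<Sum>j<k. c j)"
  proof -
    have "P k \<le> 0" using assms by (simp add: P_def)
    also have "0 \<le> (\<Sum>j<k. c j)" by (simp add: sum_nonneg c_nonneg)
    finally show ?thesis .
  qed
  ultimately have "D \<le> (\<Sum>j<k. c j)" by (simp add: sup_absorb1)
  then have "2 *\<^sub>R D \<le> 2 *\<^sub>R (\<Sum>j<k. c j)" by (intro scaleR_left_mono) auto
  then show ?thesis
    unfolding D_def c_def P_def Q_def by (simp add: diff_le_eq add.commute)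
qed

section \<open>Lattice seminorms and disjoint sequences\<close>

text \<open>Covers \<open>f \<bar>x\<bar>\<close> for one positive functional as well as suprema of
  such seminorms over a bounded family, so both directions of the theorem share one
  disjointification.\<close>

locale lattice_seminorm =
  fixes q :: "'a::banach_lattice \<Rightarrow> real" and M :: real
  assumes subadd: "q (x + y) \<le> q x + q y"
    and mono: "\<bar>x\<bar> \<le> \<bar>y\<bar> \<Longrightarrow> q x \<le> q y"
    and bound: "q x \<le> M * norm x"
begin

lemma zero [simp]: "q 0 = 0"
  using bound[of 0] subadd[of 0 0] by simp

lemma nonneg: "0 \<le> q x"
  using mono[of 0 x] by simp

lemma mono': "\<lbrakk>0 \<le> x; x \<le> y\<rbrakk> \<Longrightarrow> q x \<le> q y"
  by (rule mono) (metis abs_of_nonneg order_trans)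

lemma abs [simp]: "q \<bar>x\<bar> = q x"
  by (intro antisym mono) auto

lemma sum_le: "q (\<Sum>i\<in>I. f i) \<le> (\<Sum>i\<in>I. q (f i))"
proof (induction I rule: infinite_finite_induct)
  case (insert i I)
  then show ?case using subadd[of "f i" "sum f I"] by simp
qed auto

lemma pprt_diff_le:
  assumes "0 \<le> c"
  shows "q (pprt (a - b)) \<le> q (pprt (a - b - c)) + q c"
proof -
  have "pprt (a - b) \<le> pprt (a - b - c) + c"
    using pprt_add_le[of "a - b - c" c] assms by simp
  then show ?thesis
    using mono'[of "pprt (a - b)"] subadd[of "pprt (a - b - c)" c] by fastforce
qed

text \<open>Each \<open>x n\<close> is chosen with a large part above \<open>4^n\<close> times the
  sum of all earlier moduli. Cutting off that multiple separates \<open>y n\<close> from earlier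
  terms; cutting off a small multiple of \<open>z\<close>, which dominates a multiple of every term,
  separates it from later ones.\<close>

lemma disjoint_subsequence:
  fixes S :: "'a set"
  assumes S: "bounded S" and e: "0 < e"
    and large: "\<And>u. 0 \<le> u \<Longrightarrow> \<exists>x\<in>S. e \<le> q (pprt (\<bar>x\<bar> - u))"
  obtains x y where "\<And>n. x n \<in> S" "disjoint_seq y" "\<And>n. 0 \<le> y n" "\<And>n. y n \<le> \<bar>x n\<bar>"
    "\<And>n. e / 2 \<le> q (y n)"
proof -
  have "\<exists>x. \<forall>n::nat. x n \<in> S \<and> e \<le> q (pprt (\<bar>x n\<bar> - 4^n *\<^sub>R (\<Sum>j<n. \<bar>x j\<bar>)))"
  proof (rule dependent_wellorder_choice)
    fix r and f g :: "nat \<Rightarrow> 'a" and n :: nat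
    assume "\<And>m. m < n \<Longrightarrow> f m = g m"
    then have "(\<Sum>j<n. \<bar>f j\<bar>) = (\<Sum>j<n. \<bar>g j\<bar>)" by simp
    then show "(r \<in> S \<and> e \<le> q (pprt (\<bar>r\<bar> - 4^n *\<^sub>R (\<Sum>j<n. \<bar>f j\<bar>)))) =
      (r \<in> S \<and> e \<le> q (pprt (\<bar>r\<bar> - 4^n *\<^sub>R (\<Sum>j<n. \<bar>g j\<bar>))))" by simp
  next
    fix n :: nat and f :: "nat \<Rightarrow> 'a"
    have "0 \<le> (4::real)^n *\<^sub>R (\<Sum>j<n. \<bar>f j\<bar>)" by (intro scaleR_nonneg_nonneg sum_nonneg) auto
    from large[OF this] show "\<exists>r. r \<in> S \<and> e \<le> q (pprt (\<bar>r\<bar> - 4^n *\<^sub>R (\<Sum>j<n. \<bar>f j\<bar>)))" by blast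
  qed
  then obtain x where x: "\<And>n. x n \<in> S"
    and xe: "\<And>n::nat. e \<le> q (pprt (\<bar>x n\<bar> - 4^n *\<^sub>R (\<Sum>j<n. \<bar>x j\<bar>)))" by blast
  obtain K where "\<And>n. norm (x n) \<le> K" using S x unfolding bounded_iff by blast
  then have sm: "summable (\<lambda>n. (1/2)^n *\<^sub>R \<bar>x n\<bar>)"
    by (intro summable_scaled_bounded) (simp add: norm_abs)
  define z where "z = (\<Sum>n. (1/2)^n *\<^sub>R \<bar>x n\<bar>)"
  have xz: "(1/2)^n *\<^sub>R \<bar>x n\<bar> \<le> z" for n
    unfolding z_def by (rule term_le_suminf[OF sm]) (simp add: scaleR_nonneg_nonneg)
  have z0: "0 \<le> z" unfolding z_def by (rule suminf_nonneg_lattice[OF sm]) (simp add: scaleR_nonneg_nonneg)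
  define y where "y n = pprt (\<bar>x n\<bar> - 4^n *\<^sub>R (\<Sum>j<n. \<bar>x j\<bar>) - (1/2)^n *\<^sub>R z)" for n
  have sum0: "0 \<le> (4::real)^n *\<^sub>R (\<Sum>j<n. \<bar>x j\<bar>)" for n
    by (intro scaleR_nonneg_nonneg sum_nonneg) auto
  have z0': "0 \<le> (1/2)^n *\<^sub>R z" for n :: nat using z0 by (simp add: scaleR_nonneg_nonneg)
  have y0: "0 \<le> y n" for n by (simp add: y_def)
  have y_le: "y n \<le> \<bar>x n\<bar>" for n
    unfolding y_def using sum0[of n] z0'[of n]
    by (intro pprt_leI) (auto simp: diff_le_eq add_increasing2)
  have disj: "inf (y j) (y k) = 0" if "j < k" for j k
  proof -
    define s :: real where "s = (1/2)^j * (1/2)^k"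
    have "y j \<le> pprt (\<bar>x j\<bar> - s *\<^sub>R \<bar>x k\<bar>)"
    proof -
      have "s *\<^sub>R \<bar>x k\<bar> \<le> (1/2)^j *\<^sub>R z"
        using scaleR_left_mono[OF xz[of k], of "(1/2)^j"] by (simp add: s_def)
      moreover have "\<bar>x j\<bar> - 4^j *\<^sub>R (\<Sum>i<j. \<bar>x i\<bar>) \<le> \<bar>x j\<bar>" using sum0[of j] by simp
      ultimately show ?thesis unfolding y_def by (intro pprt_diff_mono)
    qed
    moreover have "y k \<le> pprt (\<bar>x k\<bar> - 4^k *\<^sub>R \<bar>x j\<bar>)"
    proof -
      have "\<bar>x j\<bar> \<le> \<bar>x j\<bar> + (\<Sum>i\<in>{..<k} - {j}. \<bar>x i\<bar>)" by (simp add: sum_nonneg)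
      also have "\<dots> = (\<Sum>i<k. \<bar>x i\<bar>)" using that sum.remove[of "{..<k}" j "\<lambda>i. \<bar>x i\<bar>"] by simp
      finally have "\<bar>x j\<bar> \<le> (\<Sum>i<k. \<bar>x i\<bar>)" .
      then have "(4::real)^k *\<^sub>R \<bar>x j\<bar> \<le> 4^k *\<^sub>R (\<Sum>i<k. \<bar>x i\<bar>)" by (intro scaleR_left_mono) auto
      moreover have "\<bar>x k\<bar> - 4^k *\<^sub>R (\<Sum>j<k. \<bar>x j\<bar>) - (1/2)^k *\<^sub>R z
          \<le> \<bar>x k\<bar> - 4^k *\<^sub>R (\<Sum>j<k. \<bar>x j\<bar>)" using z0'[of k] by simp
      ultimately show ?thesis unfolding y_def
        by (intro pprt_mono) (meson diff_left_mono order_trans)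
    qed
    \<comment> \<open>This is where the base \<open>4\<close> is needed: one factor
      \<open>2^k\<close> cancels the weight of \<open>x k\<close> in \<open>z\<close>, the other
      beats the weight \<open>(1/2)^j\<close> in \<open>y j\<close>.\<close>
    moreover have "1 \<le> s * 4^k"
    proof -
      have "(1/2)^k * 4^k = (2::real)^k" by (simp flip: power_mult_distrib)
      then have "s * 4^k = (1/2)^j * 2^k" unfolding s_def by (simp only: mult.assoc)
      also have "\<dots> = 2^(k - j)" using that by (simp add: power_diff power_one_over)
      finally show ?thesis by simp
    qed
    moreover have "0 < s" by (simp add: s_def)
    ultimately show ?thesis
      using disjoint_pprt_scaled[OF abs_ge_zero, of s "4^k" "x j" "\<bar>x k\<bar>"] y0
      by (metis inf_zero_mono)
  qed
  \<comment> \<open>Removing the multiple of \<open>z\<close> costs at most this much; the finitely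
    many terms where it exceeds \<open>e / 2\<close> are dropped by shifting the index.\<close>
  have "(\<lambda>n. (M * norm z) * (1/2)^n) \<longlonglongrightarrow> (M * norm z) * 0"
    by (intro tendsto_intros) auto
  then have "\<forall>\<^sub>F n in sequentially. (M * norm z) * (1/2)^n < e / 2"
    using e by (intro order_tendstoD) auto
  then obtain N where N: "\<And>n. n \<ge> N \<Longrightarrow> (M * norm z) * (1/2)^n < e / 2"
    by (auto simp: eventually_sequentially)
  have large_y: "e / 2 \<le> q (y n)" if "n \<ge> N" for n
  proof -
    have "e \<le> q (y n) + q ((1/2)^n *\<^sub>R z)"
      using xe[of n] pprt_diff_le[OF z0'] unfolding y_def by (meson order_trans)
    moreover have "q ((1/2)^n *\<^sub>R z) \<le> e / 2"
      using bound[of "(1/2)^n *\<^sub>R z"] N[OF that] by (simp add: mult_ac)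
    ultimately show ?thesis by linarith
  qed
  have dis: "disjoint_seq (\<lambda>n. y (n + N))"
    unfolding disjoint_seq_def
  proof (intro allI impI)
    fix m n :: nat assume "m \<noteq> n"
    then show "inf \<bar>y (m + N)\<bar> \<bar>y (n + N)\<bar> = 0"
      using disj[of "m + N" "n + N"] disj[of "n + N" "m + N"] y0
      by (auto simp: inf_commute neq_iff)
  qed
  show ?thesis
    by (rule that[of "\<lambda>n. x (n + N)" "\<lambda>n. y (n + N)"]) (use x dis y0 y_le large_y in auto)
qed

text \<open>An increasing sequence crosses a fixed level upwards only once, so the crossing parts
  \<open>c j n\<close> at level \<open>j\<close> are disjoint in \<open>n\<close> and lie below
  \<open>u\<close>; hence \<open>q\<close> is null on them. Finitely many levels with spacing
  \<open>u / k\<close> control each increment up to \<open>q h\<close>.\<close>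

lemma incseq_increments_tendsto_zero:
  assumes null: "\<And>y. \<lbrakk>disjoint_seq y; \<And>n. 0 \<le> y n; \<And>n. y n \<le> u\<rbrakk> \<Longrightarrow> (\<lambda>n. q (y n)) \<longlonglongrightarrow> 0"
    and x: "incseq x" "\<And>n. 0 \<le> x n" "\<And>n. x n \<le> u"
  shows "(\<lambda>n. q (x (Suc n) - x n)) \<longlonglongrightarrow> 0"
proof (rule LIMSEQ_I)
  fix e :: real assume e: "0 < e"
  obtain k :: nat where k: "2 * (M * norm u) / e < real k" using reals_Archimedean2 by blast
  have M: "0 \<le> M * norm u" using nonneg[of u] bound[of u] by linarith
  with e have "0 \<le> 2 * (M * norm u) / e" by simp
  with k have k0: "0 < real k" by linarith
  have u0: "0 \<le> u" using x(2,3) order_trans by blast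
  define h where "h = (1 / real k) *\<^sub>R u"
  have h0: "0 \<le> h" using u0 k0 by (simp add: h_def scaleR_nonneg_nonneg)
  have kh: "real k *\<^sub>R h = u" using k0 by (simp add: h_def)
  have qh: "q h < e / 2"
  proof -
    have "q h \<le> M * norm u / real k" using bound[of h] k0 by (simp add: h_def)
    also have "\<dots> < e / 2" using k k0 e by (simp add: field_simps)
    finally show ?thesis .
  qed
  define c where "c j n = inf (pprt (x (Suc n) - real j *\<^sub>R h)) (pprt (real j *\<^sub>R h - x n))" for j n
  have c0: "0 \<le> c j n" for j n by (simp add: c_def)
  have jh: "0 \<le> real j *\<^sub>R h" for j using h0 by (simp add: scaleR_nonneg_nonneg)
  have lim: "(\<lambda>n. q (c j n)) \<longlonglongrightarrow> 0" for j
  proof (rule null)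
    have disj: "inf (c j m) (c j n) = 0" if "m < n" for m n
    proof -
      have "x (Suc m) \<le> x n" using x(1) that by (simp add: incseq_def)
      then have "pprt (real j *\<^sub>R h - x n) \<le> pprt (- (x (Suc m) - real j *\<^sub>R h))"
        unfolding minus_diff_eq by (intro pprt_diff_mono) auto
      then show ?thesis
        by (intro inf_zero_mono[OF inf_pprt_pprt_uminus[of "x (Suc m) - real j *\<^sub>R h"]] c0)
          (simp_all add: c_def le_infI1 le_infI2)
    qed
    show "disjoint_seq (c j)"
      unfolding disjoint_seq_def
    proof (intro allI impI)
      fix m n :: nat assume "m \<noteq> n"
      then show "inf \<bar>c j m\<bar> \<bar>c j n\<bar> = 0"
        using disj[of m n] disj[of n m] c0 by (auto simp: inf_commute neq_iff)
    qed
    show "c j n \<le> u" for n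
    proof -
      have "c j n \<le> pprt (x (Suc n) - real j *\<^sub>R h)" by (simp add: c_def)
      also have "\<dots> \<le> x (Suc n)" using jh[of j] x(2) by (intro pprt_leI) auto
      finally show ?thesis using x(3) order_trans by blast
    qed
  qed (rule c0)
  have "(\<lambda>n. 2 * (\<Sum>j<k. q (c j n))) \<longlonglongrightarrow> 2 * (\<Sum>j<k. 0)"
    by (intro tendsto_intros lim)
  then have "\<forall>\<^sub>F n in sequentially. 2 * (\<Sum>j<k. q (c j n)) < e / 2"
    by (rule order_tendstoD(2)) (use e in simp)
  then obtain N where N: "\<And>n. n \<ge> N \<Longrightarrow> 2 * (\<Sum>j<k. q (c j n)) < e / 2"
    by (auto simp: eventually_sequentially)
  have "norm (q (x (Suc n) - x n) - 0) < e" if "n \<ge> N" for n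
  proof -
    have "x (Suc n) - x n \<le> h + 2 *\<^sub>R (\<Sum>j<k. c j n)"
      unfolding c_def using x h0 kh by (intro diff_le_level_crossings) auto
    moreover have "0 \<le> x (Suc n) - x n" using x(1) by (simp add: incseq_Suc_iff)
    ultimately have "q (x (Suc n) - x n) \<le> q (h + 2 *\<^sub>R (\<Sum>j<k. c j n))"
      by (intro mono')
    also have "\<dots> \<le> q h + (q (\<Sum>j<k. c j n) + q (\<Sum>j<k. c j n))"
      using subadd[of h "2 *\<^sub>R (\<Sum>j<k. c j n)"] subadd[of "\<Sum>j<k. c j n" "\<Sum>j<k. c j n"]
      by (simp add: scaleR_2)
    also have "\<dots> \<le> q h + 2 * (\<Sum>j<k. q (c j n))"
      using sum_le[of "\<lambda>j. c j n" "{..<k}"] by simp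
    finally show ?thesis using N[OF that] qh nonneg[of "x (Suc n) - x n"] by simp
  qed
  then show "\<exists>N. \<forall>n\<ge>N. norm (q (x (Suc n) - x n) - 0) < e" by blast
qed

text \<open>If it failed, iterating a choice of later indices from \<open>0\<close> would give a
  subsequence whose increments all have \<open>q\<close> at least \<open>e\<close>.\<close>

lemma incseq_Cauchy:
  assumes null: "\<And>y. \<lbrakk>disjoint_seq y; \<And>n. 0 \<le> y n; \<And>n. y n \<le> u\<rbrakk> \<Longrightarrow> (\<lambda>n. q (y n)) \<longlonglongrightarrow> 0"
    and x: "incseq x" "\<And>n. 0 \<le> x n" "\<And>n. x n \<le> u" and e: "0 < e"
  shows "\<exists>N. \<forall>n\<ge>N. q (x n - x N) < e"
proof (rule ccontr)
  assume "\<not> ?thesis"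
  then have "\<forall>N. \<exists>n. n \<ge> N \<and> e \<le> q (x n - x N)" by (meson not_le)
  then obtain s where s: "\<And>N. s N \<ge> N" "\<And>N. e \<le> q (x (s N) - x N)" by metis
  define X where "X n = x ((s ^^ n) 0)" for n
  have "(\<lambda>n. q (X (Suc n) - X n)) \<longlonglongrightarrow> 0"
  proof (rule incseq_increments_tendsto_zero[OF null])
    show "incseq X"
    proof (rule incseq_SucI)
      show "X n \<le> X (Suc n)" for n
        using incseqD[OF x(1) s(1)[of "(s ^^ n) 0"]] by (simp add: X_def)
    qed
  qed (use x in \<open>auto simp: X_def\<close>)
  moreover have "e \<le> q (X (Suc n) - X n)" for n using s(2) by (simp add: X_def)
  ultimately have "e \<le> 0" by (intro tendsto_lowerbound) auto
  with e show False by simp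
qed

end

section \<open>Positive functionals\<close>

lemma dual_nonneg_iff: "dual_le 0 f \<longleftrightarrow> (\<forall>x\<ge>0. 0 \<le> f x)"
  by (simp add: dual_le_def)

lemma dual_nonnegD: "dual_le 0 f \<Longrightarrow> 0 \<le> x \<Longrightarrow> 0 \<le> f x"
  by (simp add: dual_nonneg_iff)

lemma dual_nonneg_mono:
  assumes "dual_le 0 f" "x \<le> y"
  shows "f x \<le> f y"
  using dual_nonnegD[OF assms(1), of "y - x"] assms(2) by (simp add: blinfun.diff_right)

lemma dual_nonneg_abs_le:
  assumes "dual_le 0 f"
  shows "\<bar>f x\<bar> \<le> f \<bar>x\<bar>"
  using dual_nonneg_mono[OF assms abs_ge_self[of x]]
    dual_nonneg_mono[OF assms abs_ge_minus_self[of x]]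
  by (simp add: blinfun.minus_right)

lemma dual_nonneg_zero: "dual_le 0 0"
  by (simp add: dual_nonneg_iff)

lemma dual_nonneg_add: "dual_le 0 f \<Longrightarrow> dual_le 0 g \<Longrightarrow> dual_le 0 (f + g)"
  by (simp add: dual_nonneg_iff blinfun.add_left)

lemma dual_nonneg_scaleR: "dual_le 0 f \<Longrightarrow> 0 \<le> r \<Longrightarrow> dual_le 0 (r *\<^sub>R f)"
  by (simp add: dual_nonneg_iff blinfun.scaleR_left)

lemma dual_nonneg_sum: "(\<And>i. i \<in> I \<Longrightarrow> dual_le 0 (f i)) \<Longrightarrow> dual_le 0 (\<Sum>i\<in>I. f i)"
  by (simp add: dual_nonneg_iff blinfun.sum_left sum_nonneg)

lemma dual_le_modulus: "dual_le f (dual_modulus f)"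
  and dual_uminus_le_modulus: "dual_le (- f) (dual_modulus f)"
  using dual_modulus_lub[of f] by (auto simp: is_dual_modulus_def)

lemma dual_nonneg_modulus: "dual_le 0 (dual_modulus f)"
  unfolding dual_nonneg_iff
proof (intro allI impI)
  fix x :: 'a assume "0 \<le> x"
  then show "0 \<le> dual_modulus f x"
    using dual_le_modulus[of f] dual_uminus_le_modulus[of f]
    unfolding dual_le_def blinfun.minus_left by fastforce
qed

lemma abs_le_dual_modulus: "\<bar>f x\<bar> \<le> dual_modulus f \<bar>x\<bar>"
  for f :: "'a::banach_lattice \<Rightarrow>\<^sub>L real"
proof -
  have *: "f y \<le> dual_modulus f y" "- f y \<le> dual_modulus f y" if "0 \<le> y" for y
    using dual_le_modulus[of f] dual_uminus_le_modulus[of f] that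
    by (auto simp: dual_le_def blinfun.minus_left)
  have "f x = f (pprt x) - f (pprt (- x))"
    by (metis blinfun.diff_right eq_pprt_diff)
  moreover have "dual_modulus f \<bar>x\<bar> = dual_modulus f (pprt x) + dual_modulus f (pprt (- x))"
    by (simp add: abs_eq_pprt_add blinfun.add_right)
  ultimately show ?thesis
    using *[of "pprt x"] *[of "pprt (- x)"] by auto
qed

lemma dual_modulus_approx:
  assumes "0 \<le> x" "c < dual_modulus f x"
  obtains v where "\<bar>v\<bar> \<le> x" "c < f v"
proof -
  have "\<not> (\<forall>v. \<bar>v\<bar> \<le> x \<longrightarrow> f v \<le> c)"
  proof
    assume "\<forall>v. \<bar>v\<bar> \<le> x \<longrightarrow> f v \<le> c"
    then have "(SUP v\<in>{v. \<bar>v\<bar> \<le> x}. f v) \<le> c"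
      using assms(1) by (intro cSUP_least) (auto intro: exI[of _ 0])
    then show False using assms dual_modulus_Riesz_Kantorovich[of x f] by simp
  qed
  then show ?thesis using that by force
qed

lemma norm_dual_modulus_le: "norm (dual_modulus f) \<le> norm f"
proof (rule norm_blinfun_bound)
  fix x
  have "dual_modulus f \<bar>x\<bar> \<le> norm f * norm x"
  proof (rule ccontr)
    assume "\<not> ?thesis"
    then obtain v where v: "\<bar>v\<bar> \<le> \<bar>x\<bar>" "norm f * norm x < f v"
      by (auto elim: dual_modulus_approx[OF abs_ge_zero, rotated] simp: not_le)
    have "f v \<le> norm f * norm v" using norm_blinfun[of f v] by simp
    also have "\<dots> \<le> norm f * norm x" by (intro mult_left_mono norm_mono_abs v) auto
    finally show False using v by simp
  qed
  then show "norm (dual_modulus f x) \<le> norm f * norm x"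
    using dual_nonneg_abs_le[OF dual_nonneg_modulus, of f x] by simp
qed simp

text \<open>Sums of finitely many disjoint elements below \<open>x\<close> stay below
  \<open>x\<close>, so the values of \<open>f\<close> form a convergent series.\<close>

lemma order_bounded_disjoint_null:
  assumes f: "dual_le 0 f" and z: "\<And>m n. m \<noteq> n \<Longrightarrow> inf (z m) (z n) = 0"
    "\<And>n::nat. 0 \<le> z n" "\<And>n. z n \<le> x"
  shows "(\<lambda>n. f (z n)) \<longlonglongrightarrow> 0"
proof -
  have "0 \<le> x" using z order_trans by blast
  have "summable (\<lambda>n. f (z n))"
  proof (rule bounded_imp_summable)
    show "0 \<le> f (z n)" for n using f z by (simp add: dual_nonnegD)
    have "(\<Sum>i<Suc n. z i) \<le> x" for n
      using z \<open>0 \<le> x\<close> by (intro sum_le_of_disjoint) auto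
    from dual_nonneg_mono[OF f this] show "(\<Sum>k\<le>n. f (z k)) \<le> f x" for n
      by (simp add: blinfun.sum_right lessThan_Suc_atMost)
  qed
  then show ?thesis by (rule summable_LIMSEQ_zero)
qed

lemma lattice_seminorm_functional:
  assumes "dual_le 0 f"
  shows "lattice_seminorm (\<lambda>x. f \<bar>x\<bar>) (norm f)"
proof
  fix x y
  show "f \<bar>x + y\<bar> \<le> f \<bar>x\<bar> + f \<bar>y\<bar>"
    using dual_nonneg_mono[OF assms abs_triangle_ineq] by (simp add: blinfun.add_right)
  show "f \<bar>x\<bar> \<le> norm f * norm x"
    using norm_blinfun[of f "\<bar>x\<bar>"] by (simp add: norm_abs)
qed (rule dual_nonneg_mono[OF assms])

section \<open>Dominating a family of functionals on an order interval\<close>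

locale bounded_positive_family =
  fixes G :: "nat \<Rightarrow> 'a::banach_lattice \<Rightarrow>\<^sub>L real" and M :: real
  assumes pos: "dual_le 0 (G i)" and norm_le: "norm (G i) \<le> M"
begin

definition q :: "'a \<Rightarrow> real" where "q x = (SUP i. G i \<bar>x\<bar>)"

lemma G_bound: "G i \<bar>x\<bar> \<le> M * norm x"
proof -
  have "G i \<bar>x\<bar> \<le> norm (G i) * norm x"
    using norm_blinfun[of "G i" "\<bar>x\<bar>"] by (simp add: norm_abs)
  also have "\<dots> \<le> M * norm x" by (intro mult_right_mono norm_le) auto
  finally show ?thesis .
qed

lemma bdd: "bdd_above (range (\<lambda>i. G i \<bar>x\<bar>))"
  using G_bound by (intro bdd_aboveI2)

lemma G_le_q: "G i \<bar>x\<bar> \<le> q x"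
  unfolding q_def by (intro cSUP_upper bdd) auto

lemma q_leI: "(\<And>i. G i \<bar>x\<bar> \<le> c) \<Longrightarrow> q x \<le> c"
  unfolding q_def by (intro cSUP_least) auto

lemma less_q: "c < q x \<Longrightarrow> \<exists>i. c < G i \<bar>x\<bar>"
  using q_leI[of x c] by (meson not_le)

sublocale lattice_seminorm q M
proof
  fix x y
  show "q (x + y) \<le> q x + q y"
  proof (rule q_leI)
    fix i
    have "G i \<bar>x + y\<bar> \<le> G i \<bar>x\<bar> + G i \<bar>y\<bar>"
      using dual_nonneg_mono[OF pos abs_triangle_ineq] by (simp add: blinfun.add_right)
    then show "G i \<bar>x + y\<bar> \<le> q x + q y" using G_le_q[of i x] G_le_q[of i y] by linarith
  qed
  show "q x \<le> M * norm x" by (intro q_leI G_bound)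
  assume "\<bar>x\<bar> \<le> \<bar>y\<bar>"
  then show "q x \<le> q y"
    using G_le_q dual_nonneg_mono[OF pos] by (intro q_leI) (meson order_trans)
qed

text \<open>Otherwise one finds functionals \<open>\<gamma> n\<close> of the family and \<open>y n\<close> in the interval with
  \<open>\<gamma> n (y n) > e\<close> while \<open>\<gamma> j (y n)\<close> is tiny for \<open>j < n\<close>. The tails \<open>sup {y m | m \<ge> n}\<close> then
  form, up to small errors, a decreasing sequence on which \<open>q\<close> is not Cauchy.\<close>

lemma dominated_on_interval:
  assumes null: "\<And>y. \<lbrakk>disjoint_seq y; \<And>n. 0 \<le> y n; \<And>n. y n \<le> u\<rbrakk> \<Longrightarrow> (\<lambda>n. q (y n)) \<longlonglongrightarrow> 0"
    and e: "0 < e"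
  shows "\<exists>f. dual_le 0 f \<and> (\<forall>y. 0 \<le> y \<longrightarrow> y \<le> u \<longrightarrow> q y \<le> f y + e)"
proof (rule ccontr)
  assume neg: "\<not> ?thesis"
  have "\<exists>y i. 0 \<le> y \<and> y \<le> u \<and> f y + e < G i y" if "dual_le 0 f" for f
  proof -
    obtain y where "0 \<le> y" "y \<le> u" "f y + e < q y" using neg \<open>dual_le 0 f\<close> by (meson not_le)
    then show ?thesis using less_q[of "f y + e" y] by auto
  qed
  then obtain Y I where YI: "\<And>f. dual_le 0 f \<Longrightarrow> 0 \<le> Y f \<and> Y f \<le> u \<and> f (Y f) + e < G (I f) (Y f)"
    by metis
  define M' where "M' = M * norm u"
  have M': "0 \<le> M'" using nonneg[of u] bound[of u] by (simp add: M'_def)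
  \<comment> \<open>Chosen so that the geometric series of the bounds
    \<open>(M' / K) * (1/2)^d\<close> in \<open>small\<close> sums to at most
    \<open>e / 4\<close>.\<close>
  define K where "K = 8 * M' / e + 1"
  have K: "0 < K" "2 * (M' / K) \<le> e / 4"
    using M' e by (auto simp: K_def add_nonneg_pos field_simps)
  \<comment> \<open>Doubling at every stage gives each earlier functional \<open>g j\<close>
    exponentially growing weight in \<open>F n\<close>. As \<open>F n (y n)\<close> stays below
    \<open>M'\<close>, the values \<open>g j (y n)\<close> decay geometrically.\<close>
  define F where "F = rec_nat 0 (\<lambda>_ h. 2 *\<^sub>R h + K *\<^sub>R G (I h))"
  have F0: "F 0 = 0" and FS: "F (Suc n) = 2 *\<^sub>R F n + K *\<^sub>R G (I (F n))" for n
    by (simp_all add: F_def)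
  have F: "dual_le 0 (F n)" for n
  proof (induction n)
    case (Suc n)
    then show ?case unfolding FS using K(1)
      by (intro dual_nonneg_add dual_nonneg_scaleR pos) auto
  qed (simp add: F0 dual_nonneg_zero)
  define y where "y n = Y (F n)" for n
  define g where "g n = G (I (F n))" for n
  have y: "0 \<le> y n" "y n \<le> u" and yg: "F n (y n) + e < g n (y n)" for n
    using YI[OF F, of n] by (auto simp: y_def g_def)
  have g: "dual_le 0 (g n)" for n by (simp add: g_def pos)
  have g_le_q: "g n x \<le> q x" if "0 \<le> x" for n x
    using G_le_q[of "I (F n)" x] that by (simp add: g_def)
  have gM: "g n (y m) \<le> M'" for n m
    using g_le_q[OF y(1), of n m] mono'[OF y, of m] bound[of u] unfolding M'_def by linarith
  have F_lower: "K * 2^d * g j x \<le> F (Suc (j + d)) x" if "0 \<le> x" for j d x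
  proof (induction d)
    case 0
    then show ?case using dual_nonnegD[OF F that, of j]
      by (simp add: FS g_def blinfun.add_left blinfun.scaleR_left)
  next
    case (Suc d)
    have "F (Suc (j + Suc d)) x = 2 * F (Suc (j + d)) x + K * g (Suc (j + d)) x"
      by (simp add: FS[of "Suc (j + d)"] g_def blinfun.add_left blinfun.scaleR_left)
    moreover have "0 \<le> K * g (Suc (j + d)) x" using dual_nonnegD[OF g that] K(1) by simp
    ultimately show ?case using Suc by simp
  qed
  have small: "g j (y (Suc j + d)) \<le> (M' / K) * (1/2)^d" for j d
  proof -
    have "K * 2^d * g j (y (Suc j + d)) \<le> M'"
      using F_lower[OF y(1), of d j "Suc j + d"] yg[of "Suc j + d"] gM[of "Suc j + d" "Suc j + d"] e
      by simp
    then show ?thesis using K(1) by (simp add: field_simps power_one_over)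
  qed
  \<comment> \<open>The supremum of a whole tail need not exist. By \<open>incseq_Cauchy\<close> a
    finite piece of the tail can be taken so long that further terms change it by less than
    \<open>\<delta> n\<close> in \<open>q\<close>.\<close>
  define s where "s n d = Sup_fin (y ` {n..n+d})" for n d
  have s_upper: "y m \<le> s n d" if "n \<le> m" "m \<le> n + d" for m n d
    unfolding s_def using that by (intro Sup_fin.coboundedI) auto
  have s_least: "s n d \<le> b" if "\<And>m. n \<le> m \<Longrightarrow> m \<le> n + d \<Longrightarrow> y m \<le> b" for n d b
    unfolding s_def using that by (intro Sup_fin.boundedI) auto
  have s_nonneg: "0 \<le> s n d" for n d using s_upper[of n n d] y(1) by (meson le_add1 order_refl order_trans)
  define \<delta> where "\<delta> j = e / 8 * (1/2)^j" for j :: nat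
  have \<delta>: "0 < \<delta> j" for j using e by (simp add: \<delta>_def)
  have geo: "(\<Sum>i\<le>n. (1/2::real)^i) \<le> 2" for n
  proof -
    have "(\<Sum>i\<le>n. (1/2::real)^i) \<le> (\<Sum>i. (1/2)^i)"
      by (intro sum_le_suminf) (auto simp: summable_geometric)
    then show ?thesis by (simp add: suminf_geometric)
  qed
  have "\<exists>N. \<forall>d\<ge>N. q (s n d - s n N) < \<delta> n" for n
  proof (rule incseq_Cauchy[OF null])
    show "incseq (s n)" unfolding incseq_def by (auto intro!: s_least s_upper)
    show "s n d \<le> u" for d by (intro s_least y)
  qed (auto intro: s_nonneg \<delta>)
  then obtain D where D: "\<And>n d. d \<ge> D n \<Longrightarrow> q (s n d - s n (D n)) < \<delta> n" by metis
  define t where "t n = s n (D n)" for n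
  have t0: "0 \<le> t n" for n by (simp add: t_def s_nonneg)
  have yt: "y n \<le> t n" and tu: "t n \<le> u" for n
    unfolding t_def by (auto intro: s_upper s_least y)
  have tt: "q (pprt (t n - t j)) \<le> \<delta> j" if "j \<le> n" for j n
  proof -
    define d where "d = max (n + D n) (D j)"
    have "t n \<le> s j d" unfolding t_def using that
      by (intro s_least s_upper) (auto simp: d_def)
    moreover have "s j (D j) \<le> s j d" by (intro s_least s_upper) (auto simp: d_def)
    ultimately have "pprt (t n - t j) \<le> s j d - s j (D j)"
      unfolding t_def by (intro pprt_leI diff_right_mono) auto
    then have "q (pprt (t n - t j)) \<le> q (s j d - s j (D j))" by (intro mono') auto
    also have "\<dots> < \<delta> j" by (intro D) (simp add: d_def)
    finally show ?thesis by simp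
  qed
  \<comment> \<open>The \<open>t n\<close> decrease only up to the errors \<open>\<delta> j\<close>;
    running infima decrease exactly, and lose at most the sum of those errors,
    \<open>e / 4\<close>.\<close>
  define r where "r = rec_nat (t 0) (\<lambda>n h. inf h (t (Suc n)))"
  have r0: "r 0 = t 0" and rS: "r (Suc n) = inf (r n) (t (Suc n))" for n by (simp_all add: r_def)
  have r_nonneg: "0 \<le> r n" for n by (induction n) (auto simp: r0 rS t0)
  have r_le: "r n \<le> t n" for n by (cases n) (auto simp: r0 rS)
  have r_diff: "x - r n \<le> (\<Sum>j\<le>n. pprt (x - t j))" for x n
  proof (induction n)
    case 0
    then show ?case by (simp add: r0 le_pprt)
  next
    case (Suc n)
    define S where "S = (\<Sum>j\<le>n. pprt (x - t j))"
    have S: "0 \<le> S" by (simp add: S_def sum_nonneg)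
    have "x - (S + pprt (x - t (Suc n))) \<le> r n"
      using Suc unfolding S_def[symmetric]
      by (simp add: diff_le_eq add.assoc[symmetric]) (metis add.commute add_increasing2 zero_le_pprt)
    moreover have "x - (S + pprt (x - t (Suc n))) \<le> t (Suc n)"
      using add_increasing[OF S le_pprt[of "x - t (Suc n)"]]
      by (simp add: diff_le_eq add.commute)
    ultimately have "x - (S + pprt (x - t (Suc n))) \<le> r (Suc n)"
      unfolding rS by (rule inf_greatest)
    then show ?case by (simp add: S_def diff_le_eq add.commute del: diff_inf_eq_sup)
  qed
  have qtr: "q (t n - r n) \<le> e / 4" for n
  proof -
    have "q (t n - r n) \<le> q (\<Sum>j\<le>n. pprt (t n - t j))"
      using r_diff[of "t n" n] r_le[of n] by (intro mono') auto
    also have "\<dots> \<le> (\<Sum>j\<le>n. q (pprt (t n - t j)))" by (rule sum_le)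
    also have "\<dots> \<le> (\<Sum>j\<le>n. \<delta> j)" by (intro sum_mono tt) auto
    also have "\<dots> = e / 8 * (\<Sum>j\<le>n. (1/2)^j)" by (simp add: \<delta>_def sum_distrib_left)
    also have "\<dots> \<le> e / 8 * 2" by (intro mult_left_mono geo) (use e in auto)
    finally show ?thesis by simp
  qed
  have gt: "g n (t (Suc n)) \<le> e / 4" for n
  proof -
    have "t (Suc n) \<le> (\<Sum>i\<le>D (Suc n). y (Suc n + i))"
      unfolding t_def
    proof (rule s_least)
      fix m assume m: "Suc n \<le> m" "m \<le> Suc n + D (Suc n)"
      define i where "i = m - Suc n"
      have i: "m = Suc n + i" "i \<in> {..D (Suc n)}" using m by (auto simp: i_def)
      have "y (Suc n + i) + 0 \<le> y (Suc n + i) + (\<Sum>i\<in>{..D (Suc n)} - {i}. y (Suc n + i))"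
        by (intro add_left_mono sum_nonneg y)
      then show "y m \<le> (\<Sum>i\<le>D (Suc n). y (Suc n + i))"
        using i sum.remove[OF _ i(2), of "\<lambda>i. y (Suc n + i)"] by simp
    qed
    then have "g n (t (Suc n)) \<le> (\<Sum>i\<le>D (Suc n). g n (y (Suc n + i)))"
      using dual_nonneg_mono[OF g] by (simp only: blinfun.sum_right[symmetric])
    also have "\<dots> \<le> (\<Sum>i\<le>D (Suc n). (M' / K) * (1/2)^i)" by (intro sum_mono small)
    also have "\<dots> = (M' / K) * (\<Sum>i\<le>D (Suc n). (1/2)^i)" by (simp only: sum_distrib_left)
    also have "\<dots> \<le> (M' / K) * 2" using M' K(1) by (intro mult_left_mono geo) auto
    finally show ?thesis using K(2) by simp
  qed
  \<comment> \<open>\<open>g n\<close> is above \<open>e\<close> at \<open>y n\<close>, hence at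
    \<open>t n\<close>; passing to \<open>r n\<close> loses \<open>e / 4\<close>, and at
    \<open>r (Suc n)\<close> it is at most \<open>e / 4\<close>.\<close>
  have low: "e / 2 \<le> q (r n - r (Suc n))" for n
  proof -
    have "g n (y n) \<le> g n (t n)" by (intro dual_nonneg_mono[OF g] yt)
    moreover have "g n (t n) - g n (r n) \<le> q (t n - r n)"
      using g_le_q[of "t n - r n" n] r_le[of n] by (simp add: blinfun.diff_right)
    moreover have "g n (r (Suc n)) \<le> g n (t (Suc n))" by (intro dual_nonneg_mono[OF g] r_le)
    moreover have "g n (r n) - g n (r (Suc n)) \<le> q (r n - r (Suc n))"
      using g_le_q[of "r n - r (Suc n)" n] by (simp add: rS blinfun.diff_right del: diff_inf_eq_sup)
    moreover have "0 \<le> F n (y n)" by (intro dual_nonnegD[OF F] y)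
    ultimately show ?thesis using qtr[of n] gt[of n] yg[of n] by linarith
  qed
  have "(\<lambda>n. q ((u - r (Suc n)) - (u - r n))) \<longlonglongrightarrow> 0"
  proof (rule incseq_increments_tendsto_zero[OF null])
    show "incseq (\<lambda>n. u - r n)" by (intro incseq_SucI diff_left_mono) (simp add: rS)
    show "0 \<le> u - r n" for n using r_le[of n] tu[of n] by (simp add: order_trans[OF r_le tu])
    show "u - r n \<le> u" for n using r_nonneg[of n] by simp
  qed
  moreover have "(u - r (Suc n)) - (u - r n) = r n - r (Suc n)" for n by (simp add: algebra_simps del: diff_inf_eq_sup)
  ultimately have "(\<lambda>n. q (r n - r (Suc n))) \<longlonglongrightarrow> 0" by (simp only:)
  from tendsto_lowerbound[OF this, of "e / 2"] have "e / 2 \<le> 0" using low by simp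
  with e show False by simp
qed

end

section \<open>Totally bounded sets are super weakly precompact\<close>

lemma disjoint_seq_nonneg:
  assumes "disjoint_seq y" "\<And>n. 0 \<le> y n" "m \<noteq> n"
  shows "inf (y m) (y n) = 0"
  using assms unfolding disjoint_seq_def by (metis abs_of_nonneg)

lemma abs_weak_totally_boundedD:
  assumes "abs_weak_totally_bounded A" "dual_le 0 f" "0 < e"
  obtains \<Phi> where "finite \<Phi>" "\<Phi> \<subseteq> A" "\<And>a. a \<in> A \<Longrightarrow> \<exists>\<phi>\<in>\<Phi>. f \<bar>a - \<phi>\<bar> < e"
proof -
  obtain \<Phi> where \<Phi>: "finite \<Phi>" "\<Phi> \<subseteq> A"
    "A \<subseteq> \<Phi> + (\<Inter>g\<in>{f}. {x. abs_weak_seminorm g x < e})"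
    using assms(1,3) unfolding abs_weak_totally_bounded_def by (meson finite.emptyI finite.insertI)
  have "\<exists>\<phi>\<in>\<Phi>. f \<bar>a - \<phi>\<bar> < e" if "a \<in> A" for a
  proof -
    from that \<Phi>(3) obtain \<phi> r where "\<phi> \<in> \<Phi>" "a = \<phi> + r" "abs_weak_seminorm f r < e"
      by (auto elim!: set_plus_elim)
    moreover have "f \<bar>r\<bar> \<le> dual_modulus f \<bar>r\<bar>"
      using dual_le_modulus[of f] by (simp add: dual_le_def)
    ultimately show ?thesis by (intro bexI[of _ \<phi>]) (auto simp: abs_weak_seminorm_def)
  qed
  with \<Phi> that show ?thesis by blast
qed

text \<open>If \<open>\<phi>\<close> is a net point near \<open>x n\<close>, then \<open>y n\<close>
  lies below \<open>inf \<bar>\<phi>\<bar> (y n) + \<bar>x n - \<phi>\<bar>\<close>. For fixed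
  \<open>\<phi>\<close> the first term is disjoint and order bounded, hence null; as
  \<open>\<phi>\<close> varies with \<open>n\<close>, all net points are summed.\<close>

lemma disjoint_in_solid_hull_null:
  assumes A: "abs_weak_totally_bounded A" and f: "dual_le 0 f"
    and y: "disjoint_seq y" "\<And>n. 0 \<le> y n" "\<And>n. y n \<le> \<bar>x n\<bar>" and x: "\<And>n. x n \<in> A"
  shows "(\<lambda>n. f (y n)) \<longlonglongrightarrow> 0"
proof (rule LIMSEQ_I)
  fix e :: real assume e: "0 < e"
  then obtain \<Phi> where \<Phi>: "finite \<Phi>" "\<And>a. a \<in> A \<Longrightarrow> \<exists>\<phi>\<in>\<Phi>. f \<bar>a - \<phi>\<bar> < e / 2"
    using abs_weak_totally_boundedD[OF A f, of "e / 2"] by (metis half_gt_zero)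
  have "(\<lambda>n. f (inf \<bar>\<phi>\<bar> (y n))) \<longlonglongrightarrow> 0" for \<phi>
  proof (rule order_bounded_disjoint_null[OF f])
    show "0 \<le> inf \<bar>\<phi>\<bar> (y n)" for n using y(2) by simp
    show "inf (inf \<bar>\<phi>\<bar> (y m)) (inf \<bar>\<phi>\<bar> (y n)) = 0" if "m \<noteq> n" for m n
      by (rule inf_zero_mono[OF disjoint_seq_nonneg[OF y(1,2) that]]) (simp_all add: y(2))
    show "inf \<bar>\<phi>\<bar> (y n) \<le> \<bar>\<phi>\<bar>" for n by simp
  qed
  then have "(\<lambda>n. \<Sum>\<phi>\<in>\<Phi>. f (inf \<bar>\<phi>\<bar> (y n))) \<longlonglongrightarrow> (\<Sum>\<phi>\<in>\<Phi>. 0)" by (intro tendsto_sum)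
  then have "\<forall>\<^sub>F n in sequentially. (\<Sum>\<phi>\<in>\<Phi>. f (inf \<bar>\<phi>\<bar> (y n))) < e / 2"
    by (rule order_tendstoD(2)) (use e in simp)
  then obtain N where N: "\<And>n. n \<ge> N \<Longrightarrow> (\<Sum>\<phi>\<in>\<Phi>. f (inf \<bar>\<phi>\<bar> (y n))) < e / 2"
    by (auto simp: eventually_sequentially)
  have "norm (f (y n) - 0) < e" if "n \<ge> N" for n
  proof -
    obtain \<phi> where \<phi>: "\<phi> \<in> \<Phi>" "f \<bar>x n - \<phi>\<bar> < e / 2" using \<Phi>(2)[OF x] by blast
    have "\<bar>x n\<bar> \<le> \<bar>\<phi>\<bar> + \<bar>x n - \<phi>\<bar>" using abs_triangle_ineq[of \<phi> "x n - \<phi>"] by simp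
    then have "y n = inf (\<bar>\<phi>\<bar> + \<bar>x n - \<phi>\<bar>) (y n)"
      using y(3)[of n] by (metis inf_absorb2 order_trans)
    also have "\<dots> \<le> inf \<bar>\<phi>\<bar> (y n) + (inf \<bar>x n - \<phi>\<bar> (y n))" by (intro inf_add_le y) auto
    also have "\<dots> \<le> inf \<bar>\<phi>\<bar> (y n) + \<bar>x n - \<phi>\<bar>" by (intro add_left_mono inf_le1)
    finally have "f (y n) \<le> f (inf \<bar>\<phi>\<bar> (y n)) + f \<bar>x n - \<phi>\<bar>"
      using dual_nonneg_mono[OF f] by (simp only: blinfun.add_right[symmetric])
    moreover have "f (inf \<bar>\<phi>\<bar> (y n)) \<le> (\<Sum>\<phi>\<in>\<Phi>. f (inf \<bar>\<phi>\<bar> (y n)))"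
      using y(2) by (intro member_le_sum \<Phi> \<phi> dual_nonnegD[OF f]) auto
    ultimately show ?thesis using N[OF that] \<phi>(2) dual_nonnegD[OF f y(2)[of n]] by simp
  qed
  then show "\<exists>N. \<forall>n\<ge>N. norm (f (y n) - 0) < e" by blast
qed

section \<open>Operators into \<open>c0\<close> through their coordinate functionals\<close>

lemma bounded_linear_c0_nth: "bounded_linear (\<lambda>x. c0_nth x i)"
  by (rule bounded_linear_intro[where K = 1]) (auto simp: c0_nth_le_norm)

definition c0_coord :: "nat \<Rightarrow> ('a::banach_lattice \<Rightarrow>\<^sub>L c0) \<Rightarrow> 'a \<Rightarrow>\<^sub>L real" where
  "c0_coord i T = Blinfun (\<lambda>x. c0_nth (T x) i)"

lemma c0_coord_apply [simp]: "c0_coord i T x = c0_nth (T x) i"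
proof -
  have "bounded_linear (\<lambda>x. c0_nth (T x) i)"
    using bounded_linear_compose[OF bounded_linear_c0_nth[of i] blinfun.bounded_linear_right[of T]] .
  then show ?thesis by (simp add: c0_coord_def bounded_linear_Blinfun_apply)
qed

lemma norm_c0_coord_le: "norm (c0_coord i T) \<le> norm T"
proof (rule norm_blinfun_bound)
  fix x
  show "norm (c0_coord i T x) \<le> norm T * norm x"
    using c0_nth_le_norm[of "T x" i] norm_blinfun[of T x] by simp
qed simp

lemma bounded_positive_family_coord:
  "bounded_positive_family (\<lambda>i. dual_modulus (c0_coord i T)) (norm T)"
proof
  show "norm (dual_modulus (c0_coord i T)) \<le> norm T" for i
    using norm_dual_modulus_le norm_c0_coord_le order_trans by blast
qed (rule dual_nonneg_modulus)

lemma compact_closureI: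
  fixes S :: "'b::banach set"
  assumes "\<And>e. 0 < e \<Longrightarrow> \<exists>k. finite k \<and> (\<forall>x\<in>S. \<exists>y\<in>k. dist x y < e)"
  shows "compact (closure S)"
  unfolding compact_eq_totally_bounded
proof (intro conjI allI impI)
  show "complete (closure S)" by (simp add: complete_eq_closed)
  fix e :: real assume e: "0 < e"
  then obtain k where k: "finite k" "\<forall>x\<in>S. \<exists>y\<in>k. dist x y < e / 2"
    using assms[of "e / 2"] by auto
  have "closure S \<subseteq> (\<Union>x\<in>k. ball x e)"
  proof
    fix x assume "x \<in> closure S"
    then obtain z where "z \<in> S" "dist z x < e / 2"
      using e unfolding closure_approachable by (metis half_gt_zero)
    moreover from this k obtain y where "y \<in> k" "dist z y < e / 2" by blast
    ultimately show "x \<in> (\<Union>x\<in>k. ball x e)"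
      using dist_triangle_half_l[of y z e x] by (auto simp: dist_commute)
  qed
  with k(1) show "\<exists>k. finite k \<and> closure S \<subseteq> (\<Union>x\<in>k. ball x e)" by blast
qed

lemma abs_weak_totally_bounded_imp_compact:
  fixes T :: "'a::banach_lattice \<Rightarrow>\<^sub>L c0"
  assumes A: "abs_weak_totally_bounded A" "bounded A" and T: "almost_dunford_pettis T"
  shows "compact (closure (T ` A))"
proof -
  interpret bounded_positive_family "\<lambda>i. dual_modulus (c0_coord i T)" "norm T"
    by (rule bounded_positive_family_coord)
  have norm_T_le: "norm (T x) \<le> q x" for x
    using abs_le_dual_modulus[of "c0_coord _ T" x] G_le_q[of _ x]
    by (intro c0_norm_le) (metis c0_coord_apply order_trans)
  \<comment> \<open>By the Riesz-Kantorovich formula \<open>q (y n)\<close> is nearly attained as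
    \<open>norm (T v)\<close> for some \<open>v\<close> with modulus below \<open>y n\<close>. Such
    \<open>v\<close> inherit disjointness and weak nullity, so the hypothesis on \<open>T\<close>
    applies to them.\<close>
  have null: "(\<lambda>n. q (y n)) \<longlonglongrightarrow> 0"
    if y: "disjoint_seq y" "\<And>n. 0 \<le> y n" and wn: "\<And>f. dual_le 0 f \<Longrightarrow> (\<lambda>n. f (y n)) \<longlonglongrightarrow> 0" for y
  proof -
    have "\<exists>v. \<bar>v\<bar> \<le> y n \<and> q (y n) \<le> norm (T v) + 1 / real (Suc n)" for n
    proof -
      have "q (y n) - 1 / real (Suc n) < q (y n)" by simp
      then obtain i where "q (y n) - 1 / real (Suc n) < dual_modulus (c0_coord i T) (y n)"
        using less_q y(2)[of n] by (metis abs_of_nonneg)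
      then obtain v where v: "\<bar>v\<bar> \<le> y n" "q (y n) - 1 / real (Suc n) < c0_coord i T v"
        using dual_modulus_approx[OF y(2)] by blast
      moreover have "c0_coord i T v \<le> norm (T v)" using c0_nth_le_norm[of "T v" i] by simp
      ultimately show ?thesis by (intro exI[of _ v]) auto
    qed
    then obtain v where v: "\<And>n. \<bar>v n\<bar> \<le> y n" "\<And>n. q (y n) \<le> norm (T (v n)) + 1 / real (Suc n)"
      by metis
    have "disjoint_seq v" unfolding disjoint_seq_def
    proof (intro allI impI)
      fix m n :: nat assume "m \<noteq> n"
      then show "inf \<bar>v m\<bar> \<bar>v n\<bar> = 0"
        by (intro inf_zero_mono[OF disjoint_seq_nonneg[OF y \<open>m \<noteq> n\<close>]] v abs_ge_zero)
    qed
    moreover have "weakly_null v" unfolding weakly_null_def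
    proof
      fix f :: "'a \<Rightarrow>\<^sub>L real"
      have "norm (f (v n)) \<le> dual_modulus f (y n)" for n
        using abs_le_dual_modulus[of f "v n"] dual_nonneg_mono[OF dual_nonneg_modulus v(1)[of n], of f]
        by simp
      then show "(\<lambda>n. f (v n)) \<longlonglongrightarrow> 0"
        by (intro Lim_null_comparison[OF always_eventually wn[OF dual_nonneg_modulus]]) auto
    qed
    ultimately have lim: "(\<lambda>n. norm (T (v n)) + 1 / real (Suc n)) \<longlonglongrightarrow> 0 + 0"
      using T unfolding almost_dunford_pettis_def
      by (intro tendsto_add LIMSEQ_Suc[OF lim_1_over_n]) auto
    have "norm (q (y n)) \<le> norm (T (v n)) + 1 / real (Suc n)" for n
      using v(2)[of n] nonneg[of "y n"] by simp
    then show ?thesis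
      by (intro Lim_null_comparison[OF always_eventually lim[unfolded add_0_right]] allI)
  qed
  have null_interval: "(\<lambda>n. q (y n)) \<longlonglongrightarrow> 0"
    if y: "disjoint_seq y" "\<And>n. 0 \<le> y n" "\<And>n. y n \<le> u" for u y
    using y disjoint_seq_nonneg[OF y(1,2)] by (intro null order_bounded_disjoint_null[of _ y u]) auto
  have trunc: "\<exists>u\<ge>0. \<forall>x\<in>A. q (pprt (\<bar>x\<bar> - u)) < e" if e: "0 < e" for e
  proof (rule ccontr)
    assume "\<not> ?thesis"
    then have "\<exists>x\<in>A. e \<le> q (pprt (\<bar>x\<bar> - u))" if "0 \<le> u" for u using that by (meson not_le)
    from disjoint_subsequence[OF A(2) e this] obtain x y where xy: "\<And>n. x n \<in> A" "disjoint_seq y"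
      "\<And>n. 0 \<le> y n" "\<And>n. y n \<le> \<bar>x n\<bar>" "\<And>n. e / 2 \<le> q (y n)" by metis
    have "(\<lambda>n. q (y n)) \<longlonglongrightarrow> 0"
      by (intro null disjoint_in_solid_hull_null[OF A(1) _ xy(2-4,1)] xy)
    from tendsto_lowerbound[OF this, of "e / 2"] xy(5) e show False by simp
  qed
  show ?thesis
  proof (rule compact_closureI)
    fix e :: real assume e: "0 < e"
    \<comment> \<open>Four errors add up: the net for \<open>f\<close>, the domination of
      \<open>q\<close> by \<open>f\<close>, and the parts of \<open>a\<close> and of
      \<open>\<phi>\<close> above \<open>u\<close>. Since \<open>\<bar>a - \<phi>\<bar> \<le>
      \<bar>a\<bar> + \<bar>\<phi>\<bar>\<close>, domination is needed up to
      \<open>u + u\<close>.\<close>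
    define d where "d = e / 4"
    have d: "0 < d" using e by (simp add: d_def)
    obtain u where u: "0 \<le> u" "\<And>x. x \<in> A \<Longrightarrow> q (pprt (\<bar>x\<bar> - u)) < d" using trunc[OF d] by blast
    obtain f where f: "dual_le 0 f" "\<And>y. 0 \<le> y \<Longrightarrow> y \<le> u + u \<Longrightarrow> q y \<le> f y + d"
      using dominated_on_interval[OF null_interval[where u = "u + u"] d] by blast
    obtain \<Phi> where \<Phi>: "finite \<Phi>" "\<Phi> \<subseteq> A" "\<And>a. a \<in> A \<Longrightarrow> \<exists>\<phi>\<in>\<Phi>. f \<bar>a - \<phi>\<bar> < d"
      using abs_weak_totally_boundedD[OF A(1) f(1) d] by metis
    have "\<exists>\<phi>\<in>\<Phi>. dist (T a) (T \<phi>) < e" if a: "a \<in> A" for a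
    proof -
      obtain \<phi> where \<phi>: "\<phi> \<in> \<Phi>" "f \<bar>a - \<phi>\<bar> < d" using \<Phi>(3)[OF a] by blast
      define r where "r = \<bar>a - \<phi>\<bar>"
      have "norm (T a - T \<phi>) \<le> q r"
        using norm_T_le[of "a - \<phi>"] by (simp add: blinfun.diff_right r_def)
      also have "r = inf r (u + u) + pprt (r - (u + u))"
        using inf_eq_diff_pprt[of r "u + u"] by simp
      then have "q r \<le> q (inf r (u + u)) + q (pprt (r - (u + u)))"
        using subadd by metis
      also have "q (inf r (u + u)) \<le> f r + d"
      proof -
        have "q (inf r (u + u)) \<le> f (inf r (u + u)) + d" using u(1) by (intro f(2)) (auto simp: r_def)
        also have "f (inf r (u + u)) \<le> f r" by (intro dual_nonneg_mono[OF f(1)]) simp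
        finally show ?thesis by simp
      qed
      also have "q (pprt (r - (u + u))) \<le> q (pprt (\<bar>a\<bar> - u)) + q (pprt (\<bar>\<phi>\<bar> - u))"
      proof -
        have "r - (u + u) \<le> (\<bar>a\<bar> - u) + (\<bar>\<phi>\<bar> - u)"
          unfolding r_def using abs_triangle_ineq4[of a \<phi>] by (simp add: algebra_simps)
        then have "pprt (r - (u + u)) \<le> pprt (\<bar>a\<bar> - u) + pprt (\<bar>\<phi>\<bar> - u)"
          using pprt_add_le pprt_mono order_trans by blast
        then have "q (pprt (r - (u + u))) \<le> q (pprt (\<bar>a\<bar> - u) + pprt (\<bar>\<phi>\<bar> - u))"
          by (intro mono') auto
        then show ?thesis using subadd order_trans by blast
      qed
      finally have "norm (T a - T \<phi>) < e"
        using u(2)[OF a] u(2)[of \<phi>] \<phi> \<Phi>(2) unfolding r_def d_def by force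
      with \<phi>(1) show ?thesis by (auto simp: dist_norm)
    qed
    then show "\<exists>k. finite k \<and> (\<forall>x\<in>T ` A. \<exists>y\<in>k. dist x y < e)"
      using \<Phi>(1) by (intro exI[of _ "T ` \<Phi>"]) auto
  qed
qed

section \<open>Components of a functional\<close>

lemma apply_eq_pprt_diff: "blinfun_apply f x = f (pprt x) - f (pprt (- x))"
  by (metis blinfun.diff_right eq_pprt_diff)

text \<open>The defect \<open>D\<close> from linearity vanishes at integers, so
  \<open>real n * D t\<close> is the value of \<open>D\<close> at the fractional part of
  \<open>real n * t\<close>, bounded independently of \<open>n\<close>. Functionals constructed
  later thus need only be additive and bounded.\<close>

lemma additive_bounded_real:
  fixes A :: "real \<Rightarrow> real"
  assumes add: "\<And>s t. A (s + t) = A s + A t" and bd: "\<And>t. \<bar>A t\<bar> \<le> K * \<bar>t\<bar>"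
  shows "A t = t * A 1"
proof -
  define D where "D s = A s - s * A 1" for s
  have D_add: "D (s + t) = D s + D t" for s t by (simp add: D_def add algebra_simps)
  have D0: "D 0 = 0" using D_add[of 0 0] by simp
  have D_minus: "D (- s) = - D s" for s using D_add[of s "- s"] D0 by simp
  have D_nat: "D (real n * s) = real n * D s" for n s
    by (induction n) (simp_all add: D0 D_add distrib_right)
  have "D 1 = 0" by (simp add: D_def)
  then have D_int: "D (of_int k) = 0" for k
    using D_nat[of "nat \<bar>k\<bar>" 1] D_minus[of "of_int k"] by (cases "k \<ge> 0") auto
  have D_bd: "\<bar>D s\<bar> \<le> \<bar>K\<bar> + \<bar>A 1\<bar>" if "\<bar>s\<bar> \<le> 1" for s
  proof -
    have "\<bar>A s\<bar> \<le> \<bar>K\<bar> * 1" using bd[of s] that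
      by (meson abs_ge_self abs_ge_zero mult_mono order_trans)
    moreover have "\<bar>s * A 1\<bar> \<le> 1 * \<bar>A 1\<bar>" unfolding abs_mult using that by (intro mult_right_mono) auto
    ultimately show ?thesis unfolding D_def by linarith
  qed
  have "real n * \<bar>D t\<bar> \<le> \<bar>K\<bar> + \<bar>A 1\<bar>" for n
  proof -
    have "D (real n * t) = D (frac (real n * t)) + D (of_int \<lfloor>real n * t\<rfloor>)"
      unfolding D_add[symmetric] by (simp add: frac_def)
    then have "real n * D t = D (frac (real n * t))" by (simp add: D_nat D_int)
    moreover have "\<bar>D (frac (real n * t))\<bar> \<le> \<bar>K\<bar> + \<bar>A 1\<bar>"
      using frac_lt_1[of "real n * t"] frac_ge_0[of "real n * t"] by (intro D_bd) auto
    moreover have "\<bar>real n * D t\<bar> = real n * \<bar>D t\<bar>" by (simp add: abs_mult)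
    ultimately show ?thesis by metis
  qed
  then have "D t = 0"
    by (metis abs_le_zero_iff ex_less_of_nat_mult not_le)
  then show ?thesis by (simp add: D_def)
qed

lemma additive_bounded_imp_bounded_linear:
  fixes G :: "'a::real_normed_vector \<Rightarrow> real"
  assumes add: "\<And>x y. G (x + y) = G x + G y" and bd: "\<And>x. \<bar>G x\<bar> \<le> K * norm x"
  shows "bounded_linear G"
proof (rule bounded_linear_intro[where K = K])
  fix x :: 'a and r :: real
  have "\<bar>G (t *\<^sub>R x)\<bar> \<le> (K * norm x) * \<bar>t\<bar>" for t using bd[of "t *\<^sub>R x"] by (simp add: mult_ac)
  from additive_bounded_real[OF _ this, of r]
  show "G (r *\<^sub>R x) = r *\<^sub>R G x" by (simp add: scaleR_add_left add)
qed (use assms in \<open>auto simp: mult.commute\<close>)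

lemma ex_positive_extension:
  fixes f :: "'a::banach_lattice \<Rightarrow>\<^sub>L real" and p :: "'a \<Rightarrow> real"
  assumes add: "\<And>x y. \<lbrakk>0 \<le> x; 0 \<le> y\<rbrakk> \<Longrightarrow> p (x + y) = p x + p y"
    and p: "\<And>x. 0 \<le> x \<Longrightarrow> 0 \<le> p x" "\<And>x. 0 \<le> x \<Longrightarrow> p x \<le> f x"
  obtains g :: "'a \<Rightarrow>\<^sub>L real" where "dual_le 0 g" "\<And>x. 0 \<le> x \<Longrightarrow> g x = p x"
proof -
  define G where "G x = p (pprt x) - p (pprt (- x))" for x
  have G: "G x = p a - p b" if "x = a - b" "0 \<le> a" "0 \<le> b" for x a b
  proof -
    have "pprt x - pprt (- x) = a - b"
      using eq_pprt_diff[of x] that(1) by simp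
    then have "pprt x = (a - b) + pprt (- x)" by (simp only: diff_eq_eq)
    then have "pprt x + b = a + pprt (- x)" by simp
    then have "p (pprt x) + p b = p a + p (pprt (- x))" using add that by (metis zero_le_pprt)
    then show ?thesis by (simp add: G_def)
  qed
  have "p 0 = 0" using add[of 0 0] by simp
  then have G_p: "G x = p x" if "0 \<le> x" for x using G[of x x 0] that by simp
  have "bounded_linear G"
  proof (rule additive_bounded_imp_bounded_linear)
    fix x y :: 'a
    have "x + y = (pprt x + pprt y) - (pprt (- x) + pprt (- y))"
      using eq_pprt_diff[of x] eq_pprt_diff[of y] by (metis add_diff_add)
    from G[OF this] show "G (x + y) = G x + G y" by (simp add: G_def add)
    have "\<bar>G x\<bar> \<le> p (pprt x) + p (pprt (- x))"
      using p(1)[of "pprt x"] p(1)[of "pprt (- x)"] by (simp add: G_def)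
    also have "\<dots> = p \<bar>x\<bar>" by (simp add: abs_eq_pprt_add add)
    also have "\<dots> \<le> f \<bar>x\<bar>" by (intro p) simp
    also have "\<dots> \<le> norm f * norm x" using norm_blinfun[of f "\<bar>x\<bar>"] by (simp add: norm_abs)
    finally show "\<bar>G x\<bar> \<le> norm f * norm x" .
  qed
  then have "blinfun_apply (Blinfun G) = G" by (rule bounded_linear_Blinfun_apply)
  then show ?thesis using that[of "Blinfun G"] G_p p(1) by (simp add: dual_nonneg_iff)
qed

lemma ex_component:
  fixes f :: "'a::banach_lattice \<Rightarrow>\<^sub>L real"
  assumes f: "dual_le 0 f" and w: "0 \<le> w"
  shows "\<exists>g. dual_le 0 g \<and> (\<forall>x\<ge>0. (\<lambda>n. f (inf x (real n *\<^sub>R w))) \<longlonglongrightarrow> g x)"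
proof -
  have nw: "0 \<le> real n *\<^sub>R w" for n using w by (simp add: scaleR_nonneg_nonneg)
  have "convergent (\<lambda>n. f (inf x (real n *\<^sub>R w)))" for x
  proof (rule Bseq_monoseq_convergent[OF BseqI'])
    have mono: "f (inf x (real m *\<^sub>R w)) \<le> f (inf x (real n *\<^sub>R w))" if "m \<le> n" for m n
      using that w by (intro dual_nonneg_mono[OF f] inf_mono scaleR_right_mono) auto
    then show "monoseq (\<lambda>n. f (inf x (real n *\<^sub>R w)))" by (intro monoI1) auto
    show "norm (f (inf x (real n *\<^sub>R w))) \<le> \<bar>f x\<bar> + \<bar>f (inf x 0)\<bar>" for n
    proof -
      have "f (inf x (real n *\<^sub>R w)) \<le> f x" by (intro dual_nonneg_mono[OF f]) simp
      moreover have "f (inf x 0) \<le> f (inf x (real n *\<^sub>R w))" using mono[of 0 n] by simp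
      ultimately show ?thesis by simp
    qed
  qed
  then obtain p where p: "\<And>x. (\<lambda>n. f (inf x (real n *\<^sub>R w))) \<longlonglongrightarrow> p x"
    unfolding convergent_def by metis
  have "\<exists>g :: 'a \<Rightarrow>\<^sub>L real. dual_le 0 g \<and> (\<forall>x\<ge>0. g x = p x)"
  proof (rule ex_positive_extension[of p f])
    fix x y :: 'a assume xy: "0 \<le> x" "0 \<le> y"
    show "p (x + y) = p x + p y"
    proof (rule antisym)
      show "p (x + y) \<le> p x + p y"
      proof (rule LIMSEQ_le[OF p tendsto_add[OF p p]], intro exI allI impI)
        fix n :: nat
        show "f (inf (x + y) (real n *\<^sub>R w)) \<le> f (inf x (real n *\<^sub>R w)) + f (inf y (real n *\<^sub>R w))"
          unfolding blinfun.add_right[symmetric]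
          by (intro dual_nonneg_mono[OF f] inf_add_le xy nw)
      qed
      \<comment> \<open>Two truncations at \<open>n w\<close> add up to something below
        \<open>2 n w\<close>, so superadditivity appears when the sum is truncated at twice the
        index.\<close>
      have "strict_mono (\<lambda>n::nat. 2 * n)" by (simp add: strict_mono_def)
      from LIMSEQ_subseq_LIMSEQ[OF p this]
      have p2: "(\<lambda>n. f (inf (x + y) (real (2 * n) *\<^sub>R w))) \<longlonglongrightarrow> p (x + y)" by (simp add: o_def)
      show "p x + p y \<le> p (x + y)"
      proof (rule LIMSEQ_le[OF tendsto_add[OF p p] p2], intro exI allI impI)
        fix n :: nat
        have "inf x (real n *\<^sub>R w) + inf y (real n *\<^sub>R w) \<le> inf (x + y) (real (2 * n) *\<^sub>R w)"
        proof (rule inf_greatest)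
          have "inf x (real n *\<^sub>R w) + inf y (real n *\<^sub>R w) \<le> real n *\<^sub>R w + real n *\<^sub>R w"
            by (intro add_mono) auto
          then show "inf x (real n *\<^sub>R w) + inf y (real n *\<^sub>R w) \<le> real (2 * n) *\<^sub>R w"
            by (simp flip: scaleR_add_left)
        qed (intro add_mono inf_le1)
        then show "f (inf x (real n *\<^sub>R w)) + f (inf y (real n *\<^sub>R w)) \<le> f (inf (x + y) (real (2 * n) *\<^sub>R w))"
          unfolding blinfun.add_right[symmetric] by (intro dual_nonneg_mono[OF f])
      qed
    qed
  next
    fix x :: 'a assume x: "0 \<le> x"
    show "0 \<le> p x"
      using x nw by (intro LIMSEQ_le_const[OF p] exI allI impI dual_nonnegD[OF f] inf_greatest)
    show "p x \<le> f x"
      by (intro LIMSEQ_le_const2[OF p] exI allI impI dual_nonneg_mono[OF f] inf_le1)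
  qed blast
  then show ?thesis using p by metis
qed

text \<open>For an integral this is its restriction to the set where \<open>w\<close> is nonzero,
  the part of \<open>f\<close> carried by \<open>w\<close>. It is formed in the dual, since the
  lattice need not admit a projection onto the band of \<open>w\<close>.\<close>

definition component :: "('a::banach_lattice \<Rightarrow>\<^sub>L real) \<Rightarrow> 'a \<Rightarrow> 'a \<Rightarrow>\<^sub>L real" where
  "component f w = (SOME g. dual_le 0 g \<and> (\<forall>x\<ge>0. (\<lambda>n. f (inf x (real n *\<^sub>R w))) \<longlonglongrightarrow> g x))"

context
  fixes f :: "'a::banach_lattice \<Rightarrow>\<^sub>L real" and w :: 'a
  assumes f: "dual_le 0 f" and w: "0 \<le> w"
begin

lemma component_nonneg: "dual_le 0 (component f w)"
  and component_tendsto: "0 \<le> x \<Longrightarrow> (\<lambda>n. f (inf x (real n *\<^sub>R w))) \<longlonglongrightarrow> component f w x"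
  using someI_ex[OF ex_component[OF f w]] unfolding component_def by auto

lemma component_le: "0 \<le> x \<Longrightarrow> component f w x \<le> f x"
  by (intro LIMSEQ_le_const2[OF component_tendsto] exI allI impI dual_nonneg_mono[OF f] inf_le1)

lemma component_eq_of_le:
  assumes "0 \<le> x" "x \<le> r *\<^sub>R w"
  shows "component f w x = f x"
proof -
  obtain N :: nat where "r \<le> real N" using real_arch_simple by blast
  then have "x \<le> real n *\<^sub>R w" if "n \<ge> N" for n
    using assms(2) scaleR_right_mono[OF _ w, of r "real n"] that by (meson of_nat_mono order_trans)
  then have "\<forall>\<^sub>F n in sequentially. f (inf x (real n *\<^sub>R w)) = f x"
    by (intro eventually_sequentiallyI[of N]) (simp add: inf_absorb1)
  then have "(\<lambda>n. f (inf x (real n *\<^sub>R w))) \<longlonglongrightarrow> f x" by (rule tendsto_eventually)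
  then show ?thesis using component_tendsto[OF assms(1)] LIMSEQ_unique by blast
qed

lemma component_eq:
  assumes "\<bar>x\<bar> \<le> r *\<^sub>R w"
  shows "component f w x = f x"
proof -
  have "component f w (pprt x) = f (pprt x)" "component f w (pprt (- x)) = f (pprt (- x))"
    by (intro component_eq_of_le[of _ r] zero_le_pprt order_trans[OF _ assms]
        pprt_le_abs pprt_uminus_le_abs)+
  then show ?thesis by (simp only: apply_eq_pprt_diff[of _ x])
qed

lemma component_disjoint:
  assumes "0 \<le> x" "inf x w = 0"
  shows "component f w x = 0"
proof -
  have "inf x (real n *\<^sub>R w) = 0" for n by (rule inf_scaleR_zero[OF assms(2,1) w]) simp
  then show ?thesis using component_tendsto[OF assms(1)] by (simp add: LIMSEQ_const_iff)
qed

text \<open>The component agrees with \<open>f\<close> on the truncations, so its defining limit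
  says that they exhaust \<open>x\<close>. This makes the ideal of \<open>w\<close> dense for the
  seminorm of \<open>component f w\<close>.\<close>

lemma component_remainder_tendsto:
  assumes "0 \<le> x"
  shows "(\<lambda>n. component f w (x - inf x (real n *\<^sub>R w))) \<longlonglongrightarrow> 0"
proof -
  have "component f w (inf x (real n *\<^sub>R w)) = f (inf x (real n *\<^sub>R w))" for n
    using assms w by (intro component_eq_of_le[of _ "real n"]) (auto simp: scaleR_nonneg_nonneg)
  then have "component f w (x - inf x (real n *\<^sub>R w)) = component f w x - f (inf x (real n *\<^sub>R w))" for n
    by (simp add: blinfun.diff_right del: diff_inf_eq_sup)
  then show ?thesis
    using tendsto_diff[OF tendsto_const component_tendsto[OF assms], of "component f w x"]
    by (simp del: diff_inf_eq_sup)
qed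

end

text \<open>Weak nullity only concerns values at \<open>y n\<close> itself. Disjointness provides a
  single \<open>w\<close> that dominates multiples of all the positive parts and is disjoint from
  all the negative parts; the one functional \<open>component f w\<close> then takes the value
  \<open>f (pprt (y n))\<close> at \<open>y n\<close> for every \<open>n\<close>.\<close>

lemma disjoint_weakly_null_pprt:
  assumes y: "disjoint_seq y" "weakly_null y" and f: "dual_le 0 f"
  shows "(\<lambda>n. f (pprt (y n))) \<longlonglongrightarrow> 0"
proof -
  \<comment> \<open>Normalizing makes the series for \<open>w\<close> converge without first showing
    that \<open>y\<close> is bounded.\<close>
  define c where "c n = 1 / (1 + norm (y n))" for n
  have c: "0 < c n" for n by (simp add: c_def add_pos_nonneg)
  define a where "a n = (1/2)^n *\<^sub>R (c n *\<^sub>R pprt (y n))" for n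
  have a0: "0 \<le> a n" for n using c[of n] by (simp add: a_def scaleR_nonneg_nonneg)
  have "norm (c n *\<^sub>R pprt (y n)) \<le> 1" for n
  proof -
    have "norm (pprt (y n)) \<le> norm (y n)" using pprt_le_abs[of "y n"] by (intro norm_mono_abs) simp
    then show ?thesis by (simp add: c_def divide_simps add_pos_nonneg)
  qed
  then have sm: "summable a" unfolding a_def by (rule summable_scaled_bounded)
  define w where "w = suminf a"
  have w: "0 \<le> w" unfolding w_def by (rule suminf_nonneg_lattice[OF sm a0])
  have "component f w (y n) = f (pprt (y n))" for n
  proof -
    have "a n \<le> w" unfolding w_def by (rule term_le_suminf[OF sm a0])
    define d where "d = (1/2)^n * c n"
    have d: "0 < d" "a n = d *\<^sub>R pprt (y n)" using c[of n] by (simp_all add: d_def a_def)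
    have "inverse d *\<^sub>R a n \<le> inverse d *\<^sub>R w"
      using d(1) \<open>a n \<le> w\<close> by (intro scaleR_left_mono) auto
    then have "pprt (y n) \<le> inverse d *\<^sub>R w"
      using d by simp
    then have "component f w (pprt (y n)) = f (pprt (y n))"
      by (intro component_eq_of_le[OF f w]) auto
    moreover have "inf (pprt (- y n)) (a m) = 0" for m
    proof -
      have "inf (pprt (- y n)) (pprt (y m)) = 0"
      proof (cases "m = n")
        case True
        then show ?thesis using inf_pprt_pprt_uminus[of "y n"] by (simp add: inf_commute)
      next
        case False
        then have "inf \<bar>y n\<bar> \<bar>y m\<bar> = 0" using y(1) by (simp add: disjoint_seq_def)
        then show ?thesis
          by (rule inf_zero_mono) (simp_all only: zero_le_pprt pprt_le_abs pprt_uminus_le_abs)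
      qed
      from inf_scaleR_zero[OF this, of "(1/2)^m * c m"] c[of m] show ?thesis
        by (simp add: a_def)
    qed
    then have "inf (pprt (- y n)) w = 0"
      unfolding w_def by (intro inf_suminf_zero sm a0) auto
    then have "component f w (pprt (- y n)) = 0"
      by (intro component_disjoint[OF f w]) auto
    ultimately show ?thesis by (simp add: apply_eq_pprt_diff[of _ "y n"])
  qed
  then have "(\<lambda>n. f (pprt (y n))) = (\<lambda>n. component f w (y n))" by (intro ext) (rule sym)
  with y(2) show ?thesis unfolding weakly_null_def by (simp only:)
qed

lemma disjoint_weakly_null_abs:
  assumes y: "disjoint_seq y" "weakly_null y" and f: "dual_le 0 f"
  shows "(\<lambda>n. f \<bar>y n\<bar>) \<longlonglongrightarrow> 0"
proof -
  have "disjoint_seq (\<lambda>n. - y n)" using y(1) by (simp add: disjoint_seq_def)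
  moreover have "weakly_null (\<lambda>n. - y n)"
    using y(2) tendsto_minus[of _ "0::real"] by (fastforce simp: weakly_null_def blinfun.minus_right)
  ultimately have "(\<lambda>n. f (pprt (y n)) + f (pprt (- y n))) \<longlonglongrightarrow> 0 + 0"
    using assms by (intro tendsto_add disjoint_weakly_null_pprt)
  then show ?thesis by (simp add: abs_eq_pprt_add blinfun.add_right)
qed

text \<open>A pointwise null sequence of functionals dominated by a fixed positive one is the
  coordinate sequence of an almost Dunford--Pettis operator into \<open>c0\<close>.\<close>

lemma super_weakly_precompact_uniform_null:
  fixes g :: "nat \<Rightarrow> 'a::banach_lattice \<Rightarrow>\<^sub>L real"
  assumes A: "super_weakly_precompact A" and f: "dual_le 0 f"
    and g: "\<And>n x. \<bar>g n x\<bar> \<le> C * f \<bar>x\<bar>" "\<And>x. (\<lambda>n. g n x) \<longlonglongrightarrow> 0" and e: "0 < e"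
  shows "\<exists>N. \<forall>n\<ge>N. \<forall>a\<in>A. \<bar>g n a\<bar> < e"
proof -
  have C: "\<bar>g n x\<bar> \<le> \<bar>C\<bar> * f \<bar>x\<bar>" for n x
  proof -
    have "C * f \<bar>x\<bar> \<le> \<bar>C\<bar> * f \<bar>x\<bar>" by (intro mult_right_mono dual_nonnegD[OF f]) auto
    then show ?thesis using g(1)[of n x] by linarith
  qed
  define S where "S x = Abs_c0 (\<lambda>n. g n x)" for x
  have S: "c0_nth (S x) n = g n x" for x n
    using g(2) by (simp add: S_def Abs_c0_inverse)
  have norm_S: "norm (S x) \<le> \<bar>C\<bar> * f \<bar>x\<bar>" for x
    by (intro c0_norm_le) (simp only: S C)
  have "bounded_linear S"
  proof (rule bounded_linear_intro[where K = "\<bar>C\<bar> * norm f"])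
    show "S (x + y) = S x + S y" for x y by (intro c0_eqI) (simp add: S blinfun.add_right)
    show "S (r *\<^sub>R x) = r *\<^sub>R S x" for r x by (intro c0_eqI) (simp add: S blinfun.scaleR_right)
    fix x
    have "\<bar>C\<bar> * f \<bar>x\<bar> \<le> \<bar>C\<bar> * (norm f * norm x)"
      using norm_blinfun[of f "\<bar>x\<bar>"] by (intro mult_left_mono) (auto simp: norm_abs)
    then show "norm (S x) \<le> norm x * (\<bar>C\<bar> * norm f)" using norm_S[of x] by (simp add: mult_ac)
  qed
  then have S_eq: "blinfun_apply (Blinfun S) = S" by (rule bounded_linear_Blinfun_apply)
  have "almost_dunford_pettis (Blinfun S)"
    unfolding almost_dunford_pettis_def S_eq
  proof (intro allI impI)
    fix x :: "nat \<Rightarrow> 'a" assume x: "disjoint_seq x" "weakly_null x"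
    have lim: "(\<lambda>n. \<bar>C\<bar> * f \<bar>x n\<bar>) \<longlonglongrightarrow> \<bar>C\<bar> * 0"
      by (intro tendsto_intros disjoint_weakly_null_abs x f)
    show "(\<lambda>n. norm (S (x n))) \<longlonglongrightarrow> 0"
      by (rule Lim_null_comparison[OF always_eventually lim[unfolded mult_zero_right]])
        (simp add: norm_S)
  qed
  then have "compact (closure (S ` A))"
    using A S_eq unfolding super_weakly_precompact_def by metis
  then obtain k where k: "finite k" "closure (S ` A) \<subseteq> (\<Union>x\<in>k. ball x (e / 2))"
    using e unfolding compact_eq_totally_bounded by (meson half_gt_zero)
  \<comment> \<open>Finitely many null sequences are small from a common index on, and each
    \<open>S a\<close> is uniformly within \<open>e / 2\<close> of one of them.\<close>
  have "\<forall>\<^sub>F n in sequentially. \<forall>x\<in>k. \<bar>c0_nth x n\<bar> < e / 2"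
  proof (rule eventually_ball_finite[OF k(1)], rule)
    fix x
    have "(\<lambda>n. \<bar>c0_nth x n\<bar>) \<longlonglongrightarrow> 0" using c0_nth_tendsto by (rule tendsto_rabs_zero)
    then show "\<forall>\<^sub>F n in sequentially. \<bar>c0_nth x n\<bar> < e / 2"
      by (rule order_tendstoD(2)) (use e in simp)
  qed
  then obtain N where N: "\<forall>n\<ge>N. \<forall>x\<in>k. \<bar>c0_nth x n\<bar> < e / 2"
    unfolding eventually_sequentially ..
  have "\<bar>g n a\<bar> < e" if "n \<ge> N" "a \<in> A" for n a
  proof -
    have "S a \<in> closure (S ` A)" by (intro subsetD[OF closure_subset] imageI that)
    then obtain x where x: "x \<in> k" "norm (x - S a) < e / 2" using k(2) by (auto simp: dist_norm)
    have "\<bar>c0_nth x n - g n a\<bar> < e / 2" using c0_nth_le_norm[of "x - S a" n] x(2) by (simp add: S)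
    moreover have "\<bar>c0_nth x n\<bar> < e / 2" using N that(1) x(1) by blast
    ultimately show ?thesis by linarith
  qed
  then show ?thesis by blast
qed

text \<open>At least half of \<open>f (y n)\<close> comes from under the positive or under the
  negative part of \<open>x n\<close>; the component of \<open>f\<close> carried by that part tests
  \<open>x n\<close> without cancellation. Components carried by disjoint elements add up to at most
  \<open>f\<close>, hence are pointwise null.\<close>

lemma disjoint_components:
  fixes f :: "'a::banach_lattice \<Rightarrow>\<^sub>L real"
  assumes f: "dual_le 0 f" and y: "disjoint_seq y" "\<And>n. 0 \<le> y n" "\<And>n. y n \<le> \<bar>x n\<bar>"
    and large: "\<And>n. e \<le> f (y n)"
  obtains g :: "nat \<Rightarrow> 'a \<Rightarrow>\<^sub>L real" where "\<And>n z. \<bar>g n z\<bar> \<le> f \<bar>z\<bar>" "\<And>z. (\<lambda>n. g n z) \<longlonglongrightarrow> 0"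
    "\<And>n. e / 2 \<le> \<bar>g n (x n)\<bar>"
proof -
  have pos: "e / 2 \<le> component f (inf y (pprt x)) x"
    if "0 \<le> y" "e / 2 \<le> f (inf y (pprt x))" for x y
  proof -
    define v where "v = inf y (pprt x)"
    have v: "0 \<le> v" using that(1) by (simp add: v_def)
    have "inf (pprt (- x)) v = 0"
      by (rule inf_zero_mono[OF inf_pprt_pprt_uminus[of "- x"]]) (simp_all add: v_def that(1))
    then have "component f v (pprt (- x)) = 0"
      by (intro component_disjoint[OF f v]) auto
    moreover have "component f v v = f v" using component_eq_of_le[OF f v v, of 1] by simp
    moreover have "component f v v \<le> component f v (pprt x)"
      by (intro dual_nonneg_mono[OF component_nonneg[OF f v]]) (simp add: v_def)
    ultimately have "e / 2 \<le> component f v (pprt x) - component f v (pprt (- x))"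
      using that(2) unfolding v_def by linarith
    also have "\<dots> = component f v x" by (rule apply_eq_pprt_diff[symmetric])
    finally show ?thesis by (simp only: v_def)
  qed
  have "\<exists>v. 0 \<le> v \<and> v \<le> y n \<and> e / 2 \<le> \<bar>component f v (x n)\<bar>" for n
  proof -
    have "y n = inf (pprt (x n) + pprt (- x n)) (y n)"
      using y(3)[of n] by (simp add: abs_eq_pprt_add inf_absorb2)
    also have "\<dots> \<le> inf (pprt (x n)) (y n) + inf (pprt (- x n)) (y n)"
      by (intro inf_add_le y) auto
    finally have "f (y n) \<le> f (inf (y n) (pprt (x n))) + f (inf (y n) (pprt (- x n)))"
      using dual_nonneg_mono[OF f] by (simp only: blinfun.add_right[symmetric] inf_commute)
    then consider "e / 2 \<le> f (inf (y n) (pprt (x n)))" | "e / 2 \<le> f (inf (y n) (pprt (- x n)))"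
      using large[of n] by linarith
    then show ?thesis
    proof cases
      case 1
      then show ?thesis using pos[OF y(2) 1] y(2)[of n]
        by (intro exI[of _ "inf (y n) (pprt (x n))"]) auto
    next
      case 2
      then show ?thesis using pos[OF y(2) 2] y(2)[of n]
        by (intro exI[of _ "inf (y n) (pprt (- x n))"]) (auto simp: blinfun.minus_right)
    qed
  qed
  then obtain v where v: "\<And>n. 0 \<le> v n" "\<And>n. v n \<le> y n" "\<And>n. e / 2 \<le> \<bar>component f (v n) (x n)\<bar>"
    by metis
  define g where "g n = component f (v n)" for n
  have g0: "dual_le 0 (g n)" for n unfolding g_def by (rule component_nonneg[OF f v(1)])
  have dis: "inf (v m) (v n) = 0" if "m \<noteq> n" for m n
    by (rule inf_zero_mono[OF disjoint_seq_nonneg[OF y(1,2) that] v(1,2) v(1,2)])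
  have "(\<Sum>i<n. g i z) \<le> f z" if z: "0 \<le> z" for n z
  proof -
    have "(\<lambda>k. \<Sum>i<n. f (inf z (real k *\<^sub>R v i))) \<longlonglongrightarrow> (\<Sum>i<n. g i z)"
      unfolding g_def by (intro tendsto_sum component_tendsto[OF f v(1) z])
    moreover have "(\<Sum>i<n. f (inf z (real k *\<^sub>R v i))) \<le> f z" for k
    proof -
      have kv: "0 \<le> real k *\<^sub>R v i" for i using v(1) by (simp add: scaleR_nonneg_nonneg)
      have "inf (real k *\<^sub>R v i) (real k *\<^sub>R v j) = 0" if "i < j" for i j
        using scaleR_inf[of "real k" "v i" "v j"] dis[of i j] that by simp
      then have "inf (inf z (real k *\<^sub>R v i)) (inf z (real k *\<^sub>R v j)) = 0" if "i < j" for i j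
        by (rule inf_zero_mono) (use that z kv in \<open>auto intro: inf_le2\<close>)
      then have "(\<Sum>i<n. inf z (real k *\<^sub>R v i)) \<le> z"
        using z kv by (intro sum_le_of_disjoint) auto
      from dual_nonneg_mono[OF f this] show ?thesis by (simp add: blinfun.sum_right)
    qed
    ultimately show ?thesis by (intro LIMSEQ_le_const2) auto
  qed
  then have "(\<Sum>i\<le>n. g i z) \<le> f z" if "0 \<le> z" for n z
    using that by (simp only: lessThan_Suc_atMost[symmetric])
  then have "(\<lambda>n. g n z) \<longlonglongrightarrow> 0" if "0 \<le> z" for z
    using that by (intro summable_LIMSEQ_zero bounded_imp_summable[where B = "f z"] dual_nonnegD[OF g0])
  from tendsto_diff[OF this this] have "(\<lambda>n. g n (pprt z) - g n (pprt (- z))) \<longlonglongrightarrow> 0 - 0" for z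
    by simp
  moreover have "g n (pprt z) - g n (pprt (- z)) = g n z" for n z
    by (rule apply_eq_pprt_diff[symmetric])
  ultimately have "(\<lambda>n. g n z) \<longlonglongrightarrow> 0" for z by simp
  moreover have "\<bar>g n z\<bar> \<le> f \<bar>z\<bar>" for n z
    using dual_nonneg_abs_le[OF g0, of n z] component_le[OF f v(1), of "\<bar>z\<bar>" n]
    by (simp add: g_def)
  ultimately show ?thesis using that[of g] v(3) by (simp add: g_def)
qed

section \<open>A quadratic form on a principal ideal\<close>

definition principal_ideal :: "'a::banach_lattice \<Rightarrow> 'a set" where
  "principal_ideal w = {x. \<exists>r. \<bar>x\<bar> \<le> r *\<^sub>R w}"

lemma principal_idealI: "\<bar>x\<bar> \<le> r *\<^sub>R w \<Longrightarrow> x \<in> principal_ideal w"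
  by (auto simp: principal_ideal_def)

lemma subspace_principal_ideal: "subspace (principal_ideal w)"
  unfolding subspace_def
proof (intro conjI ballI allI)
  show "0 \<in> principal_ideal w" by (rule principal_idealI[of _ 0]) simp
  fix x assume "x \<in> principal_ideal w"
  then obtain r where r: "\<bar>x\<bar> \<le> r *\<^sub>R w" by (auto simp: principal_ideal_def)
  show "c *\<^sub>R x \<in> principal_ideal w" for c
    using scaleR_left_mono[OF r, of "\<bar>c\<bar>"]
    by (intro principal_idealI[of _ "\<bar>c\<bar> * r"]) (simp add: abs_scaleR)
  fix y assume "y \<in> principal_ideal w"
  then obtain s where s: "\<bar>y\<bar> \<le> s *\<^sub>R w" by (auto simp: principal_ideal_def)
  show "x + y \<in> principal_ideal w"
    using order_trans[OF abs_triangle_ineq add_mono[OF r s]]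
    by (intro principal_idealI[of _ "r + s"]) (simp add: scaleR_add_left)
qed

locale weighted_functional =
  fixes f :: "'a::banach_lattice \<Rightarrow>\<^sub>L real" and w :: 'a
  assumes f: "dual_le 0 f" and w: "0 \<le> w"
begin

section \<open>The ideal of \<open>w\<close> and the extension of functionals from it\<close>

abbreviation U where "U \<equiv> principal_ideal w"

lemmas U_add = subspace_add[OF subspace_principal_ideal[of w]]
  and U_diff = subspace_diff[OF subspace_principal_ideal[of w]]
  and U_scale = subspace_scale[OF subspace_principal_ideal[of w]]
  and U_neg = subspace_neg[OF subspace_principal_ideal[of w]]
  and U_zero = subspace_0[OF subspace_principal_ideal[of w]]

lemma U_bound:
  assumes "x \<in> U"
  obtains r where "0 < r" "\<bar>x\<bar> \<le> r *\<^sub>R w"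
proof -
  obtain r where r: "\<bar>x\<bar> \<le> r *\<^sub>R w" using assms by (auto simp: principal_ideal_def)
  have "r *\<^sub>R w \<le> (\<bar>r\<bar> + 1) *\<^sub>R w" by (intro scaleR_right_mono w) auto
  then show ?thesis using r that[of "\<bar>r\<bar> + 1"] by (meson abs_ge_zero add_nonneg_pos order_trans zero_less_one)
qed

lemma component_eq_on_U: "x \<in> U \<Longrightarrow> component f w x = f x"
  by (auto simp: principal_ideal_def intro: component_eq[OF f w])

lemma abs_in_U: "x \<in> U \<Longrightarrow> \<bar>x\<bar> \<in> U"
  by (simp add: principal_ideal_def)

definition truncate :: "nat \<Rightarrow> 'a \<Rightarrow> 'a" where
  "truncate n y = inf (pprt y) (real n *\<^sub>R w) - inf (pprt (- y)) (real n *\<^sub>R w)"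

lemma truncate_in_U: "truncate n y \<in> U"
  unfolding truncate_def
proof (intro U_diff)
  have "inf (pprt x) (real n *\<^sub>R w) \<in> U" for x
    using w by (intro principal_idealI[of _ "real n"]) (simp add: scaleR_nonneg_nonneg)
  then show "inf (pprt y) (real n *\<^sub>R w) \<in> U" "inf (pprt (- y)) (real n *\<^sub>R w) \<in> U" by auto
qed

lemma truncate_tendsto: "(\<lambda>n. component f w \<bar>y - truncate n y\<bar>) \<longlonglongrightarrow> 0"
proof -
  define R where "R x n = x - inf x (real n *\<^sub>R w)" for x n
  have R: "0 \<le> R x n" for x n by (simp add: R_def del: diff_inf_eq_sup)
  note c = component_nonneg[OF f w]
  have lim: "(\<lambda>n. component f w (R (pprt y) n) + component f w (R (pprt (- y)) n)) \<longlonglongrightarrow> 0"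
    unfolding R_def
    using tendsto_add[OF component_remainder_tendsto[OF f w zero_le_pprt[of y]]
        component_remainder_tendsto[OF f w zero_le_pprt[of "- y"]]] by (simp only: add_0_right)
  have "norm (component f w \<bar>y - truncate n y\<bar>)
      \<le> component f w (R (pprt y) n) + component f w (R (pprt (- y)) n)" for n
  proof -
    have "y - truncate n y = R (pprt y) n - R (pprt (- y)) n"
      using eq_pprt_diff[of y] by (simp add: R_def truncate_def algebra_simps del: diff_inf_eq_sup)
    then have "\<bar>y - truncate n y\<bar> \<le> R (pprt y) n + R (pprt (- y)) n"
      using abs_triangle_ineq4[of "R (pprt y) n" "R (pprt (- y)) n"] R by (metis abs_of_nonneg)
    from dual_nonneg_mono[OF c this] show ?thesis
      using dual_nonnegD[OF c, of "\<bar>y - truncate n y\<bar>"] by (simp add: blinfun.add_right)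
  qed
  then show ?thesis by (intro Lim_null_comparison[OF always_eventually lim] allI)
qed

text \<open>The ideal is dense for the seminorm of \<open>component f w\<close>, though in general
  not for that of \<open>f\<close>. As the two agree on the ideal, \<open>g\<close> extends by
  continuity along truncations, and the bound holds in the sharper form with the component.\<close>

lemma ex_extension:
  assumes add: "\<And>x y. \<lbrakk>x \<in> U; y \<in> U\<rbrakk> \<Longrightarrow> g (x + y) = g x + g y"
    and bd: "\<And>x. x \<in> U \<Longrightarrow> \<bar>g x\<bar> \<le> C * f \<bar>x\<bar>" and C: "0 \<le> C"
  obtains h :: "'a \<Rightarrow>\<^sub>L real" where "\<And>x. x \<in> U \<Longrightarrow> h x = g x"
    "\<And>x. \<bar>h x\<bar> \<le> C * component f w \<bar>x\<bar>"
proof -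
  define c where "c = component f w"
  have c: "dual_le 0 c" unfolding c_def by (rule component_nonneg[OF f w])
  have tri: "c \<bar>x + y\<bar> \<le> c \<bar>x\<bar> + c \<bar>y\<bar>" for x y
    using dual_nonneg_mono[OF c abs_triangle_ineq] by (simp add: blinfun.add_right)
  have bd': "\<bar>g x\<bar> \<le> C * c \<bar>x\<bar>" if "x \<in> U" for x
    using bd[OF that] component_eq_on_U[OF abs_in_U[OF that]] by (simp add: c_def)
  have g_diff: "\<bar>g x - g y\<bar> \<le> C * (c \<bar>z - x\<bar> + c \<bar>z - y\<bar>)" if "x \<in> U" "y \<in> U" for x y z
  proof -
    have "g (x - y) + g y = g x" using add[OF U_diff[OF that] that(2)] by simp
    then have "\<bar>g x - g y\<bar> \<le> C * c \<bar>x - y\<bar>" using bd'[OF U_diff[OF that]] by (simp flip: eq_diff_eq)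
    also have "c \<bar>x - y\<bar> \<le> c \<bar>z - x\<bar> + c \<bar>z - y\<bar>"
      using tri[of "x - z" "z - y"] by (simp add: abs_minus_commute)
    finally show ?thesis using C by (simp add: mult_left_mono)
  qed
  have lim: "(\<lambda>n. C * (c \<bar>z - X n\<bar> + c \<bar>z - Y n\<bar>)) \<longlonglongrightarrow> 0"
    if "(\<lambda>n. c \<bar>z - X n\<bar>) \<longlonglongrightarrow> 0" "(\<lambda>n. c \<bar>z - Y n\<bar>) \<longlonglongrightarrow> 0" for X Y and z :: 'a
    using tendsto_mult[OF tendsto_const tendsto_add[OF that], of C] by simp
  note T = truncate_tendsto[folded c_def]
  have "convergent (\<lambda>n. g (truncate n z))" for z
  proof -
    have "Cauchy (\<lambda>n. g (truncate n z))"
    proof (rule metric_CauchyI)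
      fix e :: real assume e: "0 < e"
      have "(\<lambda>n. C * c \<bar>z - truncate n z\<bar>) \<longlonglongrightarrow> C * 0" by (intro tendsto_intros T)
      then have "\<forall>\<^sub>F n in sequentially. C * c \<bar>z - truncate n z\<bar> < e / 2"
        by (rule order_tendstoD(2)) (use e in simp)
      then obtain N where N: "\<forall>n\<ge>N. C * c \<bar>z - truncate n z\<bar> < e / 2"
        unfolding eventually_sequentially ..
      have "dist (g (truncate m z)) (g (truncate n z)) < e" if "m \<ge> N" "n \<ge> N" for m n
      proof -
        have "C * c \<bar>z - truncate m z\<bar> < e / 2" "C * c \<bar>z - truncate n z\<bar> < e / 2" using N that by auto
        then show ?thesis
          using g_diff[OF truncate_in_U truncate_in_U, of m z n z z] by (simp add: dist_real_def distrib_left)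
      qed
      then show "\<exists>N. \<forall>m\<ge>N. \<forall>n\<ge>N. dist (g (truncate m z)) (g (truncate n z)) < e" by blast
    qed
    then show ?thesis by (simp add: Cauchy_convergent_iff)
  qed
  then obtain H where H: "\<And>z. (\<lambda>n. g (truncate n z)) \<longlonglongrightarrow> H z" unfolding convergent_def by metis
  \<comment> \<open>Truncation is not additive. Additivity of \<open>H\<close> follows because the
    limit is the same along every approximating sequence in the ideal, in particular along sums of
    truncations.\<close>
  have H_lim: "(\<lambda>n. g (X n)) \<longlonglongrightarrow> H z" if X: "\<And>n. X n \<in> U" "(\<lambda>n. c \<bar>z - X n\<bar>) \<longlonglongrightarrow> 0" for X z
  proof -
    have "(\<lambda>n. g (X n) - g (truncate n z)) \<longlonglongrightarrow> 0"
      using g_diff[OF X(1) truncate_in_U, of _ _ z z]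
      by (intro Lim_null_comparison[OF always_eventually lim[OF X(2) T]]) simp
    from tendsto_add[OF this H[of z]] show ?thesis by simp
  qed
  have H_eq: "H z = g z" if "z \<in> U" for z
    using H_lim[of "\<lambda>_. z" z] that by (simp add: LIMSEQ_const_iff)
  have H_add: "H (x + y) = H x + H y" for x y
  proof (rule LIMSEQ_unique[OF H_lim[of "\<lambda>n. truncate n x + truncate n y" "x + y"]])
    show "truncate n x + truncate n y \<in> U" for n by (intro U_add truncate_in_U)
    have lim2: "(\<lambda>n. c \<bar>x - truncate n x\<bar> + c \<bar>y - truncate n y\<bar>) \<longlonglongrightarrow> 0"
      using tendsto_add[OF T T] by simp
    have "norm (c \<bar>x + y - (truncate n x + truncate n y)\<bar>) \<le> c \<bar>x - truncate n x\<bar> + c \<bar>y - truncate n y\<bar>" for n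
      using tri[of "x - truncate n x" "y - truncate n y"]
        dual_nonnegD[OF c, of "\<bar>x + y - (truncate n x + truncate n y)\<bar>"] by (simp add: add_diff_add)
    then show "(\<lambda>n. c \<bar>x + y - (truncate n x + truncate n y)\<bar>) \<longlonglongrightarrow> 0"
      by (intro Lim_null_comparison[OF always_eventually lim2] allI)
    show "(\<lambda>n. g (truncate n x + truncate n y)) \<longlonglongrightarrow> H x + H y"
      using tendsto_add[OF H[of x] H[of y]] by (simp add: add truncate_in_U)
  qed
  have H_bd: "\<bar>H z\<bar> \<le> C * c \<bar>z\<bar>" for z
  proof (rule LIMSEQ_le)
    show "(\<lambda>n. \<bar>g (truncate n z)\<bar>) \<longlonglongrightarrow> \<bar>H z\<bar>" by (intro tendsto_rabs H)
    have "(\<lambda>n. C * (c \<bar>z\<bar> + c \<bar>z - truncate n z\<bar>)) \<longlonglongrightarrow> C * (c \<bar>z\<bar> + 0)"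
      by (intro tendsto_intros T)
    then show "(\<lambda>n. C * (c \<bar>z\<bar> + c \<bar>z - truncate n z\<bar>)) \<longlonglongrightarrow> C * c \<bar>z\<bar>" by simp
    have "\<bar>g (truncate n z)\<bar> \<le> C * (c \<bar>z\<bar> + c \<bar>z - truncate n z\<bar>)" for n
    proof -
      have "\<bar>g (truncate n z)\<bar> \<le> C * c \<bar>truncate n z\<bar>" by (rule bd'[OF truncate_in_U])
      also have "c \<bar>truncate n z\<bar> \<le> c \<bar>z\<bar> + c \<bar>z - truncate n z\<bar>"
        using tri[of z "truncate n z - z"] by (simp add: abs_minus_commute)
      finally show ?thesis using C by (simp add: mult_left_mono)
    qed
    then show "\<exists>N. \<forall>n\<ge>N. \<bar>g (truncate n z)\<bar> \<le> C * (c \<bar>z\<bar> + c \<bar>z - truncate n z\<bar>)" by blast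
  qed
  have "bounded_linear H"
  proof (rule additive_bounded_imp_bounded_linear[of H "C * norm c"])
    show "H (x + y) = H x + H y" for x y by (rule H_add)
    fix z
    have "C * c \<bar>z\<bar> \<le> C * (norm c * norm z)"
      using norm_blinfun[of c "\<bar>z\<bar>"] C by (intro mult_left_mono) (auto simp: norm_abs)
    then show "\<bar>H z\<bar> \<le> (C * norm c) * norm z" using H_bd[of z] by (simp add: mult_ac)
  qed
  then have "blinfun_apply (Blinfun H) = H" by (rule bounded_linear_Blinfun_apply)
  then show ?thesis using that[of "Blinfun H"] H_eq H_bd by (simp add: c_def)
qed

text \<open>If elements of the ideal are thought of as bounded functions times \<open>w\<close>, the supremum of
  \<open>tangent \<alpha> x\<close> over all \<open>\<alpha>\<close> is \<open>x\<^sup>2 / w\<close>. Taking \<open>f\<close> of finite suprema only avoids showing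
  that this supremum exists.\<close>

definition tangent :: "real \<Rightarrow> 'a \<Rightarrow> 'a" where
  "tangent \<alpha> x = (2 * \<alpha>) *\<^sub>R x - \<alpha>\<^sup>2 *\<^sub>R w"

definition Tan :: "real set \<Rightarrow> 'a \<Rightarrow> 'a" where
  "Tan S x = Sup_fin ((\<lambda>\<alpha>. tangent \<alpha> x) ` S)"

definition \<Phi> :: "'a \<Rightarrow> real" where
  "\<Phi> x = (SUP S\<in>{S. finite S \<and> S \<noteq> {}}. f (Tan S x))"

lemma Tan_upper: "\<lbrakk>finite S; \<alpha> \<in> S\<rbrakk> \<Longrightarrow> tangent \<alpha> x \<le> Tan S x"
  unfolding Tan_def by (intro Sup_fin.coboundedI) auto

lemma Tan_least: "\<lbrakk>finite S; S \<noteq> {}; \<And>\<alpha>. \<alpha> \<in> S \<Longrightarrow> tangent \<alpha> x \<le> b\<rbrakk> \<Longrightarrow> Tan S x \<le> b"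
  unfolding Tan_def by (intro Sup_fin.boundedI) auto

lemma tangent_le:
  assumes "\<bar>x\<bar> \<le> r *\<^sub>R w"
  shows "tangent \<alpha> x \<le> r\<^sup>2 *\<^sub>R w"
proof -
  have "(2 * \<alpha>) *\<^sub>R x \<le> \<bar>(2 * \<alpha>) *\<^sub>R x\<bar>" by (rule abs_ge_self)
  also have "\<dots> \<le> (2 * \<bar>\<alpha>\<bar>) *\<^sub>R (r *\<^sub>R w)"
    unfolding abs_scaleR abs_mult by (intro scaleR_mono assms) auto
  finally have "tangent \<alpha> x \<le> (2 * \<bar>\<alpha>\<bar> * r - \<alpha>\<^sup>2) *\<^sub>R w"
    by (simp add: tangent_def scaleR_diff_left)
  also have "\<dots> \<le> r\<^sup>2 *\<^sub>R w"
  proof (intro scaleR_right_mono w)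
    have "0 \<le> (\<bar>\<alpha>\<bar> - r)\<^sup>2" by simp
    then show "2 * \<bar>\<alpha>\<bar> * r - \<alpha>\<^sup>2 \<le> r\<^sup>2" by (simp add: power2_diff)
  qed
  finally show ?thesis .
qed

lemma Phi_upper:
  assumes "x \<in> U" "finite S" "S \<noteq> {}"
  shows "f (Tan S x) \<le> \<Phi> x"
proof -
  obtain r where r: "\<bar>x\<bar> \<le> r *\<^sub>R w" using assms(1) by (auto simp: principal_ideal_def)
  show ?thesis
    unfolding \<Phi>_def
  proof (rule cSUP_upper)
    show "bdd_above ((\<lambda>S. f (Tan S x)) ` {S. finite S \<and> S \<noteq> {}})"
      by (intro bdd_aboveI2[of _ _ "f (r\<^sup>2 *\<^sub>R w)"] dual_nonneg_mono[OF f] Tan_least tangent_le[OF r]) auto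
  qed (use assms in simp)
qed

lemma Phi_least: "(\<And>S. \<lbrakk>finite S; S \<noteq> {}\<rbrakk> \<Longrightarrow> f (Tan S x) \<le> c) \<Longrightarrow> \<Phi> x \<le> c"
  unfolding \<Phi>_def by (intro cSUP_least) (auto intro: exI[of _ "{0}"])

lemma Phi_le:
  assumes "\<bar>x\<bar> \<le> r *\<^sub>R w"
  shows "\<Phi> x \<le> r\<^sup>2 * f w"
proof (rule Phi_least)
  fix S :: "real set" assume "finite S" "S \<noteq> {}"
  then have "Tan S x \<le> r\<^sup>2 *\<^sub>R w" by (intro Tan_least tangent_le assms)
  from dual_nonneg_mono[OF f this] show "f (Tan S x) \<le> r\<^sup>2 * f w" by (simp add: blinfun.scaleR_right)
qed

lemma Phi_nonneg:
  assumes "x \<in> U"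
  shows "0 \<le> \<Phi> x"
  using Phi_upper[OF assms, of "{0}"] by (simp add: Tan_def tangent_def)

lemma Phi_zero: "\<Phi> 0 = 0"
  using Phi_le[of 0 0] Phi_nonneg[OF U_zero] by simp

lemma Phi_mono:
  assumes "\<bar>x\<bar> \<le> \<bar>y\<bar>" "y \<in> U"
  shows "\<Phi> x \<le> \<Phi> y"
proof (rule Phi_least)
  fix S :: "real set" assume S: "finite S" "S \<noteq> {}"
  \<comment> \<open>A tangent for \<open>x\<close> with parameter \<open>\<alpha>\<close> lies below
    the supremum of those for \<open>y\<close> with parameters plus and minus
    \<open>\<bar>\<alpha>\<bar>\<close>.\<close>
  define S' where "S' = S \<union> uminus ` S"
  have S': "finite S'" "S' \<noteq> {}" using S by (auto simp: S'_def)
  have "tangent \<alpha> x \<le> Tan S' y" if "\<alpha> \<in> S" for \<alpha>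
  proof -
    have "\<bar>\<alpha>\<bar> \<in> S'" "- \<bar>\<alpha>\<bar> \<in> S'" using that by (auto simp: S'_def abs_if)
    then have le: "tangent \<bar>\<alpha>\<bar> y \<le> Tan S' y" "tangent (- \<bar>\<alpha>\<bar>) y \<le> Tan S' y"
      by (auto intro: Tan_upper S')
    have "(2 * \<alpha>) *\<^sub>R x \<le> \<bar>(2 * \<alpha>) *\<^sub>R x\<bar>" by (rule abs_ge_self)
    also have "\<dots> \<le> (2 * \<bar>\<alpha>\<bar>) *\<^sub>R \<bar>y\<bar>"
      unfolding abs_scaleR abs_mult by (intro scaleR_mono assms) auto
    also have "\<dots> = sup ((2 * \<bar>\<alpha>\<bar>) *\<^sub>R y) ((2 * \<bar>\<alpha>\<bar>) *\<^sub>R (- y))"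
      unfolding abs_lattice[of y] by (rule scaleR_sup) simp
    also have "\<dots> \<le> Tan S' y + \<alpha>\<^sup>2 *\<^sub>R w"
      using le by (intro sup_least) (simp_all add: tangent_def diff_le_eq)
    finally show ?thesis by (simp add: tangent_def diff_le_eq)
  qed
  then have "Tan S x \<le> Tan S' y" by (intro Tan_least S)
  then have "f (Tan S x) \<le> f (Tan S' y)" by (rule dual_nonneg_mono[OF f])
  also have "\<dots> \<le> \<Phi> y" by (intro Phi_upper assms S')
  finally show "f (Tan S x) \<le> \<Phi> y" .
qed

lemma Phi_cong: "\<lbrakk>\<bar>x\<bar> = \<bar>y\<bar>; y \<in> U\<rbrakk> \<Longrightarrow> \<Phi> x = \<Phi> y"
  by (intro antisym Phi_mono) (auto simp: principal_ideal_def)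

lemma Phi_double_le:
  assumes "x \<in> U"
  shows "\<Phi> (2 *\<^sub>R x) \<le> 4 * \<Phi> x"
proof (rule Phi_least)
  fix S :: "real set" assume S: "finite S" "S \<noteq> {}"
  define S' where "S' = (\<lambda>\<alpha>. \<alpha> / 2) ` S"
  have S': "finite S'" "S' \<noteq> {}" using S by (auto simp: S'_def)
  have "tangent \<alpha> (2 *\<^sub>R x) \<le> 4 *\<^sub>R Tan S' x" if "\<alpha> \<in> S" for \<alpha>
  proof -
    have "tangent \<alpha> (2 *\<^sub>R x) = 4 *\<^sub>R tangent (\<alpha> / 2) x"
      by (simp add: tangent_def scaleR_diff_right power_divide mult.commute)
    also have "\<dots> \<le> 4 *\<^sub>R Tan S' x"
      using that by (intro scaleR_left_mono Tan_upper S') (auto simp: S'_def)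
    finally show ?thesis .
  qed
  then have "Tan S (2 *\<^sub>R x) \<le> 4 *\<^sub>R Tan S' x" by (intro Tan_least S)
  from dual_nonneg_mono[OF f this] show "f (Tan S (2 *\<^sub>R x)) \<le> 4 * \<Phi> x"
    using Phi_upper[OF assms S'] by (simp add: blinfun.scaleR_right)
qed

text \<open>The parallelogram law already holds for tangents: those at \<open>x\<close> and
  \<open>y\<close> with parameters \<open>\<gamma>\<close> and \<open>\<delta>\<close> add up to
  half the sum of those at \<open>x + y\<close> and \<open>x - y\<close> with parameters
  \<open>\<gamma> + \<delta>\<close> and \<open>\<gamma> - \<delta>\<close>.\<close>

lemma Phi_parallelogram_le:
  assumes x: "x \<in> U" and y: "y \<in> U"
  shows "2 * \<Phi> x + 2 * \<Phi> y \<le> \<Phi> (x + y) + \<Phi> (x - y)"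
proof -
  define K where "K = \<Phi> (x + y) + \<Phi> (x - y)"
  have main: "2 * f (Tan S x) + 2 * f (Tan S' y) \<le> K"
    if S: "finite S" "S \<noteq> {}" and S': "finite S'" "S' \<noteq> {}" for S S'
  proof -
    define P where "P = (\<lambda>(\<gamma>, \<delta>). \<gamma> + \<delta>) ` (S \<times> S')"
    define Q where "Q = (\<lambda>(\<gamma>, \<delta>). \<gamma> - \<delta>) ` (S \<times> S')"
    have P: "finite P" "P \<noteq> {}" and Q: "finite Q" "Q \<noteq> {}"
      using S S' by (auto simp: P_def Q_def)
    define Z where "Z = (1/2) *\<^sub>R (Tan P (x + y) + Tan Q (x - y))"
    have tt: "tangent \<gamma> x + tangent \<delta> y \<le> Z" if "\<gamma> \<in> S" "\<delta> \<in> S'" for \<gamma> \<delta>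
    proof -
      have "tangent \<gamma> x + tangent \<delta> y = (1/2) *\<^sub>R (tangent (\<gamma> + \<delta>) (x + y) + tangent (\<gamma> - \<delta>) (x - y))"
      proof -
        have "(1/2) *\<^sub>R ((a *\<^sub>R (x + y) - s *\<^sub>R w) + (b *\<^sub>R (x - y) - t *\<^sub>R w))
            = ((1/2) * (a + b)) *\<^sub>R x + ((1/2) * (a - b)) *\<^sub>R y - ((1/2) * (s + t)) *\<^sub>R w" for a b s t
          by (simp add: algebra_simps add_divide_distrib diff_divide_distrib)
        note this[of "2 * (\<gamma> + \<delta>)" "(\<gamma> + \<delta>)\<^sup>2" "2 * (\<gamma> - \<delta>)" "(\<gamma> - \<delta>)\<^sup>2"]
        moreover have "(1/2) * (2 * (\<gamma> + \<delta>) + 2 * (\<gamma> - \<delta>)) = 2 * \<gamma>"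
          "(1/2) * (2 * (\<gamma> + \<delta>) - 2 * (\<gamma> - \<delta>)) = 2 * \<delta>"
          "(1/2) * ((\<gamma> + \<delta>)\<^sup>2 + (\<gamma> - \<delta>)\<^sup>2) = \<gamma>\<^sup>2 + \<delta>\<^sup>2"
          by (simp_all add: power2_eq_square algebra_simps)
        ultimately have "(1/2) *\<^sub>R (tangent (\<gamma> + \<delta>) (x + y) + tangent (\<gamma> - \<delta>) (x - y))
            = (2 * \<gamma>) *\<^sub>R x + (2 * \<delta>) *\<^sub>R y - (\<gamma>\<^sup>2 + \<delta>\<^sup>2) *\<^sub>R w"
          by (simp only: tangent_def)
        then show ?thesis by (simp add: tangent_def scaleR_add_left)
      qed
      also have "\<dots> \<le> Z"
        unfolding Z_def using that
        by (intro scaleR_left_mono add_mono Tan_upper P Q) (auto simp: P_def Q_def)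
      finally show ?thesis .
    qed
    have "tangent \<gamma> x \<le> Z - Tan S' y" if "\<gamma> \<in> S" for \<gamma>
    proof -
      have "Tan S' y \<le> Z - tangent \<gamma> x"
        using tt[OF that] by (intro Tan_least S') (simp add: le_diff_eq add.commute)
      then show ?thesis by (simp add: le_diff_eq add.commute)
    qed
    then have "Tan S x \<le> Z - Tan S' y" by (intro Tan_least S)
    then have "Tan S x + Tan S' y \<le> Z" by (simp add: le_diff_eq)
    from dual_nonneg_mono[OF f this]
    have "2 * f (Tan S x) + 2 * f (Tan S' y) \<le> f (Tan P (x + y)) + f (Tan Q (x - y))"
      by (simp add: Z_def blinfun.add_right blinfun.scaleR_right)
    also have "\<dots> \<le> K"
      unfolding K_def by (intro add_mono Phi_upper U_add U_diff x y P Q)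
    finally show ?thesis .
  qed
  have "\<Phi> x \<le> (K - 2 * f (Tan S' y)) / 2" if "finite S'" "S' \<noteq> {}" for S'
  proof (rule Phi_least)
    fix S :: "real set" assume "finite S" "S \<noteq> {}"
    from main[OF this that] show "f (Tan S x) \<le> (K - 2 * f (Tan S' y)) / 2" by simp
  qed
  then have "\<Phi> y \<le> (K - 2 * \<Phi> x) / 2"
    by (intro Phi_least) (fastforce simp: field_simps)
  then show ?thesis by (simp add: K_def field_simps)
qed

text \<open>The converse inequality is the first one applied to \<open>x + y\<close> and
  \<open>x - y\<close>, together with \<open>\<Phi> (2 x) \<le> 4 \<Phi> x\<close>.\<close>

lemma Phi_parallelogram:
  assumes x: "x \<in> U" and y: "y \<in> U"
  shows "\<Phi> (x + y) + \<Phi> (x - y) = 2 * \<Phi> x + 2 * \<Phi> y"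
proof (rule antisym[OF _ Phi_parallelogram_le[OF x y]])
  have "(x + y) + (x - y) = 2 *\<^sub>R x" "(x + y) - (x - y) = 2 *\<^sub>R y" by (simp_all add: scaleR_2)
  then have "2 * \<Phi> (x + y) + 2 * \<Phi> (x - y) \<le> \<Phi> (2 *\<^sub>R x) + \<Phi> (2 *\<^sub>R y)"
    using Phi_parallelogram_le[OF U_add[OF x y] U_diff[OF x y]] by simp
  then show "\<Phi> (x + y) + \<Phi> (x - y) \<le> 2 * \<Phi> x + 2 * \<Phi> y"
    using Phi_double_le[OF x] Phi_double_le[OF y] by simp
qed

text \<open>This is Cauchy-Schwarz. The parameter \<open>f \<bar>x\<bar> / f w\<close> maximizes the
  lower bound \<open>2 * \<alpha> * f \<bar>x\<bar> - \<alpha>\<^sup>2 * f w\<close>.\<close>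

lemma Phi_lower:
  assumes "x \<in> U"
  shows "(f \<bar>x\<bar>)\<^sup>2 \<le> \<Phi> x * f w"
proof (cases "f w = 0")
  case True
  obtain r where "\<bar>x\<bar> \<le> r *\<^sub>R w" using assms by (auto simp: principal_ideal_def)
  from dual_nonneg_mono[OF f this] have "f \<bar>x\<bar> \<le> 0" using True by (simp add: blinfun.scaleR_right)
  then show ?thesis using dual_nonnegD[OF f, of "\<bar>x\<bar>"] True by simp
next
  case False
  then have fw: "0 < f w" using dual_nonnegD[OF f w] by simp
  define \<alpha> where "\<alpha> = f \<bar>x\<bar> / f w"
  have \<alpha>: "0 \<le> \<alpha>" using fw dual_nonnegD[OF f, of "\<bar>x\<bar>"] by (simp add: \<alpha>_def)
  have "(2 * \<alpha>) *\<^sub>R \<bar>x\<bar> = sup ((2 * \<alpha>) *\<^sub>R x) ((2 * \<alpha>) *\<^sub>R (- x))"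
    unfolding abs_lattice[of x] by (rule scaleR_sup) (use \<alpha> in simp)
  also have "\<dots> \<le> Tan {\<alpha>, - \<alpha>} x + \<alpha>\<^sup>2 *\<^sub>R w"
    using Tan_upper[of "{\<alpha>, - \<alpha>}" \<alpha> x] Tan_upper[of "{\<alpha>, - \<alpha>}" "- \<alpha>" x]
    by (intro sup_least) (simp_all add: tangent_def diff_le_eq)
  finally have "(2 * \<alpha>) *\<^sub>R \<bar>x\<bar> - \<alpha>\<^sup>2 *\<^sub>R w \<le> Tan {\<alpha>, - \<alpha>} x" by (simp add: diff_le_eq)
  from dual_nonneg_mono[OF f this] have "2 * \<alpha> * f \<bar>x\<bar> - \<alpha>\<^sup>2 * f w \<le> \<Phi> x"
    using Phi_upper[OF assms, of "{\<alpha>, - \<alpha>}"] by (simp add: blinfun.diff_right blinfun.scaleR_right)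
  then show ?thesis using fw by (simp add: \<alpha>_def power2_eq_square field_simps)
qed

text \<open>Since \<open>h + y\<close> has modulus at most \<open>2 r w\<close>, parameters outside
  the interval from \<open>- 2 r\<close> to \<open>2 r\<close> can be moved to its nearer end.
  Replacing \<open>h + y\<close> by \<open>h - y\<close> then changes a tangent by
  \<open>4 \<alpha> y\<close>, which is at most \<open>8 r \<bar>y\<bar>\<close>.\<close>

lemma Phi_diff_le:
  assumes h: "\<bar>h\<bar> \<le> r *\<^sub>R w" and y: "\<bar>y\<bar> \<le> r *\<^sub>R w" and r: "0 < r"
  shows "\<Phi> (h + y) - \<Phi> (h - y) \<le> 8 * r * f \<bar>y\<bar>"
proof -
  have "\<Phi> (h + y) \<le> \<Phi> (h - y) + 8 * r * f \<bar>y\<bar>"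
  proof (rule Phi_least)
    fix S :: "real set" assume S: "finite S" "S \<noteq> {}"
    define c where "c \<alpha> = max (- (2 * r)) (min \<alpha> (2 * r))" for \<alpha>
    have c: "\<bar>c \<alpha>\<bar> \<le> 2 * r" for \<alpha> using r by (auto simp: c_def)
    have "\<bar>h + y\<bar> \<le> r *\<^sub>R w + r *\<^sub>R w" using h y by (meson abs_triangle_ineq add_mono order_trans)
    then have hy: "h + y \<le> (2 * r) *\<^sub>R w" "- (h + y) \<le> (2 * r) *\<^sub>R w"
      unfolding lattice_abs_le_iff by (simp_all flip: scaleR_add_left)
    have clip: "tangent \<alpha> (h + y) \<le> tangent (c \<alpha>) (h + y)" for \<alpha>
    proof -
      have le: "tangent \<alpha> x \<le> tangent \<beta> x" if "(2 * (\<alpha> - \<beta>)) *\<^sub>R x \<le> (\<alpha>\<^sup>2 - \<beta>\<^sup>2) *\<^sub>R w" for x \<beta>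
      proof -
        have "tangent \<alpha> x - tangent \<beta> x = (2 * (\<alpha> - \<beta>)) *\<^sub>R x - (\<alpha>\<^sup>2 - \<beta>\<^sup>2) *\<^sub>R w"
          by (simp add: tangent_def algebra_simps)
        then show ?thesis using that by (metis diff_le_0_iff_le)
      qed
      consider "\<bar>\<alpha>\<bar> \<le> 2 * r" | "2 * r < \<alpha>" | "\<alpha> < - (2 * r)" by linarith
      then show ?thesis
      proof cases
        case 1
        then show ?thesis by (simp add: c_def)
      next
        case 2
        then have "(2 * (\<alpha> - 2 * r)) *\<^sub>R (h + y) \<le> (2 * (\<alpha> - 2 * r)) *\<^sub>R ((2 * r) *\<^sub>R w)"
          by (intro scaleR_left_mono hy) auto
        also have "\<dots> \<le> (\<alpha>\<^sup>2 - (2 * r)\<^sup>2) *\<^sub>R w"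
          unfolding scaleR_scaleR
        proof (intro scaleR_right_mono w)
          have "0 \<le> (\<alpha> - 2 * r)\<^sup>2" by simp
          then show "2 * (\<alpha> - 2 * r) * (2 * r) \<le> \<alpha>\<^sup>2 - (2 * r)\<^sup>2" by (simp add: power2_eq_square algebra_simps)
        qed
        finally have "tangent \<alpha> (h + y) \<le> tangent (2 * r) (h + y)" by (rule le)
        moreover have "c \<alpha> = 2 * r" using 2 r by (simp add: c_def)
        ultimately show ?thesis by (simp only:)
      next
        case 3
        then have "(2 * (- 2 * r - \<alpha>)) *\<^sub>R (- (h + y)) \<le> (2 * (- 2 * r - \<alpha>)) *\<^sub>R ((2 * r) *\<^sub>R w)"
          by (intro scaleR_left_mono hy) auto
        also have "\<dots> \<le> (\<alpha>\<^sup>2 - (2 * r)\<^sup>2) *\<^sub>R w"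
          unfolding scaleR_scaleR
        proof (intro scaleR_right_mono w)
          have "0 \<le> (\<alpha> + 2 * r)\<^sup>2" by simp
          then show "2 * (- 2 * r - \<alpha>) * (2 * r) \<le> \<alpha>\<^sup>2 - (2 * r)\<^sup>2" by (simp add: power2_eq_square algebra_simps)
        qed
        finally have "(2 * (- 2 * r - \<alpha>)) *\<^sub>R (- (h + y)) \<le> (\<alpha>\<^sup>2 - (2 * r)\<^sup>2) *\<^sub>R w" .
        moreover have "(2 * (- 2 * r - \<alpha>)) *\<^sub>R (- (h + y)) = (2 * (\<alpha> - (- 2 * r))) *\<^sub>R (h + y)"
          unfolding scaleR_minus_right scaleR_minus_left[symmetric] by (simp add: algebra_simps)
        moreover have "(2 * r)\<^sup>2 = (- 2 * r)\<^sup>2" by simp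
        ultimately have "tangent \<alpha> (h + y) \<le> tangent (- 2 * r) (h + y)" by (intro le) (simp only:)
        moreover have "c \<alpha> = - 2 * r" using 3 r by (simp add: c_def)
        ultimately show ?thesis by (simp only:)
      qed
    qed
    have shift: "tangent (c \<alpha>) (h + y) \<le> tangent (c \<alpha>) (h - y) + (8 * r) *\<^sub>R \<bar>y\<bar>" for \<alpha>
    proof -
      have "tangent (c \<alpha>) (h + y) = tangent (c \<alpha>) (h - y) + (4 * c \<alpha>) *\<^sub>R y"
        using scaleR_add_left[of "2 * c \<alpha>" "2 * c \<alpha>" y]
        by (simp add: tangent_def scaleR_add_right scaleR_diff_right)
      also have "(4 * c \<alpha>) *\<^sub>R y \<le> \<bar>(4 * c \<alpha>) *\<^sub>R y\<bar>" by (rule abs_ge_self)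
      also have "\<dots> \<le> (8 * r) *\<^sub>R \<bar>y\<bar>"
        unfolding abs_scaleR using c[of \<alpha>] by (intro scaleR_right_mono) (auto simp: abs_mult)
      finally show ?thesis by simp
    qed
    define S' where "S' = c ` S"
    have S': "finite S'" "S' \<noteq> {}" using S by (auto simp: S'_def)
    have "tangent \<alpha> (h + y) \<le> Tan S' (h - y) + (8 * r) *\<^sub>R \<bar>y\<bar>" if "\<alpha> \<in> S" for \<alpha>
    proof -
      have "tangent (c \<alpha>) (h - y) \<le> Tan S' (h - y)" using that by (intro Tan_upper S') (simp add: S'_def)
      then have "tangent (c \<alpha>) (h - y) + (8 * r) *\<^sub>R \<bar>y\<bar> \<le> Tan S' (h - y) + (8 * r) *\<^sub>R \<bar>y\<bar>" by (rule add_right_mono)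
      then show ?thesis using clip[of \<alpha>] shift[of \<alpha>] by (meson order_trans)
    qed
    then have "Tan S (h + y) \<le> Tan S' (h - y) + (8 * r) *\<^sub>R \<bar>y\<bar>" by (intro Tan_least S)
    from dual_nonneg_mono[OF f this] have "f (Tan S (h + y)) \<le> f (Tan S' (h - y)) + 8 * r * f \<bar>y\<bar>"
      by (simp add: blinfun.add_right blinfun.scaleR_right)
    also have "f (Tan S' (h - y)) \<le> \<Phi> (h - y)"
      using h y by (intro Phi_upper S' U_diff) (auto intro: principal_idealI)
    finally show "f (Tan S (h + y)) \<le> \<Phi> (h - y) + 8 * r * f \<bar>y\<bar>" by simp
  qed
  then show ?thesis by simp
qed

text \<open>Polarization of \<open>\<Phi>\<close>; in the function model, the integral of
  \<open>x y / w\<close>.\<close>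

definition B :: "'a \<Rightarrow> 'a \<Rightarrow> real" where "B x y = (\<Phi> (x + y) - \<Phi> (x - y)) / 4"

lemma B_commute:
  assumes "x \<in> U" "y \<in> U"
  shows "B x y = B y x"
proof -
  have "\<Phi> (x - y) = \<Phi> (y - x)"
    using assms by (intro Phi_cong U_diff) (simp_all add: abs_minus_commute)
  then show ?thesis by (simp add: B_def add.commute)
qed

lemma B_self:
  assumes "x \<in> U"
  shows "B x x = \<Phi> x"
proof -
  have "\<Phi> (2 *\<^sub>R x) = 4 * \<Phi> x"
    using Phi_parallelogram[OF assms assms] by (simp add: Phi_zero scaleR_2)
  then show ?thesis by (simp add: B_def Phi_zero scaleR_2)
qed

text \<open>The Jordan-von Neumann argument: the parallelogram law gives the midpoint identity
  \<open>*\<close>, used once for the pair \<open>x\<close>, \<open>x'\<close> and once for their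
  sum and \<open>0\<close>.\<close>

lemma B_add_left:
  assumes x: "x \<in> U" and x': "x' \<in> U" and y: "y \<in> U"
  shows "B (x + x') y = B x y + B x' y"
proof -
  have B_0: "B 0 y = 0"
    using Phi_cong[of y "- y"] U_neg[OF y] by (simp add: B_def)
  have *: "B (a + b) y + B (a - b) y = 2 * B a y" if a: "a \<in> U" and b: "b \<in> U" for a b
  proof -
    have "\<Phi> ((a + b) + y) + \<Phi> ((a - b) + y) = 2 * \<Phi> (a + y) + 2 * \<Phi> b"
      using Phi_parallelogram[OF U_add[OF a y] b] by (simp add: algebra_simps)
    moreover have "\<Phi> ((a + b) - y) + \<Phi> ((a - b) - y) = 2 * \<Phi> (a - y) + 2 * \<Phi> b"
      using Phi_parallelogram[OF U_diff[OF a y] b] by (simp add: algebra_simps)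
    ultimately show ?thesis unfolding B_def by (simp add: field_simps)
  qed
  define a where "a = (1/2) *\<^sub>R (x + x')"
  define b where "b = (1/2) *\<^sub>R (x - x')"
  have ab: "a \<in> U" "b \<in> U" unfolding a_def b_def by (intro U_scale U_add U_diff x x')+
  have "a + b = x" "a - b = x'" "a + a = x + x'"
    unfolding a_def b_def scaleR_add_right[symmetric] scaleR_diff_right[symmetric]
    by (simp_all flip: scaleR_2)
  then show ?thesis using *[OF ab] *[OF ab(1) ab(1)] B_0 by simp
qed

lemma B_add_right: "\<lbrakk>x \<in> U; y \<in> U; y' \<in> U\<rbrakk> \<Longrightarrow> B x (y + y') = B x y + B x y'"
  using B_add_left[of y y' x] by (simp add: B_commute U_add)

lemma B_diff_left: "\<lbrakk>x \<in> U; x' \<in> U; y \<in> U\<rbrakk> \<Longrightarrow> B (x - x') y = B x y - B x' y"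
  using B_add_left[of "x - x'" x' y] by (simp add: U_diff)

lemma B_diff_right: "\<lbrakk>x \<in> U; y \<in> U; y' \<in> U\<rbrakk> \<Longrightarrow> B x (y - y') = B x y - B x y'"
  using B_add_right[of x "y - y'" y'] by (simp add: U_diff)

text \<open>\<open>Phi_diff_le\<close> covers \<open>y\<close> within \<open>r w\<close>; any other
  \<open>y\<close> in the ideal is an integer multiple of such an element, and additivity scales
  back. The constant depends on \<open>h\<close> only, so \<open>B h\<close> is dominated by
  \<open>f\<close>.\<close>

lemma B_bound:
  assumes h: "\<bar>h\<bar> \<le> r *\<^sub>R w" and r: "0 < r" and y: "y \<in> U"
  shows "\<bar>B h y\<bar> \<le> 2 * r * f \<bar>y\<bar>"
proof -
  have hU: "h \<in> U" using h by (rule principal_idealI)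
  have small: "\<bar>B h z\<bar> \<le> 2 * r * f \<bar>z\<bar>" if "\<bar>z\<bar> \<le> r *\<^sub>R w" for z
    using Phi_diff_le[OF h that r] Phi_diff_le[OF h, of "- z"] that r by (simp add: B_def)
  obtain s where s: "0 < s" "\<bar>y\<bar> \<le> s *\<^sub>R w" using U_bound[OF y] by blast
  obtain n :: nat where n: "s / r \<le> real n" using real_arch_simple by blast
  have n0: "0 < real n" using n s(1) r by (meson divide_pos_pos less_le_trans)
  define z where "z = (1 / real n) *\<^sub>R y"
  have zU: "z \<in> U" unfolding z_def by (rule U_scale[OF y])
  have "\<bar>z\<bar> \<le> (1 / real n) *\<^sub>R (s *\<^sub>R w)"
    unfolding z_def abs_scaleR using scaleR_left_mono[OF s(2), of "1 / real n"] by simp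
  also have "\<dots> \<le> r *\<^sub>R w"
    unfolding scaleR_scaleR using n n0 r by (intro scaleR_right_mono w) (simp add: field_simps)
  finally have z: "\<bar>z\<bar> \<le> r *\<^sub>R w" .
  have "B h (real k *\<^sub>R z) = real k * B h z" for k
  proof (induction k)
    case 0
    then show ?case by (simp add: B_def)
  next
    case (Suc k)
    have "B h (real (Suc k) *\<^sub>R z) = B h (real k *\<^sub>R z + z)" by (simp add: scaleR_add_left add.commute)
    also have "\<dots> = B h (real k *\<^sub>R z) + B h z" by (intro B_add_right hU zU U_scale)
    finally show ?case by (simp add: Suc distrib_right)
  qed
  from this[of n] have "B h y = real n * B h z" using n0 by (simp add: z_def)
  moreover have "f \<bar>y\<bar> = real n * f \<bar>z\<bar>"
    using n0 by (simp add: z_def abs_scaleR blinfun.scaleR_right)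
  ultimately show ?thesis
    using mult_left_mono[OF small[OF z], of "real n"] n0 by (simp add: abs_mult mult_ac)
qed

lemma B_scale_right:
  assumes "x \<in> U" "y \<in> U"
  shows "B x (t *\<^sub>R y) = t * B x y"
proof -
  obtain r where r: "0 < r" "\<bar>x\<bar> \<le> r *\<^sub>R w" using U_bound[OF assms(1)] by blast
  have "B x (t *\<^sub>R y) = t * B x (1 *\<^sub>R y)"
  proof (rule additive_bounded_real[of "\<lambda>t. B x (t *\<^sub>R y)" "2 * r * f \<bar>y\<bar>"])
    show "B x ((s + t) *\<^sub>R y) = B x (s *\<^sub>R y) + B x (t *\<^sub>R y)" for s t
      unfolding scaleR_add_left by (intro B_add_right U_scale assms)
    show "\<bar>B x (t *\<^sub>R y)\<bar> \<le> 2 * r * f \<bar>y\<bar> * \<bar>t\<bar>" for t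
      using B_bound[OF r(2,1) U_scale[OF assms(2)], of t]
      by (simp add: abs_scaleR blinfun.scaleR_right mult_ac)
  qed
  then show ?thesis by simp
qed

lemma Phi_diff_scaled:
  assumes x: "x \<in> U" and z: "z \<in> U"
  shows "\<Phi> (z - t *\<^sub>R x) = \<Phi> z - 2 * t * B x z + t\<^sup>2 * \<Phi> x"
proof -
  note tx = U_scale[OF x, of t]
  have "\<Phi> (z - t *\<^sub>R x) = B (z - t *\<^sub>R x) (z - t *\<^sub>R x)" by (intro B_self[symmetric] U_diff z tx)
  also have "\<dots> = B z z - B z (t *\<^sub>R x) - (B (t *\<^sub>R x) z - B (t *\<^sub>R x) (t *\<^sub>R x))"
    using z tx by (simp add: B_diff_left B_diff_right U_diff)
  finally have "\<Phi> (z - t *\<^sub>R x) = B z z - B z (t *\<^sub>R x) - (B (t *\<^sub>R x) z - B (t *\<^sub>R x) (t *\<^sub>R x))" .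
  moreover have "B (t *\<^sub>R x) z = t * B x z" "B z (t *\<^sub>R x) = t * B x z"
    using B_scale_right[OF z x, of t] B_commute[OF tx z] B_commute[OF z x] by simp_all
  moreover have "B (t *\<^sub>R x) (t *\<^sub>R x) = t * (t * B x x)"
    using B_scale_right[OF tx x, of t] B_scale_right[OF x x, of t] B_commute[OF tx x] by simp
  ultimately show ?thesis using x z by (simp add: B_self power2_eq_square)
qed

text \<open>This plays the role of weak sequential compactness of bounded sets in the Hilbert space
  associated with \<open>B\<close>: an element \<open>v\<close> of the span of \<open>h\<close> that is nearly closest to \<open>y\<close> leaves a
  remainder \<open>y - v\<close> that is nearly orthogonal to all \<open>h n\<close>.\<close>

lemma B_convergent_subsequence:
  assumes h: "\<And>n. \<bar>h n\<bar> \<le> r *\<^sub>R w" and r: "0 < r"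
  obtains k :: "nat \<Rightarrow> nat" where "strict_mono k" "\<And>y. y \<in> U \<Longrightarrow> convergent (\<lambda>n. B (h (k n)) y)"
proof -
  have hU: "h n \<in> U" for n by (rule principal_idealI[OF h])
  have M: "norm (B (h n) x) \<le> 2 * r * f (r *\<^sub>R w)" if x: "x \<in> range h" for n x
  proof -
    have "\<bar>B (h n) x\<bar> \<le> 2 * r * f \<bar>x\<bar>" using x by (intro B_bound h r) (auto intro: hU)
    also have "\<dots> \<le> 2 * r * f (r *\<^sub>R w)"
      using x r h by (intro mult_left_mono dual_nonneg_mono[OF f]) auto
    finally show ?thesis by simp
  qed
  \<comment> \<open>A diagonal choice gives convergence against the countably many
    \<open>h m\<close>, and linearity extends it to their span.\<close>
  obtain k where k: "strict_mono k" "\<And>x. x \<in> range h \<Longrightarrow> \<exists>l. (\<lambda>n. B (h (k n)) x) \<longlonglongrightarrow> l"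
    by (rule function_convergent_subsequence[of "range h" "\<lambda>n. B (h n)", OF _ M])
      auto
  define V where "V = span (range h)"
  have V_sub: "V \<subseteq> {v \<in> U. convergent (\<lambda>n. B (h (k n)) v)}"
    unfolding V_def
  proof (rule span_minimal)
    show "range h \<subseteq> {v \<in> U. convergent (\<lambda>n. B (h (k n)) v)}"
      using hU k(2) by (auto simp: convergent_def)
    show "subspace {v \<in> U. convergent (\<lambda>n. B (h (k n)) v)}"
      unfolding subspace_def
    proof (intro conjI ballI allI)
      show "0 \<in> {v \<in> U. convergent (\<lambda>n. B (h (k n)) v)}"
        using U_zero by (simp add: B_def convergent_const)
      show "x + y \<in> {v \<in> U. convergent (\<lambda>n. B (h (k n)) v)}"
        if "x \<in> {v \<in> U. convergent (\<lambda>n. B (h (k n)) v)}" "y \<in> {v \<in> U. convergent (\<lambda>n. B (h (k n)) v)}" for x y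
        using that by (simp add: U_add B_add_right hU convergent_add)
      show "c *\<^sub>R x \<in> {v \<in> U. convergent (\<lambda>n. B (h (k n)) v)}"
        if "x \<in> {v \<in> U. convergent (\<lambda>n. B (h (k n)) v)}" for c x
        using that by (auto simp: U_scale B_scale_right hU intro!: convergent_mult convergent_const)
    qed
  qed
  have "convergent (\<lambda>n. B (h (k n)) y)" if y: "y \<in> U" for y
  proof -
    define d where "d = (INF v\<in>V. \<Phi> (y - v))"
    have V_ne: "V \<noteq> {}" unfolding V_def using span_zero by blast
    have VU: "v \<in> U" if "v \<in> V" for v using V_sub that by auto
    have bdd: "bdd_below ((\<lambda>v. \<Phi> (y - v)) ` V)"
      by (intro bdd_belowI2[of _ 0] Phi_nonneg U_diff y VU)
    define R where "R = r\<^sup>2 * f w + 1"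
    have R: "0 < R" using dual_nonnegD[OF f w] by (simp add: R_def add_nonneg_pos)
    have "Cauchy (\<lambda>n. B (h (k n)) y)"
    proof (rule metric_CauchyI)
      fix e :: real assume e: "0 < e"
      define e' where "e' = (e / 3)\<^sup>2 / R"
      have e': "0 < e'" using e R by (simp add: e'_def)
      then obtain v where v: "v \<in> V" "\<Phi> (y - v) < d + e'"
        using cINF_less_iff[OF V_ne bdd, of "d + e'"] by (auto simp: d_def)
      have vU: "v \<in> U" by (rule VU[OF v(1)])
      have near: "\<bar>B (h n) (y - v)\<bar> < e / 3" for n
      proof -
        define \<beta> where "\<beta> = B (h n) (y - v)"
        \<comment> \<open>The step along \<open>h n\<close> with the largest guaranteed decrease of
          the quadratic form, namely \<open>\<beta>\<^sup>2 / R\<close>. It cannot reach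
          \<open>e'\<close>, since \<open>v\<close> is within \<open>e'\<close> of the infimum;
          hence the choice of \<open>e'\<close>.\<close>
        define t where "t = \<beta> / R"
        have "v + t *\<^sub>R h n \<in> V"
          using v(1) unfolding V_def by (intro span_add span_scale) (auto intro: span_base)
        from cINF_lower[OF bdd this] have "d \<le> \<Phi> (y - v - t *\<^sub>R h n)"
          by (simp add: d_def algebra_simps)
        also have "\<dots> = \<Phi> (y - v) - 2 * t * \<beta> + t\<^sup>2 * \<Phi> (h n)"
          unfolding \<beta>_def by (intro Phi_diff_scaled hU U_diff y vU)
        also have "t\<^sup>2 * \<Phi> (h n) \<le> t\<^sup>2 * R"
          using Phi_le[OF h[of n]] by (intro mult_left_mono) (auto simp: R_def)
        finally have "2 * t * \<beta> - t\<^sup>2 * R < e'" using v(2) by simp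
        moreover have "2 * t * \<beta> - t\<^sup>2 * R = \<beta>\<^sup>2 / R"
          using R by (simp add: t_def power2_eq_square field_simps)
        ultimately have "\<beta>\<^sup>2 < (e / 3)\<^sup>2" using R by (simp add: e'_def divide_less_cancel)
        then show ?thesis using power2_less_imp_less[of "\<bar>\<beta>\<bar>" "e / 3"] e by (simp add: \<beta>_def)
      qed
      have "Cauchy (\<lambda>n. B (h (k n)) v)" using V_sub v(1) by (auto simp: Cauchy_convergent_iff)
      then obtain N where N: "\<And>m n. \<lbrakk>m \<ge> N; n \<ge> N\<rbrakk> \<Longrightarrow> dist (B (h (k m)) v) (B (h (k n)) v) < e / 3"
        using e unfolding Cauchy_def by (metis divide_pos_pos zero_less_numeral)
      have "dist (B (h (k m)) y) (B (h (k n)) y) < e" if "m \<ge> N" "n \<ge> N" for m n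
      proof -
        have "B (h (k i)) y = B (h (k i)) v + B (h (k i)) (y - v)" for i
          using B_add_right[OF hU vU U_diff[OF y vU]] by simp
        then have "B (h (k m)) y - B (h (k n)) y = (B (h (k m)) v - B (h (k n)) v)
            + (B (h (k m)) (y - v) - B (h (k n)) (y - v))" by simp
        moreover have "\<bar>B (h (k m)) v - B (h (k n)) v\<bar> < e / 3"
          using N[OF that] by (simp add: dist_real_def)
        ultimately show ?thesis
          using near[of "k m"] near[of "k n"] unfolding dist_real_def by linarith
      qed
      then show "\<exists>N. \<forall>m\<ge>N. \<forall>n\<ge>N. dist (B (h (k m)) y) (B (h (k n)) y) < e" by blast
    qed
    then show ?thesis by (simp add: Cauchy_convergent_iff)
  qed
  with k(1) that show ?thesis by blast
qed

text \<open>The hypotheses say that \<open>p\<close> has the sign of \<open>q\<close> and no larger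
  modulus, so \<open>2 p - q\<close> has modulus at most \<open>\<bar>q\<bar>\<close>. As
  \<open>q\<close> and \<open>2 p - q\<close> are, up to sign, the sum and difference of
  \<open>p\<close> and \<open>q - p\<close>, monotonicity of \<open>\<Phi>\<close> gives
  \<open>B p (q - p) \<ge> 0\<close>.\<close>

lemma Phi_le_B:
  assumes q: "q \<in> U" and p: "p \<le> pprt q" "- p \<le> pprt (- q)"
  shows "\<Phi> p \<le> B p q"
proof -
  have "\<bar>p\<bar> \<le> \<bar>q\<bar>"
    unfolding lattice_abs_le_iff using p pprt_le_abs[of q] pprt_uminus_le_abs[of q] by (meson order_trans)
  then have pU: "p \<in> U" using q by (auto simp: principal_ideal_def intro: order_trans)
  have N: "pprt (- q) = pprt q - q" using eq_pprt_diff[of q] by (metis add_diff_cancel_left' diff_add_cancel)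
  have "p + p \<le> pprt q + pprt q" "(- p) + (- p) \<le> pprt (- q) + pprt (- q)" by (intro add_mono p)+
  then have "p + p - q \<le> pprt q + pprt q - q" "(- p) + (- p) + q \<le> pprt (- q) + pprt (- q) + q"
    by (simp_all only: diff_right_mono add_right_mono)
  moreover have "pprt q + pprt q - q = \<bar>q\<bar>" "pprt (- q) + pprt (- q) + q = \<bar>q\<bar>"
    unfolding abs_eq_pprt_add N by simp_all
  moreover have "p - (q - p) = p + p - q" "- (p - (q - p)) = (- p) + (- p) + q" by simp_all
  ultimately have "p - (q - p) \<le> \<bar>q\<bar>" "- (p - (q - p)) \<le> \<bar>q\<bar>" by (simp_all only:)
  then have "\<Phi> (p - (q - p)) \<le> \<Phi> q" by (intro Phi_mono q) (simp only: lattice_abs_le_iff)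
  then have "0 \<le> B p (q - p)" by (simp add: B_def)
  then show ?thesis using B_diff_right[OF pU q pU] B_self[OF pU] by simp
qed

end

section \<open>Super weakly precompact sets are totally bounded\<close>

definition clip :: "'a::banach_lattice \<Rightarrow> 'a \<Rightarrow> 'a" where
  "clip u x = sup (- u) (inf x u)"

lemma abs_clip_le:
  assumes "0 \<le> u"
  shows "\<bar>clip u x\<bar> \<le> u"
proof -
  have "- u \<le> u" using assms by (meson neg_le_0_iff_le order_trans)
  then have "clip u x \<le> u" "- u \<le> clip u x" by (simp_all add: clip_def)
  then show ?thesis unfolding lattice_abs_le_iff by (simp add: minus_le_iff)
qed

lemma clip_diff_le: "clip u a - clip u b \<le> pprt (a - b)"
proof -
  define c where "c = pprt (a - b)"
  have c: "0 \<le> c" by (simp add: c_def)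
  have "a \<le> b + c" using le_pprt[of "a - b"] by (simp add: c_def diff_le_eq add.commute)
  then have "inf a u \<le> inf (b + c) (u + c)" using c by (intro inf_mono) auto
  also have "\<dots> = inf b u + c" by (simp add: add_inf_distrib_right)
  finally have "clip u a \<le> sup (- u + c) (inf b u + c)"
    unfolding clip_def using c by (intro sup_mono) auto
  also have "\<dots> = clip u b + c" by (simp add: clip_def add_sup_distrib_right)
  finally show ?thesis by (simp add: c_def diff_le_eq add.commute)
qed

lemma abs_diff_clip_le: "\<bar>x - clip u x\<bar> \<le> pprt (\<bar>x\<bar> - u)"
  unfolding lattice_abs_le_iff
proof
  have "inf x u \<le> clip u x" by (simp add: clip_def)
  then have "x - clip u x \<le> x - inf x u" by (rule diff_left_mono)
  also have "\<dots> = pprt (x - u)" using inf_eq_diff_pprt[of x u] by simp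
  also have "\<dots> \<le> pprt (\<bar>x\<bar> - u)" by (intro pprt_diff_mono abs_ge_self order_refl)
  finally show "x - clip u x \<le> pprt (\<bar>x\<bar> - u)" .
  have "- u \<le> x + pprt (\<bar>x\<bar> - u)"
  proof -
    have "- x \<le> u + (\<bar>x\<bar> - u)" by (simp add: abs_ge_minus_self)
    also have "\<dots> \<le> u + pprt (\<bar>x\<bar> - u)" by (intro add_left_mono le_pprt)
    finally have "- (u + pprt (\<bar>x\<bar> - u)) \<le> x" by (simp only: minus_le_iff[of x])
    then show ?thesis by (simp add: algebra_simps)
  qed
  moreover have "inf x u \<le> x + pprt (\<bar>x\<bar> - u)" by (simp add: le_infI1)
  ultimately have "clip u x \<le> x + pprt (\<bar>x\<bar> - u)" by (simp add: clip_def)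
  then show "- (x - clip u x) \<le> pprt (\<bar>x\<bar> - u)" by (simp add: diff_le_eq add.commute)
qed

text \<open>Writing \<open>g n\<close> for the functional \<open>B (p n) \<cdot>\<close> with \<open>p n\<close> the difference of consecutive terms
  of \<open>clip u (x (k n))\<close>, monotonicity of clipping bounds \<open>g n\<close> from below on the corresponding
  difference of the unclipped terms.\<close>

lemma clipped_separated_functionals:
  assumes f: "dual_le 0 f" and x: "bounded (range x)" and u: "0 \<le> u" and d: "0 < d"
    and sep: "\<And>m n. m < n \<Longrightarrow> d \<le> f \<bar>clip u (x n) - clip u (x m)\<bar>"
  obtains g :: "nat \<Rightarrow> 'a::banach_lattice \<Rightarrow>\<^sub>L real" and k :: "nat \<Rightarrow> nat" and C c
  where "\<And>n z. \<bar>g n z\<bar> \<le> C * f \<bar>z\<bar>" "\<And>z. (\<lambda>n. g n z) \<longlonglongrightarrow> 0" "0 < c"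
    "\<And>n. c \<le> g n (x (k n) - x (k (Suc n)))"
proof -
  obtain K where "\<And>n. norm (x n) \<le> K" using x unfolding bounded_iff by blast
  then have sm: "summable (\<lambda>n. (1/2)^n *\<^sub>R \<bar>x n\<bar>)"
    by (intro summable_scaled_bounded) (simp add: norm_abs)
  have term0: "0 \<le> (1/2)^n *\<^sub>R \<bar>x n\<bar>" for n :: nat by (simp add: scaleR_nonneg_nonneg)
  define s where "s = (\<Sum>n. (1/2)^n *\<^sub>R \<bar>x n\<bar>)"
  have s0: "0 \<le> s" unfolding s_def by (rule suminf_nonneg_lattice[OF sm term0])
  \<comment> \<open>The summand \<open>s\<close> puts every \<open>x n\<close> into the ideal, with
    a factor depending on \<open>n\<close>; the summand \<open>u\<close> bounds all clipped terms by
    \<open>w\<close> itself.\<close>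
  define w where "w = u + s"
  have uw: "u \<le> w" "s \<le> w" and w: "0 \<le> w" using u s0 by (auto simp: w_def)
  interpret weighted_functional f w by unfold_locales (rule f w)+
  have xU: "x n \<in> U" for n
  proof (rule principal_idealI)
    have "(1/2)^n *\<^sub>R \<bar>x n\<bar> \<le> w"
      using term_le_suminf[OF sm term0, of n] uw(2) unfolding s_def by (rule order_trans)
    then have "2^n *\<^sub>R ((1/2)^n *\<^sub>R \<bar>x n\<bar>) \<le> 2^n *\<^sub>R w" by (intro scaleR_left_mono) auto
    then show "\<bar>x n\<bar> \<le> 2^n *\<^sub>R w" by (simp add: power_one_over)
  qed
  define h where "h n = clip u (x n)" for n
  have h: "\<bar>h n\<bar> \<le> 1 *\<^sub>R w" for n
    using order_trans[OF abs_clip_le[OF u] uw(1)] by (simp add: h_def)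
  have hU: "h n \<in> U" for n by (rule principal_idealI[OF h])
  obtain k where k: "strict_mono k" "\<And>y. y \<in> U \<Longrightarrow> convergent (\<lambda>n. B (h (k n)) y)"
    using B_convergent_subsequence[of h 1, OF h] by auto
  define p where "p n = h (k n) - h (k (Suc n))" for n
  have pU: "p n \<in> U" for n unfolding p_def by (intro U_diff hU)
  have p: "\<bar>p n\<bar> \<le> 2 *\<^sub>R w" for n
    unfolding p_def using order_trans[OF abs_triangle_ineq4 add_mono[OF h h]] by (simp add: scaleR_2)
  have p_null: "(\<lambda>n. B (p n) y) \<longlonglongrightarrow> 0" if y: "y \<in> U" for y
  proof -
    obtain l where l: "(\<lambda>n. B (h (k n)) y) \<longlonglongrightarrow> l" using k(2)[OF y] by (auto simp: convergent_def)
    from tendsto_diff[OF l LIMSEQ_Suc[OF l]] show ?thesis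
      by (simp add: p_def B_diff_left hU y)
  qed
  \<comment> \<open>The constant \<open>4\<close> is \<open>2 * r\<close> in \<open>B_bound\<close>
    with the bound \<open>r = 2\<close> for \<open>p n\<close>.\<close>
  have "\<exists>g :: 'a \<Rightarrow>\<^sub>L real. (\<forall>y\<in>U. g y = B (p n) y) \<and> (\<forall>y. \<bar>g y\<bar> \<le> 4 * component f w \<bar>y\<bar>)" for n
  proof (rule ex_extension[of "B (p n)" 4])
    show "\<bar>B (p n) y\<bar> \<le> 4 * f \<bar>y\<bar>" if "y \<in> U" for y using B_bound[OF p _ that] by simp
  qed (auto intro: B_add_right pU)
  then obtain g :: "nat \<Rightarrow> 'a \<Rightarrow>\<^sub>L real" where g: "\<And>n y. y \<in> U \<Longrightarrow> g n y = B (p n) y"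
    "\<And>n y. \<bar>g n y\<bar> \<le> 4 * component f w \<bar>y\<bar>" by metis
  have g_bd: "\<bar>g n z\<bar> \<le> 4 * f \<bar>z\<bar>" for n z
    using g(2)[of n z] component_le[OF f w, of "\<bar>z\<bar>"] by simp
  \<comment> \<open>The bound by the component makes the error of truncating \<open>z\<close> small
    uniformly in \<open>n\<close>; a bound by \<open>f\<close> would not, as truncations need not
    approach \<open>z\<close> for \<open>f\<close>.\<close>
  have g_null: "(\<lambda>n. g n z) \<longlonglongrightarrow> 0" for z
  proof (rule LIMSEQ_I)
    fix e :: real assume e: "0 < e"
    have "(\<lambda>m. 4 * component f w \<bar>z - truncate m z\<bar>) \<longlonglongrightarrow> 4 * 0"
      by (intro tendsto_intros truncate_tendsto)
    then have "\<forall>\<^sub>F m in sequentially. 4 * component f w \<bar>z - truncate m z\<bar> < e / 2"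
      by (rule order_tendstoD(2)) (use e in simp)
    then obtain m where m: "4 * component f w \<bar>z - truncate m z\<bar> < e / 2"
      using eventually_happens trivial_limit_sequentially by blast
    obtain N where N: "\<And>n. n \<ge> N \<Longrightarrow> norm (B (p n) (truncate m z) - 0) < e / 2"
      using LIMSEQ_D[OF p_null[OF truncate_in_U], of "e / 2" m z] e by auto
    have "norm (g n z - 0) < e" if "n \<ge> N" for n
    proof -
      have "g n z = B (p n) (truncate m z) + g n (z - truncate m z)"
        using g(1)[OF truncate_in_U, of n m z] by (simp add: blinfun.diff_right)
      then show ?thesis using g(2)[of n "z - truncate m z"] m N[OF that] by simp
    qed
    then show "\<exists>N. \<forall>n\<ge>N. norm (g n z - 0) < e" by blast
  qed
  have kk: "k n < k (Suc n)" for n using k(1) by (simp add: strict_mono_Suc_iff)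
  have fp: "d \<le> f \<bar>p n\<bar>" for n
    using sep[OF kk, of n] by (simp add: p_def h_def abs_minus_commute)
  have fw: "0 < f w"
  proof -
    have "f \<bar>p 0\<bar> \<le> 2 * f w" using dual_nonneg_mono[OF f p[of 0]] by (simp add: blinfun.scaleR_right)
    then show ?thesis using fp[of 0] d by linarith
  qed
  show ?thesis
  proof (rule that[of g 4 "d\<^sup>2 / f w" k])
    show "\<bar>g n z\<bar> \<le> 4 * f \<bar>z\<bar>" for n z by (rule g_bd)
    show "(\<lambda>n. g n z) \<longlonglongrightarrow> 0" for z by (rule g_null)
    show "0 < d\<^sup>2 / f w" using d fw by simp
    fix n
    define q where "q = x (k n) - x (k (Suc n))"
    have qU: "q \<in> U" unfolding q_def by (intro U_diff xU)
    have "p n \<le> pprt q" unfolding p_def h_def q_def by (rule clip_diff_le)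
    moreover have "- p n \<le> pprt (- q)"
      unfolding p_def h_def q_def minus_diff_eq by (rule clip_diff_le)
    ultimately have "\<Phi> (p n) \<le> B (p n) q" by (rule Phi_le_B[OF qU])
    moreover have "d\<^sup>2 \<le> (f \<bar>p n\<bar>)\<^sup>2" using fp d by (intro power_mono) auto
    moreover have "(f \<bar>p n\<bar>)\<^sup>2 \<le> \<Phi> (p n) * f w" by (rule Phi_lower[OF pU])
    ultimately have "d\<^sup>2 \<le> B (p n) q * f w" using fw by (meson mult_right_mono less_imp_le order_trans)
    then show "d\<^sup>2 / f w \<le> g n (x (k n) - x (k (Suc n)))"
      using fw g(1)[OF qU] by (simp add: pos_divide_le_eq q_def)
  qed
qed

lemma super_weakly_precompact_imp_net:
  fixes A :: "'a::banach_lattice set"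
  assumes A: "super_weakly_precompact A" and f: "dual_le 0 f" and e: "0 < e"
  shows "\<exists>\<Phi>. finite \<Phi> \<and> \<Phi> \<subseteq> A \<and> (\<forall>a\<in>A. \<exists>\<phi>\<in>\<Phi>. f \<bar>a - \<phi>\<bar> < e)"
proof (rule ccontr)
  assume neg: "\<not> ?thesis"
  interpret lattice_seminorm "\<lambda>x. f \<bar>x\<bar>" "norm f" by (rule lattice_seminorm_functional[OF f])
  have bA: "bounded A" using A by (simp add: super_weakly_precompact_def)
  have "\<exists>x. \<forall>n::nat. x n \<in> A \<and> (\<forall>m<n. e \<le> f \<bar>x n - x m\<bar>)"
  proof (rule dependent_wellorder_choice)
    fix n :: nat and x assume x: "\<And>m. m < n \<Longrightarrow> x m \<in> A \<and> (\<forall>i<m. e \<le> f \<bar>x m - x i\<bar>)"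
    then have "finite (x ` {..<n})" "x ` {..<n} \<subseteq> A" by auto
    then obtain a where "a \<in> A" "\<And>\<phi>. \<phi> \<in> x ` {..<n} \<Longrightarrow> \<not> f \<bar>a - \<phi>\<bar> < e" using neg by metis
    then show "\<exists>a. a \<in> A \<and> (\<forall>m<n. e \<le> f \<bar>a - x m\<bar>)" by (auto simp: not_less)
  qed auto
  then obtain x where x: "\<And>n::nat. x n \<in> A" "\<And>m n. m < n \<Longrightarrow> e \<le> f \<bar>x n - x m\<bar>" by blast
  show False
  \<comment> \<open>Clipping at such a \<open>u\<close> moves each of two terms by less than
    \<open>e / 4\<close>, so separation by \<open>e / 2\<close> remains.\<close>
  proof (cases "\<exists>u\<ge>0. \<forall>a\<in>A. f (pprt (\<bar>a\<bar> - u)) < e / 4")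
    case True
    then obtain u where u: "0 \<le> u" "\<And>a. a \<in> A \<Longrightarrow> f (pprt (\<bar>a\<bar> - u)) < e / 4" by blast
    have "bounded (range x)" using bounded_subset[OF bA] x(1) by blast
    moreover have "e / 2 \<le> f \<bar>clip u (x n) - clip u (x m)\<bar>" if "m < n" for m n
    proof -
      define r where "r i = x i - clip u (x i)" for i
      have r: "f \<bar>r i\<bar> < e / 4" for i
        using dual_nonneg_mono[OF f abs_diff_clip_le[of "x i" u]] u(2)[OF x(1)[of i]] by (simp add: r_def)
      have "x n - x m = (clip u (x n) - clip u (x m)) + (r n - r m)" by (simp add: r_def)
      then have "f \<bar>x n - x m\<bar> \<le> f \<bar>clip u (x n) - clip u (x m)\<bar> + f \<bar>r n - r m\<bar>"
        using subadd[of "clip u (x n) - clip u (x m)" "r n - r m"] by simp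
      moreover have "f \<bar>r n - r m\<bar> \<le> f \<bar>r n\<bar> + f \<bar>r m\<bar>" using subadd[of "r n" "- r m"] by simp
      ultimately show ?thesis using r[of n] r[of m] x(2)[OF that] by linarith
    qed
    ultimately obtain g :: "nat \<Rightarrow> 'a \<Rightarrow>\<^sub>L real" and k C c where
      g: "\<And>n z. \<bar>g n z\<bar> \<le> C * f \<bar>z\<bar>" "\<And>z. (\<lambda>n. g n z) \<longlonglongrightarrow> 0"
      and c: "0 < c" "\<And>n. c \<le> g n (x (k n) - x (k (Suc n)))"
      using clipped_separated_functionals[OF f _ u(1) half_gt_zero[OF e], of x] by metis
    obtain N where N: "\<forall>n\<ge>N. \<forall>a\<in>A. \<bar>g n a\<bar> < c / 2"
      using super_weakly_precompact_uniform_null[OF A f g half_gt_zero[OF c(1)]] by blast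
    then have "\<bar>g N (x (k N))\<bar> < c / 2" "\<bar>g N (x (k (Suc N)))\<bar> < c / 2" using x(1) by auto
    then show False using c(2)[of N] by (simp add: blinfun.diff_right)
  next
    case False
    then have "\<exists>a\<in>A. e / 4 \<le> f \<bar>pprt (\<bar>a\<bar> - u)\<bar>" if "0 \<le> u" for u
      using that by (auto simp: not_less)
    then obtain a y where a: "\<And>n. a n \<in> A" and y: "disjoint_seq y" "\<And>n. 0 \<le> y n"
      "\<And>n. y n \<le> \<bar>a n\<bar>" "\<And>n. e / 4 / 2 \<le> f \<bar>y n\<bar>"
      using disjoint_subsequence[OF bA, of "e / 4"] e by (metis divide_pos_pos zero_less_numeral)
    \<comment> \<open>Disjointification has halved \<open>e / 4\<close>; choosing a sign in
      \<open>disjoint_components\<close> halves it again, hence \<open>e / 16\<close>.\<close>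
    have "e / 8 \<le> f (y n)" for n using y(4)[of n] y(2)[of n] by simp
    then obtain g :: "nat \<Rightarrow> 'a \<Rightarrow>\<^sub>L real" where g: "\<And>n z. \<bar>g n z\<bar> \<le> f \<bar>z\<bar>" "\<And>z. (\<lambda>n. g n z) \<longlonglongrightarrow> 0"
      "\<And>n. e / 8 / 2 \<le> \<bar>g n (a n)\<bar>"
      using disjoint_components[OF f y(1-3)] by metis
    have "\<exists>N. \<forall>n\<ge>N. \<forall>a\<in>A. \<bar>g n a\<bar> < e / 16"
      by (rule super_weakly_precompact_uniform_null[OF A f, of g 1]) (use g e in auto)
    then obtain N where "\<bar>g N (a N)\<bar> < e / 16" using a by blast
    then show False using g(3)[of N] by simp
  qed
qed

theorem theorem2p10:
  fixes A :: "'a::banach_lattice set"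
  assumes "bounded A"
  shows "super_weakly_precompact A \<longleftrightarrow> abs_weak_totally_bounded A"
proof
  assume "abs_weak_totally_bounded A"
  then show "super_weakly_precompact A"
    using assms abs_weak_totally_bounded_imp_compact by (auto simp: super_weakly_precompact_def)
next
  assume A: "super_weakly_precompact A"
  show "abs_weak_totally_bounded A"
    unfolding abs_weak_totally_bounded_def
  proof (intro allI impI)
    fix e :: real and F :: "('a \<Rightarrow>\<^sub>L real) set"
    assume e: "0 < e" and F: "finite F"
    \<comment> \<open>One positive functional dominates all seminorms from \<open>F\<close>, so a
      net for it serves them all.\<close>
    define f where "f = (\<Sum>h\<in>F. dual_modulus h)"
    have "dual_le 0 f" unfolding f_def by (intro dual_nonneg_sum dual_nonneg_modulus)
    from super_weakly_precompact_imp_net[OF A this e] obtain \<Phi> where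
      \<Phi>: "finite \<Phi>" "\<Phi> \<subseteq> A" "\<forall>a\<in>A. \<exists>\<phi>\<in>\<Phi>. f \<bar>a - \<phi>\<bar> < e" by blast
    have "A \<subseteq> \<Phi> + (\<Inter>h\<in>F. {x. abs_weak_seminorm h x < e})"
    proof
      fix a assume "a \<in> A"
      then obtain \<phi> where \<phi>: "\<phi> \<in> \<Phi>" "f \<bar>a - \<phi>\<bar> < e" using \<Phi>(3) by blast
      have "abs_weak_seminorm h (a - \<phi>) < e" if "h \<in> F" for h
      proof -
        have "dual_modulus h \<bar>a - \<phi>\<bar> \<le> (\<Sum>h\<in>F. dual_modulus h \<bar>a - \<phi>\<bar>)"
          by (rule member_le_sum[OF that _ F]) (simp add: dual_nonnegD[OF dual_nonneg_modulus])
        then show ?thesis using \<phi>(2) by (simp add: f_def abs_weak_seminorm_def blinfun.sum_left)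
      qed
      then have "\<phi> + (a - \<phi>) \<in> \<Phi> + (\<Inter>h\<in>F. {x. abs_weak_seminorm h x < e})"
        by (intro set_plus_intro \<phi>(1)) auto
      then show "a \<in> \<Phi> + (\<Inter>h\<in>F. {x. abs_weak_seminorm h x < e})" by simp
    qed
    with \<Phi> show "\<exists>\<Phi>. finite \<Phi> \<and> \<Phi> \<subseteq> A \<and> A \<subseteq> \<Phi> + (\<Inter>h\<in>F. {x. abs_weak_seminorm h x < e})" by blast
  qed
qed

end
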